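(* For any scalars $\varepsilon_0,\varepsilon_1\in\{1,-1\}$ the following hold. (i) Let $V$ be a finite-dimensional irreducible $U_q(\widehat{\mathfrak{sl}}_2)^{\geq0}$-module of type $(\varepsilon_0,\varepsilon_1)$. Then the action of $U_q(\widehat{\mathfrak{sl}}_2)^{\geq0}$ on $V$ extends uniquely to an action of $U_q(\widehat{\mathfrak{sl}}_2)$ on $V$. The resulting $U_q(\widehat{\mathfrak{sl}}_2)$-module structure on $V$ is irreducible and of type $(\varepsilon_0,\varepsilon_1)$. (ii) Let $V$ be a finite-dimensional irreducible $U_q(\widehat{\mathfrak{sl}}_2)$-module of type $(\varepsilon_0,\varepsilon_1)$. When the $U_q(\widehat{\mathfrak{sl}}_2)$-action is restricted to $U_q(\widehat{\mathfrak{sl}}_2)^{\geq0}$, the resulting $U_q(\widehat{\mathfrak{sl}}_2)^{\geq0}$-module structure on $V$ is irreducible and of type $(\varepsilon_0,\varepsilon_1)$.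
   Context: $\mathbb F$ is an algebraically closed field, and $q\in\mathbb F$ is nonzero and not a root of unity. $[n]=\frac{q^n-q^{-n}}{q-q^{-1}}$. $U_q(\widehat{\mathfrak{sl}}_2)$ is the unital associative $\mathbb F$-algebra with generators $e_i^{\pm},K_i^{\pm1}$ ($i\in\{0,1\}$) and relations: $K_iK_i^{-1}=K_i^{-1}K_i=1$; $K_0K_1=K_1K_0$; $K_ie_i^{\pm}K_i^{-1}=q^{\pm2}e_i^{\pm}$; $K_ie_j^{\pm}K_i^{-1}=q^{\mp2}e_j^{\pm}$ for $i\ne j$; $[e_i^+,e_i^-]=\frac{K_i-K_i^{-1}}{q-q^{-1}}$; $[e_0^{\pm},e_1^{\mp}]=0$; $(e_i^{\pm})^3e_j^{\pm}-[3](e_i^{\pm})^2e_j^{\pm}e_i^{\pm}+[3]e_i^{\pm}e_j^{\pm}(e_i^{\pm})^2-e_j^{\pm}(e_i^{\pm})^3=0$ for $i\neq j$. (Here $[x,y]=xy-yx$ for algebra elements.) The Borel subalgebra $U_q(\widehat{\mathfrak{sl}}_2)^{\geq0}$ is the subalgebra of $U_q(\widehat{\mathfrak{sl}}_2)$ generated by $e_i^+,K_i^{\pm1}$ ($i\in\{0,1\}$). Type of a $U_q(\widehat{\mathfrak{sl}}_2)$-module: on any finite-dimensional irreducible $U_q(\widehat{\mathfrak{sl}}_2)$-module $V$, it is known that $K_0,K_1$ act semisimply and there are an integer $d\ge0$ and $\varepsilon_0,\varepsilon_1\in\{1,-1\}$ such that the set of distinct eigenvalues of $K_0$ on $V$ is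 $\{\varepsilon_0q^{2i-d}\mid 0\le i\le d\}$ and $K_0K_1-\varepsilon_0\varepsilon_1I$ vanishes on $V$; the pair $(\varepsilon_0,\varepsilon_1)$ is called the type of $V$. (If $\mathbb F$ has characteristic 2, $\{1,-1\}$ is viewed as having a single element.) Type of a $U_q(\widehat{\mathfrak{sl}}_2)^{\geq0}$-module: for a finite-dimensional irreducible $U_q(\widehat{\mathfrak{sl}}_2)^{\geq0}$-module $V$, the central element $K_0K_1$ acts as a scalar $\gamma$, and there exist a nonzero $\alpha\in\mathbb F$, an integer $d\ge0$ and a direct sum decomposition $V=U_0\oplus\cdots\oplus U_d$ into nonzero subspaces with $(K_0-\alpha q^{2i-d}I)U_i=0$ for $0\le i\le d$; then, with $\beta=\gamma\alpha^{-1}$, $(K_1-\beta q^{d-2i}I)U_i=0$ for $0\le i\le d$. The pair $(\alpha,\beta)$ is called the type of $V$. *)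

theory Defs
  imports
    "HOL-Library.Poly_Mapping"
    "HOL-Algebra.QuotRing"
    "HOL-Algebra.Generated_Rings"
    "HOL-Algebra.Algebraic_Closure_Type"
begin

section \<open>Free associative algebras\<close>

text \<open>
  The product of \<^typ>\<open>'a \<Rightarrow>\<^sub>0 'b\<close> is convolution with respect to addition on \<^typ>\<open>'a\<close>. Taking the
  free monoid, written additively, for \<^typ>\<open>'a\<close>, we obtain the free unital associative algebra.
\<close>

datatype 'g free_monoid = Word "'g list"

instantiation free_monoid :: (type) monoid_add
begin

definition zero_free_monoid :: "'a free_monoid" where
  "0 = Word []"

fun plus_free_monoid :: "'a free_monoid \<Rightarrow> 'a free_monoid \<Rightarrow> 'a free_monoid" where
  "Word xs + Word ys = Word (xs @ ys)"

instance
proof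
  fix a b c :: "'a free_monoid"
  show "a + b + c = a + (b + c)" by (cases a; cases b; cases c) simp
  show "0 + a = a" by (cases a) (simp add: zero_free_monoid_def)
  show "a + 0 = a" by (cases a) (simp add: zero_free_monoid_def)
qed

end

type_synonym ('g, 'f) free_algebra = "'g free_monoid \<Rightarrow>\<^sub>0 'f"

definition fa_gen :: "'g \<Rightarrow> ('g, 'f::field) free_algebra" where
  "fa_gen g = Poly_Mapping.single (Word [g]) 1"

definition fa_const :: "'f::field \<Rightarrow> ('g, 'f) free_algebra" where
  "fa_const c = Poly_Mapping.single 0 c"


section \<open>The quantum affine algebra\<close>

datatype node = N0 | N1

datatype sign = Pos | Neg

primrec opp :: "sign \<Rightarrow> sign" where
  "opp Pos = Neg" | "opp Neg = Pos"

primrec sgn_int :: "sign \<Rightarrow> int" where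
  "sgn_int Pos = 1" | "sgn_int Neg = -1"

text \<open>\<open>E s i\<close> stands for $e_i^{s}$, and \<open>K s i\<close> for $K_i^{s1}$.\<close>

datatype uq_gen = E sign node | K sign node

definition qint :: "'f::field \<Rightarrow> int \<Rightarrow> 'f" where
  "qint q n = (q powi n - q powi (-n)) / (q - inverse q)"

text \<open>The defining relations, each written as an element of the free algebra that is to vanish.\<close>

definition uq_relations :: "'f::field \<Rightarrow> (uq_gen, 'f) free_algebra set" where
  "uq_relations q =
    (let e = (\<lambda>s i. fa_gen (E s i)); k = (\<lambda>s i. fa_gen (K s i)); c = fa_const in
      {k s i * k (opp s) i - 1 | s i. True}
    \<union> {k Pos N0 * k Pos N1 - k Pos N1 * k Pos N0}
    \<union> {k Pos i * e s i * k Neg i - c (q powi (2 * sgn_int s)) * e s i | s i. True}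
    \<union> {k Pos i * e s j * k Neg i - c (q powi (- 2 * sgn_int s)) * e s j | s i j. i \<noteq> j}
    \<union> {e Pos i * e Neg i - e Neg i * e Pos i
          - c (inverse (q - inverse q)) * (k Pos i - k Neg i) | i. True}
    \<union> {e s N0 * e (opp s) N1 - e (opp s) N1 * e s N0 | s. True}
    \<union> {e s i ^ 3 * e s j - c (qint q 3) * e s i ^ 2 * e s j * e s i
          + c (qint q 3) * e s i * e s j * e s i ^ 2 - e s j * e s i ^ 3 | s i j. i \<noteq> j})"

definition uq_ideal :: "'f::field \<Rightarrow> (uq_gen, 'f) free_algebra set" where
  "uq_ideal q = genideal ring_of_type_algebra (uq_relations q)"

definition uq :: "'f::field \<Rightarrow> (uq_gen, 'f) free_algebra set ring" where
  "uq q = ring_of_type_algebra Quot (uq_ideal q)"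

definition uq_class :: "'f::field \<Rightarrow> (uq_gen, 'f) free_algebra \<Rightarrow> (uq_gen, 'f) free_algebra set" where
  "uq_class q a = uq_ideal q +>\<^bsub>ring_of_type_algebra\<^esub> a"

definition uq_const :: "'f::field \<Rightarrow> 'f \<Rightarrow> (uq_gen, 'f) free_algebra set" where
  "uq_const q c = uq_class q (fa_const c)"

definition uq_E :: "'f::field \<Rightarrow> sign \<Rightarrow> node \<Rightarrow> (uq_gen, 'f) free_algebra set" where
  "uq_E q s i = uq_class q (fa_gen (E s i))"

definition uq_K :: "'f::field \<Rightarrow> sign \<Rightarrow> node \<Rightarrow> (uq_gen, 'f) free_algebra set" where
  "uq_K q s i = uq_class q (fa_gen (K s i))"

text \<open>
  The subalgebra generated by a set is the subring generated by that set and the scalars.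
\<close>

definition borel_carrier :: "'f::field \<Rightarrow> (uq_gen, 'f) free_algebra set set" where
  "borel_carrier q = generate_ring (uq q)
     (range (uq_const q) \<union> range (uq_E q Pos) \<union> {uq_K q s i | s i. True})"

definition borel :: "'f::field \<Rightarrow> (uq_gen, 'f) free_algebra set ring" where
  "borel q = (uq q)\<lparr>carrier := borel_carrier q\<rparr>"

lemma ring_free_algebra: "ring (ring_of_type_algebra :: ('g, 'f::field) free_algebra ring)"
proof -
  have "\<exists>y. x + y = 0" "\<exists>y. y + x = 0" for x :: "('g, 'f) free_algebra"
    using add.right_inverse add.left_inverse by blast+
  then show ?thesis
    unfolding ring_of_type_algebra_def
    by unfold_locales (auto simp: algebra_simps Units_def)
qed

lemma ideal_uq_ideal: "ideal (uq_ideal q) ring_of_type_algebra"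
  unfolding uq_ideal_def
  by (rule ring.genideal_ideal[OF ring_free_algebra]) (simp add: ring_of_type_algebra_def)

lemma ring_uq: "ring (uq q)"
  unfolding uq_def by (rule ideal.quotient_is_ring[OF ideal_uq_ideal])

lemma uq_class_closed: "uq_class q a \<in> carrier (uq q)"
  by (auto simp: uq_class_def uq_def FactRing_def A_RCOSETS_def' a_r_coset_def'
      ring_of_type_algebra_def)

lemma subring_borel_carrier: "subring (borel_carrier q) (uq q)"
  unfolding borel_carrier_def
  by (rule ring.generate_ring_is_subring[OF ring_uq])
    (auto simp: uq_const_def uq_E_def uq_K_def uq_class_closed)

lemma ring_borel: "ring (borel q)"
  unfolding borel_def
  by (metis ring.subring_iff ring_uq subring_borel_carrier subringE(1))


section \<open>Modules\<close>

text \<open>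
  A module over an algebra with underlying ring \<open>R\<close> and structure map \<open>c\<close> from the field
  into \<open>R\<close>, on the vector space given by the scalar multiplication \<open>scale\<close>. Only the values of
  \<open>\<rho>\<close> on \<^term>\<open>carrier R\<close> are constrained.
\<close>

definition is_module_action ::
  "('a, 'm) ring_scheme \<Rightarrow> ('f::field \<Rightarrow> 'a) \<Rightarrow> ('f \<Rightarrow> 'v::ab_group_add \<Rightarrow> 'v) \<Rightarrow> ('a \<Rightarrow> 'v \<Rightarrow> 'v) \<Rightarrow> bool"
  where
  "is_module_action R c scale \<rho> \<longleftrightarrow>
     (\<forall>x\<in>carrier R. Vector_Spaces.linear scale scale (\<rho> x)) \<and>
     (\<forall>x\<in>carrier R. \<forall>y\<in>carrier R. \<forall>v. \<rho> (x \<oplus>\<^bsub>R\<^esub> y) v = \<rho> x v + \<rho> y v) \<and>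
     (\<forall>x\<in>carrier R. \<forall>y\<in>carrier R. \<forall>v. \<rho> (x \<otimes>\<^bsub>R\<^esub> y) v = \<rho> x (\<rho> y v)) \<and>
     (\<forall>v. \<rho> \<one>\<^bsub>R\<^esub> v = v) \<and>
     (\<forall>a v. \<rho> (c a) v = scale a v)"

definition is_irreducible_action ::
  "('a, 'm) ring_scheme \<Rightarrow> ('f::field \<Rightarrow> 'v::ab_group_add \<Rightarrow> 'v) \<Rightarrow> ('a \<Rightarrow> 'v \<Rightarrow> 'v) \<Rightarrow> bool"
  where
  "is_irreducible_action R scale \<rho> \<longleftrightarrow>
     (UNIV :: 'v set) \<noteq> {0} \<and>
     (\<forall>W. Modules.module.subspace scale W \<and> (\<forall>x\<in>carrier R. \<forall>w\<in>W. \<rho> x w \<in> W)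
        \<longrightarrow> W = {0} \<or> W = UNIV)"

definition uq_module ::
  "'f::field \<Rightarrow> ('f \<Rightarrow> 'v::ab_group_add \<Rightarrow> 'v) \<Rightarrow> ((uq_gen, 'f) free_algebra set \<Rightarrow> 'v \<Rightarrow> 'v) \<Rightarrow> bool"
  where "uq_module q scale \<rho> \<longleftrightarrow> is_module_action (uq q) (uq_const q) scale \<rho>"

definition borel_module ::
  "'f::field \<Rightarrow> ('f \<Rightarrow> 'v::ab_group_add \<Rightarrow> 'v) \<Rightarrow> ((uq_gen, 'f) free_algebra set \<Rightarrow> 'v \<Rightarrow> 'v) \<Rightarrow> bool"
  where "borel_module q scale \<rho> \<longleftrightarrow> is_module_action (borel q) (uq_const q) scale \<rho>"

definition eigenvalues :: "('f::field \<Rightarrow> 'v::ab_group_add \<Rightarrow> 'v) \<Rightarrow> ('v \<Rightarrow> 'v) \<Rightarrow> 'f set" where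
  "eigenvalues scale f = {\<theta>. \<exists>v. v \<noteq> 0 \<and> f v = scale \<theta> v}"

definition direct_sum_decomposition ::
  "('f::field \<Rightarrow> 'v::ab_group_add \<Rightarrow> 'v) \<Rightarrow> nat \<Rightarrow> (nat \<Rightarrow> 'v set) \<Rightarrow> bool" where
  "direct_sum_decomposition scale d U \<longleftrightarrow>
     (\<forall>i\<le>d. Modules.module.subspace scale (U i)) \<and>
     (\<forall>v. \<exists>!u. u \<in> (\<Pi>\<^sub>E i\<in>{..d}. U i) \<and> v = (\<Sum>i\<le>d. u i))"

text \<open>
  The two notions of type are meant for finite-dimensional irreducible modules. That \<open>K\<^sub>0\<close> and \<open>K\<^sub>1\<close>
  act semisimply in the first case, and that \<open>K\<^sub>1\<close> acts on \<open>U i\<close> as \<^term>\<open>\<beta> * q powi (int d - 2 * int i)\<close>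
  in the second, are consequences and not part of the definitions.
\<close>

definition uq_module_type ::
  "'f::field \<Rightarrow> ('f \<Rightarrow> 'v::ab_group_add \<Rightarrow> 'v) \<Rightarrow> ((uq_gen, 'f) free_algebra set \<Rightarrow> 'v \<Rightarrow> 'v)
     \<Rightarrow> 'f \<times> 'f \<Rightarrow> bool" where
  "uq_module_type q scale \<rho> = (\<lambda>(\<epsilon>0, \<epsilon>1).
     \<epsilon>0 \<in> {1, -1} \<and> \<epsilon>1 \<in> {1, -1} \<and>
     (\<exists>d::nat. eigenvalues scale (\<rho> (uq_K q Pos N0)) = {\<epsilon>0 * q powi (2 * int i - int d) | i. i \<le> d}) \<and>
     (\<forall>v. \<rho> (uq_K q Pos N0 \<otimes>\<^bsub>uq q\<^esub> uq_K q Pos N1) v = scale (\<epsilon>0 * \<epsilon>1) v))"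

definition borel_module_type ::
  "'f::field \<Rightarrow> ('f \<Rightarrow> 'v::ab_group_add \<Rightarrow> 'v) \<Rightarrow> ((uq_gen, 'f) free_algebra set \<Rightarrow> 'v \<Rightarrow> 'v)
     \<Rightarrow> 'f \<times> 'f \<Rightarrow> bool" where
  "borel_module_type q scale \<rho> = (\<lambda>(\<alpha>, \<beta>).
     \<exists>\<gamma>. (\<forall>v. \<rho> (uq_K q Pos N0 \<otimes>\<^bsub>borel q\<^esub> uq_K q Pos N1) v = scale \<gamma> v) \<and>
         \<alpha> \<noteq> 0 \<and> \<beta> = \<gamma> * inverse \<alpha> \<and>
         (\<exists>(d::nat) U. direct_sum_decomposition scale d U \<and>
            (\<forall>i\<le>d. U i \<noteq> {0} \<and>
               (\<forall>u\<in>U i. \<rho> (uq_K q Pos N0) u - scale (\<alpha> * q powi (2 * int i - int d)) u = 0))))"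

end

theory Submission
  imports Defs
begin

text \<open>
  Put $k = \varepsilon_0 K_0$, $e = e_0^+$ and $c = e_1^+$. The type of a Borel module says that $k$ is diagonalisable
  with eigenvalues $q^{2i-d}$ for $0 \le i \le d$ (eigenspaces \<open>wt i\<close>), and that $K_0$ and $K_1$ act as
  $\varepsilon_0 k$ and $\varepsilon_1 k^{-1}$. So a module of type $(\varepsilon_0,\varepsilon_1)$ is a set
  of operators, and a module over the whole algebra has in addition the operators
  $f = \varepsilon_0 e_0^-$ and $g = \varepsilon_1 e_1^-$. The roles of $e, f, k$ and $c, g, k^{-1}$ are
  exchanged by $i \mapsto d - i$, hence each statement is needed for one of the two nodes only.

  Existence of $f$ on an irreducible Borel module. The operator $a = k + e$ is triangular with respect to the
  weight spaces; let \<open>ev i\<close> be its eigenspace for $q^{2i-d}$. The Serre relation, read on an eigenvector of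
  $a$, says that $c$ maps \<open>ev i\<close> into the sum of the \<open>ev j\<close> with $j \le i + 1$, and $k^{-1}$ does the same.
  Let $E_i$ and $U_i$ be the sums of the \<open>ev j\<close> and of the \<open>wt j\<close> with $j \le i$. Then both
  $\sum_i (E_i \cap U_{d-1-i})$ and $\bigcap_i (E_i + U_{d-1-i})$ are invariant under $a$, $k^{-1}$ and $c$.
  The former is not the whole space and the latter is not zero, so irreducibility
  gives $E_i \oplus U_{d-1-i} = V$ for every $i$ (\<open>lower_flags_disjoint\<close>, \<open>lower_flags_sum\<close>). Therefore $V$
  is the direct sum of the spaces $E_i \cap U_{d-i}$. Let $t$ act on the $i$-th of them as $q^{d-2i}$. How
  $a$, $c$ and $k^{-1}$ move these spaces translates into $q$-commutation relations with $t$, and these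
  say that $f = \gamma (t k^{-1} - 1)$, for a suitable scalar $\gamma$, satisfies
  $[e, f] = (k - k^{-1})/(q - q^{-1})$ and $[c, f] = 0$ (\<open>lowering_operator_exists\<close>).

  The rest of the extension follows from one remark (\<open>commuting_operator_zero\<close>): an operator of nonzero
  weight that commutes with $e$ and $c$ is zero, since its kernel is an invariant subspace, and contains
  \<open>wt 0\<close> or \<open>wt d\<close>. This applies to the difference of two candidates for $f$, and to the Serre expressions in
  $f$ and $g$.

  Conversely, let $V$ be an irreducible module over the whole algebra. The sum of the eigenspaces of $K_0$ is
  a submodule, so $k$ is diagonalisable. Let $W$ be invariant under the Borel subalgebra. By quantum $sl_2$
  theory, for $2i \le d$ the power $e^{d-2i}$ is injective on \<open>wt i\<close> and $c^{d-2i}$ on \<open>wt (d - i)\<close>; hence both induce bijections between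
  the corresponding weight spaces of $W$, and this forces $f W \subseteq W$ (\<open>f_invariant\<close>). Likewise
  $g W \subseteq W$, and $W$ is a submodule (\<open>borel_irreducible\<close>).
\<close>

section \<open>Eigenspaces of an endomorphism\<close>

text \<open>A vector space over an arbitrary field; \<open>endo f\<close> says that \<open>f\<close> is linear.\<close>

locale linear_space = vector_space scale
  for scale :: "'a::field \<Rightarrow> 'b::ab_group_add \<Rightarrow> 'b"
begin

abbreviation endo :: "('b \<Rightarrow> 'b) \<Rightarrow> bool" where
  "endo f \<equiv> Vector_Spaces.linear scale scale f"

lemma endo_iff:
  "endo f \<longleftrightarrow> (\<forall>x y. f (x + y) = f x + f y) \<and> (\<forall>c x. f (scale c x) = scale c (f x))"
  unfolding Vector_Spaces.linear_iff by (auto intro: vector_space_axioms)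

lemma endo_add: "endo f \<Longrightarrow> f (x + y) = f x + f y"
  and endo_scale: "endo f \<Longrightarrow> f (scale c x) = scale c (f x)"
  by (simp_all add: endo_iff)

lemma endo_zero: "endo f \<Longrightarrow> f 0 = 0"
  using endo_scale[of f 0 0] by simp

lemma endo_uminus: "endo f \<Longrightarrow> f (- x) = - f x"
  using endo_scale[of f "-1" x] by simp

lemma endo_diff: "endo f \<Longrightarrow> f (x - y) = f x - f y"
  using endo_add[of f x "- y"] by (simp add: endo_uminus)

lemma endo_sum: "endo f \<Longrightarrow> f (sum g I) = (\<Sum>i\<in>I. f (g i))"
  by (induction I rule: infinite_finite_induct) (simp_all add: endo_add endo_zero)

lemmas endo_simps = endo_add endo_scale endo_zero endo_uminus endo_diff

lemma endo_shift: "endo f \<Longrightarrow> endo (\<lambda>x. f x - scale c x)"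
  by (simp add: endo_iff algebra_simps scale_left_commute)

lemma endo_span:
  assumes "endo f" "subspace Y" "\<And>x. x \<in> S \<Longrightarrow> f x \<in> Y" "x \<in> span S"
  shows "f x \<in> Y"
  using assms(4)
proof (induction rule: span_induct_alt)
  case base
  then show ?case using assms(1,2) by (simp add: endo_zero subspace_0)
next
  case (step c x y)
  then show ?case
    using assms(1-3) by (simp add: endo_simps subspace_add subspace_scale)
qed

lemma endo_eq_on_spanning:
  assumes "endo f" "endo g" "span S = UNIV" "\<And>x. x \<in> S \<Longrightarrow> f x = g x"
  shows "f = g"
proof
  fix x
  have "endo (\<lambda>x. f x - g x)"
    using assms(1,2) by (simp add: endo_iff algebra_simps)
  then have "f x - g x \<in> {0}"
    by (rule endo_span[where S = S]) (use assms(3,4) in auto)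
  then show "f x = g x" by simp
qed

definition eigenspace :: "('b \<Rightarrow> 'b) \<Rightarrow> 'a \<Rightarrow> 'b set" where
  "eigenspace f \<mu> = {v. f v = scale \<mu> v}"

lemma subspace_eigenspace: "endo f \<Longrightarrow> subspace (eigenspace f \<mu>)"
  by (rule subspaceI)
    (auto simp: eigenspace_def endo_simps scale_right_distrib mult.commute)

lemma span_UN_sum:
  assumes "finite I" "\<And>i. i \<in> I \<Longrightarrow> subspace (Z i)" "v \<in> span (\<Union>i\<in>I. Z i)"
  obtains z where "\<And>i. i \<in> I \<Longrightarrow> z i \<in> Z i" "v = (\<Sum>i\<in>I. z i)"
proof -
  from assms(3) have "\<exists>z. (\<forall>i\<in>I. z i \<in> Z i) \<and> v = (\<Sum>i\<in>I. z i)"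
  proof (induction rule: span_induct_alt)
    case base
    show ?case
      by (rule exI[of _ "\<lambda>_. 0"]) (use assms(2) in \<open>auto intro: subspace_0\<close>)
  next
    case (step c x y)
    then obtain j z where j: "j \<in> I" "x \<in> Z j" and z: "\<forall>i\<in>I. z i \<in> Z i" "y = (\<Sum>i\<in>I. z i)"
      by auto
    have "(\<Sum>i\<in>I. (if i = j then scale c x else 0) + z i) = scale c x + y"
      using assms(1) j(1) z(2) by (simp add: sum.distrib)
    moreover have "\<forall>i\<in>I. (if i = j then scale c x else 0) + z i \<in> Z i"
      using j z(1) assms(2) by (auto intro: subspace_add subspace_scale)
    ultimately show ?case
      by (intro exI[of _ "\<lambda>i. (if i = j then scale c x else 0) + z i"]) auto
  qed
  then show ?thesis using that by blast
qed

text \<open>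
  The components of a vector of an invariant subspace in distinct eigenspaces lie in the subspace.
\<close>

lemma eigen_components_mem:
  assumes "finite I" "subspace W" "inj_on \<mu> I" "endo T" "\<And>w. w \<in> W \<Longrightarrow> T w \<in> W"
    and "\<And>i. i \<in> I \<Longrightarrow> u i \<in> eigenspace T (\<mu> i)" "(\<Sum>i\<in>I. u i) \<in> W"
  shows "\<forall>i\<in>I. u i \<in> W"
  using assms(1,3,6,7)
proof (induction I arbitrary: u rule: finite_induct)
  case (insert j I)
  let ?s = "\<Sum>i\<in>insert j I. u i"
  have "T ?s - scale (\<mu> j) ?s = (\<Sum>i\<in>insert j I. scale (\<mu> i - \<mu> j) (u i))"
    using insert.prems(2)
    by (simp add: endo_sum[OF assms(4)] scale_sum_right eigenspace_def scale_left_diff_distrib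
        sum_subtractf del: sum.insert)
  also have "\<dots> = (\<Sum>i\<in>I. scale (\<mu> i - \<mu> j) (u i))"
    using insert.hyps by simp
  finally have "(\<Sum>i\<in>I. scale (\<mu> i - \<mu> j) (u i)) \<in> W"
    using insert.prems(3) assms(2,5) by (metis subspace_diff subspace_scale)
  moreover have "scale (\<mu> i - \<mu> j) (u i) \<in> eigenspace T (\<mu> i)" if "i \<in> I" for i
    using insert.prems(2)[of i] that subspace_scale[OF subspace_eigenspace[OF assms(4)]] by blast
  ultimately have *: "\<forall>i\<in>I. scale (\<mu> i - \<mu> j) (u i) \<in> W"
    using insert.IH[of "\<lambda>i. scale (\<mu> i - \<mu> j) (u i)"] insert.prems(1) by (auto simp: inj_on_def)
  have I: "u i \<in> W" if "i \<in> I" for i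
  proof -
    have "\<mu> i - \<mu> j \<noteq> 0"
      using insert.prems(1) insert.hyps(2) that by (auto simp: inj_on_def)
    then show ?thesis
      using * that subspace_scale[OF assms(2), of "scale (\<mu> i - \<mu> j) (u i)" "inverse (\<mu> i - \<mu> j)"]
      by auto
  qed
  have "u j = ?s - (\<Sum>i\<in>I. u i)" using insert.hyps by simp
  also have "\<dots> \<in> W"
    by (rule subspace_diff[OF assms(2) insert.prems(3) subspace_sum[OF assms(2) I]])
  finally show ?case using I by auto
qed simp

lemma eigen_components_zero:
  assumes "finite I" "inj_on \<mu> I" "endo T"
    and "\<And>i. i \<in> I \<Longrightarrow> u i \<in> eigenspace T (\<mu> i)" "(\<Sum>i\<in>I. u i) = 0"
  shows "\<forall>i\<in>I. u i = 0"
  using eigen_components_mem[of I "{0}" \<mu> T u] assms by (auto simp: endo_zero)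

lemma invariant_subspace_graded:
  assumes "finite I" "subspace W" "inj_on \<mu> I" "endo T" "\<And>w. w \<in> W \<Longrightarrow> T w \<in> W"
    and "span (\<Union>i\<in>I. eigenspace T (\<mu> i)) = UNIV"
  shows "span (\<Union>i\<in>I. W \<inter> eigenspace T (\<mu> i)) = W"
proof
  show "span (\<Union>i\<in>I. W \<inter> eigenspace T (\<mu> i)) \<subseteq> W"
    by (rule span_minimal) (use assms(2) in auto)
  show "W \<subseteq> span (\<Union>i\<in>I. W \<inter> eigenspace T (\<mu> i))"
  proof
    fix w assume w: "w \<in> W"
    obtain u where u: "\<And>i. i \<in> I \<Longrightarrow> u i \<in> eigenspace T (\<mu> i)" "w = (\<Sum>i\<in>I. u i)"
      using span_UN_sum[OF assms(1), of "\<lambda>i. eigenspace T (\<mu> i)" w] assms(4,6)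
        subspace_eigenspace by auto
    have "\<forall>i\<in>I. u i \<in> W"
      by (rule eigen_components_mem[OF assms(1-5)]) (use u w in auto)
    then show "w \<in> span (\<Union>i\<in>I. W \<inter> eigenspace T (\<mu> i))"
      unfolding u(2) using u(1) by (intro span_sum span_base) auto
  qed
qed

lemma eigenvalue_of_spanning:
  assumes "finite I" "inj_on \<mu> I" "endo T" "span (\<Union>i\<in>I. eigenspace T (\<mu> i)) = UNIV"
    and "v \<in> eigenspace T \<nu>" "v \<noteq> 0"
  shows "\<nu> \<in> \<mu> ` I"
proof (rule ccontr)
  assume \<nu>: "\<nu> \<notin> \<mu> ` I"
  obtain u where u: "\<And>i. i \<in> I \<Longrightarrow> u i \<in> eigenspace T (\<mu> i)" "v = (\<Sum>i\<in>I. u i)"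
    using span_UN_sum[OF assms(1), of "\<lambda>i. eigenspace T (\<mu> i)" v] assms(3,4)
      subspace_eigenspace by auto
  have "(\<Sum>i\<in>I. scale (\<mu> i - \<nu>) (u i)) = T v - scale \<nu> v"
    unfolding u(2) using u(1)
    by (simp add: endo_sum[OF assms(3)] scale_sum_right eigenspace_def scale_left_diff_distrib
        sum_subtractf)
  also have "\<dots> = 0" using assms(5) by (simp add: eigenspace_def)
  finally have "\<forall>i\<in>I. scale (\<mu> i - \<nu>) (u i) = 0"
    using u(1) by (intro eigen_components_zero[OF assms(1-3)])
      (auto intro: subspace_scale subspace_eigenspace[OF assms(3)])
  then have "\<forall>i\<in>I. u i = 0" using \<nu> by auto
  then show False using u(2) assms(6) by simp
qed

text \<open>
  On a filtration on whose successive quotients \<open>T\<close> acts by the scalars \<open>\<theta> i\<close>, these are the only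
  possible eigenvalues.
\<close>

lemma eigenvector_flag_zero:
  fixes F :: "int \<Rightarrow> 'b set"
  assumes sub: "\<And>i. subspace (F i)" and mem: "v \<in> F 0" and fin: "F n = {0}" and n: "n \<ge> 0"
    and step: "\<And>i x. 0 \<le> i \<Longrightarrow> i < n \<Longrightarrow> x \<in> F i \<Longrightarrow> T x - scale (\<theta> i) x \<in> F (i + 1)"
    and eig: "v \<in> eigenspace T \<mu>" and ne: "\<And>i. 0 \<le> i \<Longrightarrow> i < n \<Longrightarrow> \<mu> \<noteq> \<theta> i"
  shows "v = 0"
proof -
  have "int m \<le> n \<Longrightarrow> v \<in> F (int m)" for m
  proof (induction m)
    case (Suc m)
    then have "T v - scale (\<theta> (int m)) v \<in> F (int m + 1)" by (intro step) auto
    then have *: "scale (\<mu> - \<theta> (int m)) v \<in> F (int m + 1)"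
      using eig by (simp add: eigenspace_def scale_left_diff_distrib)
    moreover have "\<mu> - \<theta> (int m) \<noteq> 0" using ne[of "int m"] Suc.prems by auto
    ultimately show ?case
      using subspace_scale[OF sub *, of "inverse (\<mu> - \<theta> (int m))"] by (simp add: add.commute)
  qed (use mem in simp)
  from this[of "nat n"] n fin show ?thesis by simp
qed

text \<open>An endomorphism may be prescribed to act as a scalar on each summand of a direct sum.\<close>

lemma scalar_operator_exists:
  assumes I: "finite I" "\<And>i. i \<in> I \<Longrightarrow> subspace (Z i)" "span (\<Union>i\<in>I. Z i) = UNIV"
    and indep: "\<And>z. (\<And>i. i \<in> I \<Longrightarrow> z i \<in> Z i) \<Longrightarrow> (\<Sum>i\<in>I. z i) = 0 \<Longrightarrow> \<forall>i\<in>I. z i = 0"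
  obtains T where "endo T" "\<And>i z. i \<in> I \<Longrightarrow> z \<in> Z i \<Longrightarrow> T z = scale (\<mu> i) z"
proof -
  have "\<forall>v. \<exists>z. (\<forall>i\<in>I. z i \<in> Z i) \<and> (\<Sum>i\<in>I. z i) = v"
  proof
    fix v
    obtain z where "\<And>i. i \<in> I \<Longrightarrow> z i \<in> Z i" "v = (\<Sum>i\<in>I. z i)"
      using span_UN_sum[of I Z v] I by blast
    then show "\<exists>z. (\<forall>i\<in>I. z i \<in> Z i) \<and> (\<Sum>i\<in>I. z i) = v" by blast
  qed
  from choice[OF this] obtain z where
    z: "\<And>v i. i \<in> I \<Longrightarrow> z v i \<in> Z i" "\<And>v. (\<Sum>i\<in>I. z v i) = v"
    by blast
  define T where "T v = (\<Sum>i\<in>I. scale (\<mu> i) (z v i))" for v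
  have uniq: "T v = (\<Sum>i\<in>I. scale (\<mu> i) (y i))"
    if "\<And>i. i \<in> I \<Longrightarrow> y i \<in> Z i" "v = (\<Sum>i\<in>I. y i)" for v y
  proof -
    have "\<forall>i\<in>I. z v i - y i = 0"
    proof (rule indep)
      show "z v i - y i \<in> Z i" if "i \<in> I" for i
        using that z(1) \<open>\<And>i. i \<in> I \<Longrightarrow> y i \<in> Z i\<close> I(2) by (blast intro: subspace_diff)
      show "(\<Sum>i\<in>I. z v i - y i) = 0"
        using z(2)[of v] that(2) by (simp add: sum_subtractf)
    qed
    then show ?thesis unfolding T_def by (intro sum.cong) auto
  qed
  have "T (x + y) = T x + T y" for x y
  proof -
    have "T (x + y) = (\<Sum>i\<in>I. scale (\<mu> i) (z x i + z y i))"
      by (rule uniq) (use z(1) I(2) in \<open>auto intro: subspace_add simp: sum.distrib z(2)\<close>)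
    then show ?thesis by (simp add: T_def scale_right_distrib sum.distrib)
  qed
  moreover have "T (scale c x) = scale c (T x)" for c x
  proof -
    have "T (scale c x) = (\<Sum>i\<in>I. scale (\<mu> i) (scale c (z x i)))"
      by (rule uniq)
        (use z(1) I(2) in \<open>auto intro: subspace_scale simp: scale_sum_right[symmetric] z(2)\<close>)
    then show ?thesis by (simp add: T_def scale_sum_right mult.commute)
  qed
  ultimately have "endo T" by (simp add: endo_iff)
  moreover have "T x = scale (\<mu> i) x" if "i \<in> I" "x \<in> Z i" for i x
  proof -
    have "T x = (\<Sum>j\<in>I. scale (\<mu> j) (if j = i then x else 0))"
      by (rule uniq) (use that I(1,2) in \<open>auto intro: subspace_0\<close>)
    also have "\<dots> = (\<Sum>j\<in>I. if j = i then scale (\<mu> i) x else 0)"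
      by (rule sum.cong) auto
    finally show ?thesis using that I(1) by simp
  qed
  ultimately show ?thesis using that by blast
qed

end

section \<open>Weight spaces\<close>

lemma powi_eq_1D:
  fixes q :: "'f::field"
  assumes "\<And>n::nat. n > 0 \<Longrightarrow> q ^ n \<noteq> 1" "q powi n = 1" shows "n = 0"
proof (rule ccontr)
  assume "n \<noteq> 0"
  then have "nat \<bar>n\<bar> > 0" by simp
  moreover have "q ^ nat \<bar>n\<bar> = 1"
    using assms(2) by (cases "n \<ge> 0") (auto simp: power_int_def power_inverse)
  ultimately show False using assms(1) by blast
qed

lemma powi_inject:
  fixes q :: "'f::field"
  assumes "q \<noteq> 0" "\<And>n::nat. n > 0 \<Longrightarrow> q ^ n \<noteq> 1"
  shows "q powi m = q powi n \<longleftrightarrow> m = n"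
proof
  assume "q powi m = q powi n"
  then have "q powi (m - n) = 1" using assms(1) by (simp add: power_int_diff)
  then show "m = n" using powi_eq_1D[OF assms(2)] by fastforce
qed simp

text \<open>
  An operator \<open>k\<close> with inverse \<open>k'\<close> that is diagonalisable, with all eigenvalues among
  $q^{2i-d}$ for $0 \le i \le d$. Some of these eigenspaces may be zero. The space \<open>wt i\<close> is defined for every
  integer \<open>i\<close>, and is zero outside the range.
\<close>

locale weight_operator = linear_space scale
  for scale :: "'f::field \<Rightarrow> 'v::ab_group_add \<Rightarrow> 'v" +
  fixes q :: 'f and d :: int and k k' :: "'v \<Rightarrow> 'v"
  assumes q_nonzero: "q \<noteq> 0" and q_not_root: "\<And>n::nat. n > 0 \<Longrightarrow> q ^ n \<noteq> 1"
    and endo_k: "endo k" and endo_k': "endo k'"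
    and k_k': "\<And>v. k (k' v) = v" and k'_k: "\<And>v. k' (k v) = v"
    and weights_span: "span (\<Union>i\<in>{0..d}. eigenspace k (q powi (2 * i - d))) = UNIV"
begin

definition wt :: "int \<Rightarrow> 'v set" where
  "wt i = eigenspace k (q powi (2 * i - d))"

lemma wt_span: "span (\<Union>i\<in>{0..d}. wt i) = UNIV"
  using weights_span by (simp add: wt_def)

lemma subspace_wt: "subspace (wt i)"
  by (simp add: wt_def subspace_eigenspace endo_k)

lemmas powi_inj = powi_inject[OF q_nonzero q_not_root]

text \<open>The square of \<open>q\<close> is kept opaque, so that the simplifier does not expand its inverse.\<close>

definition qq :: 'f where "qq = q powi 2"

lemma qq_nonzero: "qq \<noteq> 0"
  using q_nonzero by (simp add: qq_def)

lemma qq_neq_1: "qq \<noteq> 1"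
  using powi_eq_1D[OF q_not_root, of 2] by (auto simp: qq_def)

lemma powi_double: "q powi 2 = qq" "q powi -2 = inverse qq"
  using power_int_minus[of q 2] by (simp_all add: qq_def)

lemma powi_shift: "q powi (m + 2) = qq * q powi m" "q powi (m - 2) = inverse qq * q powi m"
  using q_nonzero by (simp_all add: power_int_add power_int_diff qq_def field_simps)

lemma qq_cancel:
  "qq * (inverse qq * x) = x" "inverse qq * (qq * x) = x"
  "qq * (x * inverse qq) = x" "inverse qq * (x * qq) = x"
  using qq_nonzero by (simp_all add: field_simps)

lemma wt_outside: assumes "i \<notin> {0..d}" shows "wt i = {0}"
proof -
  have "v = 0" if "v \<in> wt i" for v
  proof (rule ccontr)
    assume "v \<noteq> 0"
    then have "q powi (2 * i - d) \<in> (\<lambda>i. q powi (2 * i - d)) ` {0..d}"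
      using that weights_span
      by (intro eigenvalue_of_spanning[OF _ _ endo_k]) (auto simp: wt_def inj_on_def powi_inj)
    then show False using assms by (auto simp: powi_inj)
  qed
  then show ?thesis using subspace_0[OF subspace_wt] by blast
qed

lemma wt_k: "v \<in> wt i \<Longrightarrow> k v = scale (q powi (2 * i - d)) v"
  by (simp add: wt_def eigenspace_def)

lemma wt_k': "v \<in> wt i \<Longrightarrow> k' v = scale (q powi (d - 2 * i)) v"
proof -
  assume v: "v \<in> wt i"
  have "v = scale (q powi (2 * i - d)) (k' v)"
    using k'_k[of v] by (simp add: wt_k[OF v] endo_scale[OF endo_k'])
  then have "scale (q powi (d - 2 * i)) v = scale (q powi (d - 2 * i) * q powi (2 * i - d)) (k' v)"
    by (metis scale_scale)
  then show ?thesis using q_nonzero by (simp flip: power_int_add)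
qed

text \<open>
  Passing to the inverse operator reverses the order of the weight spaces.
\<close>

lemma dual: "weight_operator scale q d k' k"
proof (intro weight_operator.intro weight_operator_axioms.intro linear_space_axioms)
  have "v \<in> (\<Union>i\<in>{0..d}. eigenspace k' (q powi (2 * i - d)))" if "i \<in> {0..d}" "v \<in> wt i" for i v
    using that wt_k'[OF that(2)] by (intro UN_I[of "d - i"]) (auto simp: eigenspace_def algebra_simps)
  then have "(\<Union>i\<in>{0..d}. wt i) \<subseteq> (\<Union>i\<in>{0..d}. eigenspace k' (q powi (2 * i - d)))"
    by blast
  then show "span (\<Union>i\<in>{0..d}. eigenspace k' (q powi (2 * i - d))) = UNIV"
    using wt_span span_mono by blast
qed (fact q_nonzero q_not_root endo_k endo_k' k_k' k'_k)+

lemma dual_wt: "weight_operator.wt scale q d k' i = wt (d - i)"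
proof -
  interpret D: weight_operator scale q d k' k by (rule dual)
  show ?thesis
    using wt_k'[of _ "d - i"] D.wt_k'[of _ i]
    by (auto simp: D.wt_def wt_def eigenspace_def algebra_simps)
qed

lemma wt_graded:
  assumes "subspace W" "\<And>w. w \<in> W \<Longrightarrow> k w \<in> W"
  shows "span (\<Union>i\<in>{0..d}. W \<inter> wt i) = W"
  unfolding wt_def
  by (rule invariant_subspace_graded[OF _ assms(1) _ endo_k assms(2) weights_span])
    (auto simp: inj_on_def powi_inj)

lemma invariant_k':
  assumes "subspace W" "\<And>w. w \<in> W \<Longrightarrow> k w \<in> W" "w \<in> W"
  shows "k' w \<in> W"
proof -
  have "k' x \<in> W" if "x \<in> (\<Union>i\<in>{0..d}. W \<inter> wt i)" for x
    using that wt_k'[of x] assms(1) by (auto intro: subspace_scale)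
  then show ?thesis
    using endo_span[OF endo_k' assms(1), of "\<Union>i\<in>{0..d}. W \<inter> wt i" w] wt_graded[OF assms(1,2)] assms(3)
    by blast
qed

lemma k'_commute:
  assumes "\<And>v. k (f v) = scale s (f (k v))" "s \<noteq> 0" "endo f"
  shows "k' (f v) = scale (inverse s) (f (k' v))"
  using assms(1)[of "k' v"] assms(2) k'_k[of "f (k' v)"]
  by (simp add: k_k') (metis endo_k' endo_scale k'_k scale_left_imp_eq scale_right_imp_eq
      left_inverse scale_scale scale_one)

lemma wt_induct:
  assumes "endo f" "endo g" "\<And>i v. v \<in> wt i \<Longrightarrow> f v = g v"
  shows "f = g"
  using endo_eq_on_spanning[OF assms(1,2) wt_span] assms(3) by blast

lemma raising_wt:
  assumes "endo f" "\<And>v. k (f v) = scale (q powi (2 * s)) (f (k v))" "v \<in> wt i"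
  shows "f v \<in> wt (i + s)"
proof -
  have "k (f v) = scale (q powi (2 * s) * q powi (2 * i - d)) (f v)"
    by (simp add: assms(2) wt_k[OF assms(3)] endo_scale[OF assms(1)])
  also have "q powi (2 * s) * q powi (2 * i - d) = q powi (2 * (i + s) - d)"
    using q_nonzero by (simp flip: power_int_add add: algebra_simps)
  finally show ?thesis by (simp add: wt_def eigenspace_def)
qed

end

section \<open>Quantum integers\<close>

context weight_operator
begin

text \<open>
  The scalar by which $(k - k^{-1})/(q - q^{-1})$ acts on \<open>wt i\<close>.
\<close>

definition h :: "int \<Rightarrow> 'f" where "h i = qint q (2 * i - d)"

lemma q_diff_nonzero: "q - inverse q \<noteq> 0"
  using qq_neq_1 q_nonzero by (auto simp: qq_def power_int_def power2_eq_square field_simps)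

lemma qint_eq_0_iff: "qint q n = 0 \<longleftrightarrow> n = 0"
  using q_diff_nonzero powi_inj[of n "- n"] by (auto simp: qint_def)

lemma qint_3: "qint q 3 = qq + 1 + inverse qq"
proof -
  have "q powi 3 - q powi -3 = (qq + 1 + inverse qq) * (q - inverse q)"
    using q_nonzero by (simp add: qq_def power_int_def eval_nat_numeral field_simps)
  then show ?thesis using q_diff_nonzero by (simp add: qint_def)
qed

lemma h_three_term: "h (j - 1) + h j + h (j + 1) = qint q 3 * h j"
proof -
  define u where "u = q powi (2 * j - d)"
  have "q powi (2 * (j + 1) - d) = qq * u" "q powi (2 * (j - 1) - d) = inverse qq * u"
    using powi_shift[of "2 * j - d"] by (simp_all add: u_def algebra_simps)
  then have h: "h j = (u - inverse u) / (q - inverse q)"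
    "h (j + 1) = (qq * u - inverse qq * inverse u) / (q - inverse q)"
    "h (j - 1) = (inverse qq * u - qq * inverse u) / (q - inverse q)"
    unfolding h_def qint_def power_int_minus by (simp_all add: u_def)
  have "(inverse qq * u - qq * inverse u) + (u - inverse u) + (qq * u - inverse qq * inverse u)
      = (qq + 1 + inverse qq) * (u - inverse u)"
    by (simp add: algebra_simps)
  then show ?thesis
    unfolding h qint_3 by (simp only: add_divide_distrib[symmetric] times_divide_eq_right)
qed

lemma h_next: "h (j + 1) = qint q 3 * h j - h j - h (j - 1)"
  using h_three_term[of j] by (simp add: algebra_simps)

lemma k_minus_k'_wt:
  assumes "v \<in> wt i" shows "scale (inverse (q - inverse q)) (k v - k' v) = scale (h i) v"
proof -
  have "k v - k' v = scale (q powi (2 * i - d) - q powi (- (2 * i - d))) v"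
    by (simp add: wt_k[OF assms] wt_k'[OF assms] scale_left_diff_distrib)
  then show ?thesis by (simp add: h_def qint_def divide_inverse mult.commute)
qed

lemma qint_product:
  "qint q (int n) * qint q (m + int n - 1) + qint q (m + 2 * int n) = qint q (int n + 1) * qint q (m + int n)"
proof -
  define x y where "x = q powi int n" and "y = q powi m"
  have nz: "x \<noteq> 0" "y \<noteq> 0" using q_nonzero by (simp_all add: x_def y_def)
  have "q powi (m + 2 * int n) = q powi (m + int n + int n)"
    by (rule arg_cong[where f = "power_int q"]) simp
  also have "\<dots> = y * x * x"
    using power_int_add[of q "m + int n" "int n"] power_int_add[of q m "int n"] q_nonzero
    unfolding x_def y_def by metis
  finally have "q powi (m + 2 * int n) = y * x * x" .
  moreover have "q powi (m + int n - 1) = y * x * inverse q"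
    "q powi (int n + 1) = x * q" "q powi (m + int n) = y * x"
    using q_nonzero by (simp_all add: x_def y_def power_int_add power_int_diff field_simps)
  ultimately have e: "qint q (m + int n - 1) = (y * x * inverse q - inverse (y * x * inverse q)) / (q - inverse q)"
    "qint q (m + 2 * int n) = (y * x * x - inverse (y * x * x)) / (q - inverse q)"
    "qint q (int n + 1) = (x * q - inverse (x * q)) / (q - inverse q)"
    "qint q (m + int n) = (y * x - inverse (y * x)) / (q - inverse q)"
    "qint q (int n) = (x - inverse x) / (q - inverse q)"
    unfolding qint_def power_int_minus by (simp_all add: x_def)
  have "(x - inverse x) * (y * x * inverse q - inverse (y * x * inverse q))
      + (y * x * x - inverse (y * x * x)) * (q - inverse q)
      = (x * q - inverse (x * q)) * (y * x - inverse (y * x))"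
    using nz q_nonzero by (simp add: field_simps)
  then show ?thesis unfolding e using q_diff_nonzero by (simp add: divide_simps) (simp add: algebra_simps)?
qed

end

section \<open>Construction of a lowering operator\<close>

text \<open>
  An irreducible module of the Borel subalgebra, in terms of \<open>k\<close>, \<open>e\<close> and \<open>c\<close>, with nonzero
  extreme weight spaces. Only one of the two Serre relations is assumed, since the construction of the lowering operator for \<open>e\<close> uses only this one.
\<close>

locale borel_triple = weight_operator scale q d k k' + finite_dimensional_vector_space scale Basis
  for scale :: "'f::field \<Rightarrow> 'v::ab_group_add \<Rightarrow> 'v" and q d k k' and Basis +
  fixes e c :: "'v \<Rightarrow> 'v"
  assumes d_nonneg: "d \<ge> 0"
    and endo_e: "endo e" and endo_c: "endo c"
    and k_e: "\<And>v. k (e v) = scale (q powi 2) (e (k v))"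
    and k_c: "\<And>v. k (c v) = scale (q powi -2) (c (k v))"
    and serre: "\<And>v. e (e (e (c v))) - scale (qint q 3) (e (e (c (e v))))
        + scale (qint q 3) (e (c (e (e v)))) - c (e (e (e v))) = 0"
    and irreducible: "\<And>W. subspace W \<Longrightarrow> (\<And>w. w \<in> W \<Longrightarrow> k w \<in> W) \<Longrightarrow> (\<And>w. w \<in> W \<Longrightarrow> e w \<in> W)
        \<Longrightarrow> (\<And>w. w \<in> W \<Longrightarrow> c w \<in> W) \<Longrightarrow> W = {0} \<or> W = UNIV"
    and wt_bottom: "wt 0 \<noteq> {0}" and wt_top: "wt d \<noteq> {0}"
begin

lemmas simps = endo_simps[OF endo_k] endo_simps[OF endo_k'] endo_simps[OF endo_e]
  endo_simps[OF endo_c]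

lemma e_wt: "v \<in> wt i \<Longrightarrow> e v \<in> wt (i + 1)"
  using raising_wt[OF endo_e, of 1] k_e by simp

lemma c_wt: "v \<in> wt i \<Longrightarrow> c v \<in> wt (i - 1)"
  using raising_wt[OF endo_c, of "-1"] k_c by simp

text \<open>Invariance under \<open>k'\<close>, \<open>k + e\<close> and \<open>c\<close> suffices.\<close>

lemma irreducible':
  assumes "subspace W" "\<And>w. w \<in> W \<Longrightarrow> k' w \<in> W" "\<And>w. w \<in> W \<Longrightarrow> k w + e w \<in> W"
    "\<And>w. w \<in> W \<Longrightarrow> c w \<in> W"
  shows "W = {0} \<or> W = UNIV"
proof (rule irreducible[OF assms(1)])
  interpret D: weight_operator scale q d k' k by (rule dual)
  show k: "k w \<in> W" if "w \<in> W" for w using D.invariant_k'[OF assms(1,2) that] .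
  show "e w \<in> W" if "w \<in> W" for w
    using subspace_diff[OF assms(1) assms(3)[OF that] k[OF that]] by simp
qed (fact assms(4))

text \<open>
  If an operator commutes with \<open>e\<close> and \<open>c\<close>, and with \<open>k\<close> up to a scalar, then its kernel is invariant.
\<close>

lemma commuting_operator_zero:
  assumes "endo g" "\<And>v. g (e v) = e (g v)" "\<And>v. g (c v) = c (g v)"
    and "\<And>v. k (g v) = scale \<kappa> (g (k v))" "\<kappa> \<noteq> 0" "v0 \<noteq> 0" "g v0 = 0"
  shows "g v = 0"
proof -
  let ?W = "{v. g v = 0}"
  have gk: "g (k v) = scale (inverse \<kappa>) (k (g v))" for v
    using assms(4)[of v] assms(5) by simp
  have "?W = {0} \<or> ?W = UNIV"
  proof (rule irreducible)
    show "subspace ?W" by (rule subspaceI) (simp_all add: endo_simps[OF assms(1)])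
  qed (simp_all add: assms(2,3) gk simps)
  then show ?thesis using assms(6,7) by blast
qed

definition theta :: "int \<Rightarrow> 'f" where "theta i = q powi (2 * i - d)"

lemma theta_nonzero: "theta i \<noteq> 0"
  using q_nonzero by (simp add: theta_def)

lemma theta_inject: "theta i = theta j \<longleftrightarrow> i = j"
  by (auto simp: theta_def powi_inj)

lemma theta_Suc: "theta (i + 1) = qq * theta i"
  and theta_pred: "theta (i - 1) = inverse qq * theta i"
  using powi_shift[of "2 * i - d"] by (simp_all add: theta_def algebra_simps)

lemma inverse_theta: "inverse (theta i) = q powi (d - 2 * i)"
  by (simp add: theta_def flip: power_int_minus)

lemma wt_theta: "v \<in> wt i \<Longrightarrow> k v = scale (theta i) v" "v \<in> wt i \<Longrightarrow> k' v = scale (inverse (theta i)) v"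
  by (simp_all add: wt_k wt_k' inverse_theta) (simp add: theta_def)

text \<open>
  The operator \<open>a = k + e\<close> is triangular with respect to the weight spaces, with the eigenvalues of \<open>k\<close> on the
  diagonal. As for the weight spaces, its eigenspaces \<open>ev i\<close> are indexed by all integers.
\<close>

definition a :: "'v \<Rightarrow> 'v" where "a v = k v + e v"

definition ev :: "int \<Rightarrow> 'v set" where "ev i = eigenspace a (theta i)"

text \<open>
  The two flags, of sums of weight spaces and of sums of eigenspaces of \<open>a\<close>.
\<close>

definition lower_wt :: "int \<Rightarrow> 'v set" where "lower_wt j = span (\<Union>i\<in>{..j}. wt i)"

definition lower_ev :: "int \<Rightarrow> 'v set" where "lower_ev j = span (\<Union>i\<in>{..j}. ev i)"

lemma endo_a: "endo a"
  by (simp add: endo_iff a_def simps scale_right_distrib)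

lemma ev_a: "v \<in> ev i \<Longrightarrow> a v = scale (theta i) v"
  by (simp add: ev_def eigenspace_def)

lemma subspace_ev: "subspace (ev i)"
  by (simp add: ev_def subspace_eigenspace endo_a)

lemma wt_subset_lower: "i \<le> j \<Longrightarrow> wt i \<subseteq> lower_wt j"
  unfolding lower_wt_def by (meson UN_upper atMost_iff order_trans span_superset)

lemma ev_subset_lower: "i \<le> j \<Longrightarrow> ev i \<subseteq> lower_ev j"
  unfolding lower_ev_def by (meson UN_upper atMost_iff order_trans span_superset)

lemma subspace_lower_wt: "subspace (lower_wt j)"
  and subspace_lower_ev: "subspace (lower_ev j)"
  by (simp_all add: lower_wt_def lower_ev_def)

lemma lower_wt_mono: "i \<le> j \<Longrightarrow> lower_wt i \<subseteq> lower_wt j"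
  unfolding lower_wt_def by (intro span_mono UN_mono) auto

lemma lower_ev_mono: "i \<le> j \<Longrightarrow> lower_ev i \<subseteq> lower_ev j"
  unfolding lower_ev_def by (intro span_mono UN_mono) auto

lemma lower_wt_neg: "j < 0 \<Longrightarrow> lower_wt j = {0}"
  using wt_outside subspace_0[OF subspace_lower_wt]
    span_minimal[of "\<Union>i\<in>{..j}. wt i" "{0}"] by (force simp: lower_wt_def)

lemma lower_wt_top: "j \<ge> d \<Longrightarrow> lower_wt j = UNIV"
  using wt_span span_mono[of "\<Union>i\<in>{0..d}. wt i" "\<Union>i\<in>{..j}. wt i"]
  unfolding lower_wt_def by fastforce

lemma upper_wt_step:
  assumes "x \<in> span (\<Union>i\<in>{j..d}. wt i)"
  shows "a x - scale (theta j) x \<in> span (\<Union>i\<in>{j+1..d}. wt i)"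
proof (rule endo_span[OF endo_shift[OF endo_a] subspace_span _ assms])
  fix x assume "x \<in> (\<Union>i\<in>{j..d}. wt i)"
  then obtain i where i: "j \<le> i" "i \<le> d" "x \<in> wt i" by auto
  have mem: "y \<in> span (\<Union>i\<in>{j+1..d}. wt i)" if "m \<ge> j + 1" "y \<in> wt m" for y m
    using that wt_outside[of m] by (cases "m \<in> {0..d}") (auto intro!: span_base span_zero)
  have "scale (theta i - theta j) x \<in> span (\<Union>i\<in>{j+1..d}. wt i)"
    using i mem[OF _ subspace_scale[OF subspace_wt i(3)], of "theta i - theta j"]
    by (cases "i = j") (auto intro: span_zero)
  moreover have "e x \<in> span (\<Union>i\<in>{j+1..d}. wt i)"
    using mem[OF _ e_wt[OF i(3)]] i(1) by simp
  moreover have "a x - scale (theta j) x = scale (theta i - theta j) x + e x"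
    by (simp add: a_def wt_theta(1)[OF i(3)] scale_left_diff_distrib)
  ultimately show "a x - scale (theta j) x \<in> span (\<Union>i\<in>{j+1..d}. wt i)"
    by (simp add: span_add)
qed

lemma ev_neg: assumes "i < 0" shows "ev i = {0}"
proof -
  have "v = 0" if "v \<in> ev i" for v
  proof (rule eigenvector_flag_zero)
    show "v \<in> span (\<Union>i\<in>{0..d}. wt i)" by (simp add: wt_span)
    show "span (\<Union>i\<in>{d+1..d}. wt i) = {0}" by simp
    show "v \<in> eigenspace a (theta i)" using that by (simp add: ev_def)
    show "a x - scale (theta j) x \<in> span (\<Union>i\<in>{j+1..d}. wt i)"
      if "x \<in> span (\<Union>i\<in>{j..d}. wt i)" for j x using upper_wt_step[OF that] .
    show "theta i \<noteq> theta j" if "0 \<le> j" for j using assms that by (simp add: theta_inject)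
    show "0 \<le> d + 1" using d_nonneg by simp
  qed simp
  then show ?thesis using subspace_0[OF subspace_ev] by blast
qed

lemma lower_ev_neg: "j < 0 \<Longrightarrow> lower_ev j = {0}"
  using ev_neg subspace_0[OF subspace_lower_ev]
    span_minimal[of "\<Union>i\<in>{..j}. ev i" "{0}"] by (force simp: lower_ev_def)

lemma wt_top_not_lower: "wt d \<inter> lower_wt (d - 1) = {0}"
proof -
  have "v = 0" if "v \<in> wt d" "v \<in> lower_wt (d - 1)" for v
  proof (rule eigenvector_flag_zero)
    show "v \<in> lower_wt (d - 1 - 0)" using that by simp
    show "lower_wt (d - 1 - d) = {0}" by (simp add: lower_wt_neg)
    show "v \<in> eigenspace k (theta d)" using that by (simp add: wt_def theta_def)
    show "theta d \<noteq> theta (d - 1 - j)" if "0 \<le> j" for j using that by (simp add: theta_inject)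
    show "k x - scale (theta (d - 1 - j)) x \<in> lower_wt (d - 1 - (j + 1))"
      if "x \<in> lower_wt (d - 1 - j)" for j x
    proof (rule endo_span[OF endo_shift[OF endo_k] subspace_lower_wt _ that[unfolded lower_wt_def]])
      fix x assume "x \<in> (\<Union>i\<in>{..d - 1 - j}. wt i)"
      then obtain i where i: "i \<le> d - 1 - j" "x \<in> wt i" by auto
      show "k x - scale (theta (d - 1 - j)) x \<in> lower_wt (d - 1 - (j + 1))"
      proof (cases "i = d - 1 - j")
        case True
        then show ?thesis
          using i(2) by (simp add: wt_theta subspace_0[OF subspace_lower_wt])
      next
        case False
        then have "x \<in> lower_wt (d - 1 - (j + 1))"
          using i wt_subset_lower[of i "d - 1 - (j + 1)"] by auto
        then show ?thesis
          unfolding wt_theta(1)[OF i(2)] using subspace_lower_wt by (metis subspace_diff subspace_scale)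
      qed
    qed
  qed (auto simp: d_nonneg subspace_lower_wt)
  then show ?thesis
    using subspace_0[OF subspace_wt] subspace_0[OF subspace_lower_wt] by blast
qed

text \<open>
  By \<open>upper_wt_step\<close>, the operator \<open>a - theta 0\<close> maps into the sum of the weight spaces other than the lowest,
  so it is not onto, and thus not injective either.
\<close>

lemma ev_bottom: "ev 0 \<noteq> {0}"
proof
  assume 0: "ev 0 = {0}"
  let ?f = "\<lambda>v. a v - scale (theta 0) v"
  have f: "endo ?f" by (rule endo_shift[OF endo_a])
  have "inj ?f"
  proof (rule injI)
    fix x y assume "?f x = ?f y"
    then have "x - y \<in> ev 0"
      by (simp add: ev_def eigenspace_def endo_simps[OF endo_a] algebra_simps)
    then show "x = y" using 0 by simp
  qed
  then have "surj ?f" by (rule linear_inj_imp_surj[OF f])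
  moreover have "?f v \<in> span (\<Union>i\<in>{0+1..d}. wt i)" for v
    by (rule upper_wt_step) (simp add: wt_span)
  then have "range ?f \<subseteq> span (\<Union>i\<in>{1..d}. wt i)" by auto
  ultimately have span: "span (\<Union>i\<in>{1..d}. wt i) = UNIV" by blast
  obtain v where v: "v \<in> wt 0" "v \<noteq> 0" using wt_bottom subspace_0[OF subspace_wt] by blast
  have "q powi (2 * 0 - d) \<in> (\<lambda>i. q powi (2 * i - d)) ` {1..d}"
    by (rule eigenvalue_of_spanning[OF _ _ endo_k _ _ v(2)])
      (use span v(1) in \<open>auto simp: wt_def inj_on_def powi_inj\<close>)
  then show False by (auto simp: powi_inj)
qed

lemma k_ec: "k (e v) = scale qq (e (k v))" "k (c v) = scale (inverse qq) (c (k v))"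
  using k_e[of v] k_c[of v] by (simp_all only: powi_double)

lemma k'_ec: "k' (e v) = scale (inverse qq) (e (k' v))" "k' (c v) = scale qq (c (k' v))"
  using qq_nonzero k'_commute[of e "qq" v] k'_commute[of c "inverse qq" v] k_ec endo_e endo_c
  by simp_all

lemma a_k': "a (k' v) = scale qq (k' (a v)) + scale (1 - qq) v"
  using qq_nonzero
  by (simp add: a_def simps k_k' k'_k k'_ec qq_cancel scale_right_distrib scale_left_diff_distrib)

lemma k'_ev: assumes "v \<in> ev i" shows "k' v - scale (inverse (theta i)) v \<in> ev (i + 1)"
  using theta_nonzero[of i]
  by (simp add: ev_def eigenspace_def endo_simps[OF endo_a] a_k' ev_a[OF assms] theta_Suc
      scale_right_diff_distrib scale_left_diff_distrib simps)

text \<open>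
  A component of \<open>a x - theta j x\<close> in an eigenspace other than \<open>ev j\<close> can be removed by changing \<open>x\<close>.
\<close>

lemma ev_absorb:
  assumes "y \<in> ev m" "m \<noteq> j" "x' = x - scale (inverse (theta m - theta j)) y"
  shows "a x' - scale (theta j) x' = a x - scale (theta j) x - y"
proof -
  have "scale (inverse (theta m - theta j) * theta m - inverse (theta m - theta j) * theta j) y = y"
    using assms(2) by (simp add: theta_inject flip: right_diff_distrib)
  then show ?thesis
    by (simp add: assms(3) endo_simps[OF endo_a] ev_a[OF assms(1)] scale_right_diff_distrib
        scale_left_diff_distrib algebra_simps)
qed

text \<open>
  The Serre relation is the vanishing of $e c_2 - q^2 c_2 e$, where $c_1 = e c - q^{-2} c e$ and
  $c_2 = e c_1 - c_1 e$. If $v$ is an eigenvector of $a = k + e$ for $\theta$, then $k v = \theta v - e v$.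
  As $c$, $c_1$ and $c_2$ have weights $-2$, $0$ and $2$, it follows that
  $(a - q^{-2}\theta) c v = c_1 v$, $(a - \theta) c_1 v = c_2 v$ and
  $(a - q^2\theta) c_2 v = (e c_2 - q^2 c_2 e) v = 0$. So $c v$ is a sum of eigenvectors for $q^{-2}\theta$,
  $\theta$ and $q^2\theta$.
\<close>

lemma c_ev: assumes v: "v \<in> ev i" shows "c v \<in> lower_ev (i + 1)"
proof -
  define c1 where "c1 x = e (c x) - scale (inverse qq) (c (e x))" for x
  define c2 where "c2 x = e (c1 x) - c1 (e x)" for x
  have kv: "k v = scale (theta i) v - e v"
    using ev_a[OF v] by (simp add: a_def algebra_simps)
  have s0: "a (c v) - scale (theta (i - 1)) (c v) = c1 v"
    by (simp add: a_def k_ec kv c1_def theta_pred simps qq_cancel scale_right_diff_distrib algebra_simps)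
  have s1: "a (c1 v) - scale (theta i) (c1 v) = c2 v"
    using qq_nonzero
    by (simp add: a_def k_ec kv c1_def c2_def simps qq_cancel scale_right_diff_distrib algebra_simps)
  have "a (c2 v) - scale (theta (i + 1)) (c2 v) = e (c2 v) - scale qq (c2 (e v))"
    using qq_nonzero unfolding theta_Suc
    by (simp add: a_def k_ec kv c1_def c2_def simps qq_cancel scale_right_diff_distrib algebra_simps)
  also have "\<dots> = 0"
    using serre[of v] qq_nonzero
    by (simp add: qint_3 qq_cancel c1_def c2_def simps scale_right_diff_distrib scale_left_distrib algebra_simps)
  finally have c2: "c2 v \<in> ev (i + 1)" by (simp add: ev_def eigenspace_def)
  \<comment> \<open>The eigenvectors are split off from \<open>c v\<close> one at a time, from the highest eigenvalue down.\<close>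
  define x1 where "x1 = c1 v - scale (inverse (theta (i + 1) - theta i)) (c2 v)"
  have x1: "x1 \<in> ev i"
    using ev_absorb[OF c2 _ x1_def] s1 by (simp add: ev_def eigenspace_def)
  define y where "y = scale (inverse (theta (i + 1) - theta i)) (c2 v)"
  have y: "y \<in> ev (i + 1)" unfolding y_def by (rule subspace_scale[OF subspace_ev c2])
  define x2 where "x2 = c v - scale (inverse (theta i - theta (i - 1))) x1"
  define x3 where "x3 = x2 - scale (inverse (theta (i + 1) - theta (i - 1))) y"
  have "a x3 - scale (theta (i - 1)) x3 = a x2 - scale (theta (i - 1)) x2 - y"
    by (rule ev_absorb[OF y _ x3_def]) simp
  also have "\<dots> = a (c v) - scale (theta (i - 1)) (c v) - x1 - y"
    by (subst ev_absorb[OF x1 _ x2_def]) simp_all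
  also have "\<dots> = 0" by (simp add: s0 x1_def y_def)
  finally have x3: "x3 \<in> ev (i - 1)" by (simp add: ev_def eigenspace_def)
  have "c v = x3 + scale (inverse (theta (i + 1) - theta (i - 1))) y
      + scale (inverse (theta i - theta (i - 1))) x1"
    by (simp add: x3_def x2_def)
  also have "\<dots> \<in> lower_ev (i + 1)"
    using x1 y x3 ev_subset_lower[of "i - 1" "i + 1"] ev_subset_lower[of i "i + 1"]
      ev_subset_lower[of "i + 1" "i + 1"]
    by (intro subspace_add subspace_scale subspace_lower_ev) auto
  finally show ?thesis .
qed

lemma a_lower_wt: assumes "x \<in> lower_wt j" shows "a x \<in> lower_wt (j + 1)"
proof (rule endo_span[OF endo_a subspace_lower_wt _ assms[unfolded lower_wt_def]])
  fix x assume "x \<in> (\<Union>i\<in>{..j}. wt i)"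
  then obtain i where i: "i \<le> j" "x \<in> wt i" by auto
  have "k x \<in> lower_wt (j + 1)"
    unfolding wt_theta(1)[OF i(2)] using i wt_subset_lower[of i "j + 1"] subspace_lower_wt
    by (auto intro: subspace_scale)
  moreover have "e x \<in> lower_wt (j + 1)"
    using e_wt[OF i(2)] wt_subset_lower[of "i + 1" "j + 1"] i(1) by auto
  ultimately show "a x \<in> lower_wt (j + 1)"
    unfolding a_def by (intro subspace_add subspace_lower_wt)
qed

lemma c_lower_wt: assumes "x \<in> lower_wt j" shows "c x \<in> lower_wt (j - 1)"
proof (rule endo_span[OF endo_c subspace_lower_wt _ assms[unfolded lower_wt_def]])
  fix x assume "x \<in> (\<Union>i\<in>{..j}. wt i)"
  then obtain i where "i \<le> j" "x \<in> wt i" by auto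
  then show "c x \<in> lower_wt (j - 1)"
    using c_wt[of x i] wt_subset_lower[of "i - 1" "j - 1"] by auto
qed

lemma k'_lower_wt:
  assumes "x \<in> lower_wt j" shows "k' x - scale (inverse (theta j)) x \<in> lower_wt (j - 1)"
proof (rule endo_span[OF endo_shift[OF endo_k'] subspace_lower_wt _ assms[unfolded lower_wt_def]])
  fix x assume "x \<in> (\<Union>i\<in>{..j}. wt i)"
  then obtain i where i: "i \<le> j" "x \<in> wt i" by auto
  show "k' x - scale (inverse (theta j)) x \<in> lower_wt (j - 1)"
  proof (cases "i = j")
    case True
    then show ?thesis using i(2) by (simp add: wt_theta subspace_0[OF subspace_lower_wt])
  next
    case False
    then have "x \<in> lower_wt (j - 1)" using i wt_subset_lower[of i "j - 1"] by auto
    then show ?thesis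
      unfolding wt_theta(2)[OF i(2)] using subspace_lower_wt by (metis subspace_diff subspace_scale)
  qed
qed

lemma a_lower_ev: assumes "x \<in> lower_ev j" shows "a x - scale (theta j) x \<in> lower_ev (j - 1)"
proof (rule endo_span[OF endo_shift[OF endo_a] subspace_lower_ev _ assms[unfolded lower_ev_def]])
  fix x assume "x \<in> (\<Union>i\<in>{..j}. ev i)"
  then obtain i where i: "i \<le> j" "x \<in> ev i" by auto
  show "a x - scale (theta j) x \<in> lower_ev (j - 1)"
  proof (cases "i = j")
    case True
    then show ?thesis using i(2) by (simp add: ev_a subspace_0[OF subspace_lower_ev])
  next
    case False
    then have "x \<in> lower_ev (j - 1)" using i ev_subset_lower[of i "j - 1"] by auto
    then show ?thesis
      unfolding ev_a[OF i(2)] using subspace_lower_ev by (metis subspace_diff subspace_scale)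
  qed
qed

lemma c_lower_ev: assumes "x \<in> lower_ev j" shows "c x \<in> lower_ev (j + 1)"
proof (rule endo_span[OF endo_c subspace_lower_ev _ assms[unfolded lower_ev_def]])
  fix x assume "x \<in> (\<Union>i\<in>{..j}. ev i)"
  then obtain i where "i \<le> j" "x \<in> ev i" by auto
  then show "c x \<in> lower_ev (j + 1)"
    using c_ev[of x i] lower_ev_mono[of "i + 1" "j + 1"] by auto
qed

lemma k'_lower_ev: assumes "x \<in> lower_ev j" shows "k' x \<in> lower_ev (j + 1)"
proof (rule endo_span[OF endo_k' subspace_lower_ev _ assms[unfolded lower_ev_def]])
  fix x assume "x \<in> (\<Union>i\<in>{..j}. ev i)"
  then obtain i where i: "i \<le> j" "x \<in> ev i" by auto
  have "(k' x - scale (inverse (theta i)) x) + scale (inverse (theta i)) x \<in> lower_ev (j + 1)"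
    using k'_ev[OF i(2)] ev_subset_lower[of "i + 1" "j + 1"] ev_subset_lower[of i "j + 1"] i
    by (intro subspace_add subspace_scale subspace_lower_ev) auto
  then show "k' x \<in> lower_ev (j + 1)" by simp
qed

text \<open>
  With respect to the two flags, \<open>a\<close> lowers the first index up to a scalar and raises the second, whereas \<open>c\<close>
  and (up to a scalar) \<open>k'\<close> raise the first and lower the second. So the sum of the intersections is invariant;
  it lies in \<open>lower_wt (d - 1)\<close>.
\<close>

lemma lower_flags_disjoint: "lower_ev i \<inter> lower_wt (d - 1 - i) = {0}"
proof -
  define M where "M i = lower_ev i \<inter> lower_wt (d - 1 - i)" for i
  define W where "W = span (\<Union>i. M i)"
  have M: "x \<in> W" if "x \<in> M i" for x i using that unfolding W_def by (auto intro: span_base)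
  have sub: "subspace W" by (simp add: W_def)
  have "W = {0} \<or> W = UNIV"
  proof (rule irreducible'[OF sub])
    fix w assume "w \<in> W"
    then have w: "w \<in> span (\<Union>i. M i)" by (simp add: W_def)
    show "c w \<in> W"
    proof (rule endo_span[OF endo_c sub _ w])
      fix x assume "x \<in> (\<Union>i. M i)"
      then obtain i where "x \<in> M i" by auto
      then have "c x \<in> M (i + 1)"
        using c_lower_ev[of x i] c_lower_wt[of x "d - 1 - i"] by (simp add: M_def algebra_simps)
      then show "c x \<in> W" by (rule M)
    qed
    show "k' w \<in> W"
    proof (rule endo_span[OF endo_k' sub _ w])
      fix x assume "x \<in> (\<Union>i. M i)"
      then obtain i where x: "x \<in> M i" by auto
      let ?s = "scale (inverse (theta (d - 1 - i))) x"
      have "?s \<in> lower_ev (i + 1)"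
        using x lower_ev_mono[of i "i + 1"] subspace_lower_ev by (auto simp: M_def intro: subspace_scale)
      then have "k' x - ?s \<in> M (i + 1)"
        using x k'_lower_ev[of x i] k'_lower_wt[of x "d - 1 - i"]
        by (auto simp: M_def algebra_simps intro: subspace_diff subspace_lower_ev)
      then have "(k' x - ?s) + ?s \<in> W"
        using M x sub by (blast intro: subspace_add subspace_scale)
      then show "k' x \<in> W" by simp
    qed
    have "a w \<in> W"
    proof (rule endo_span[OF endo_a sub _ w])
      fix x assume "x \<in> (\<Union>i. M i)"
      then obtain i where x: "x \<in> M i" by auto
      let ?s = "scale (theta i) x"
      have "?s \<in> lower_wt (d - 1 - (i - 1))"
        using x lower_wt_mono[of "d - 1 - i" "d - 1 - (i - 1)"] subspace_lower_wt
        by (auto simp: M_def intro!: subspace_scale)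
      then have "a x - ?s \<in> M (i - 1)"
        using x a_lower_ev[of x i] a_lower_wt[of x "d - 1 - i"]
        by (auto simp: M_def algebra_simps intro!: subspace_diff[OF subspace_lower_wt])
      then have "(a x - ?s) + ?s \<in> W"
        using M x sub by (blast intro: subspace_add subspace_scale)
      then show "a x \<in> W" by simp
    qed
    then show "k w + e w \<in> W" by (simp add: a_def)
  qed
  moreover have "W \<noteq> UNIV"
  proof
    assume "W = UNIV"
    moreover have "M i \<subseteq> lower_wt (d - 1)" for i
      using lower_wt_mono[of "d - 1 - i" "d - 1"] lower_ev_neg[of i]
        subspace_0[OF subspace_lower_wt, of "d - 1"]
      by (cases "i < 0") (auto simp: M_def)
    then have "W \<subseteq> lower_wt (d - 1)"
      unfolding W_def by (intro span_minimal subspace_lower_wt) auto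
    ultimately show False using wt_top_not_lower wt_top by auto
  qed
  ultimately have "W = {0}" by blast
  moreover have "0 \<in> M i"
    by (simp add: M_def subspace_0[OF subspace_lower_wt] subspace_0[OF subspace_lower_ev])
  ultimately have "M i = {0}" using M[of _ i] by blast
  then show ?thesis by (simp add: M_def)
qed

text \<open>
  Likewise the intersection of the sums is invariant; it contains \<open>ev 0\<close>, since \<open>ev 0\<close> lies in the first
  summand if \<open>i\<close> is nonnegative, and otherwise the second summand is the whole space.
\<close>

lemma lower_flags_sum:
  obtains x y where "v = x + y" "x \<in> lower_ev i" "y \<in> lower_wt (d - 1 - i)"
proof -
  define M where "M i = {x + y | x y. x \<in> lower_ev i \<and> y \<in> lower_wt (d - 1 - i)}" for i
  have sub: "subspace (M i)" for i
    unfolding M_def by (intro subspace_sums subspace_lower_ev subspace_lower_wt)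
  have ev: "x \<in> M i" if "x \<in> lower_ev i" for x i
    using that subspace_0[OF subspace_lower_wt] unfolding M_def by force
  have wt: "x \<in> M i" if "x \<in> lower_wt (d - 1 - i)" for x i
    using that subspace_0[OF subspace_lower_ev] unfolding M_def by force
  define W where "W = (\<Inter>i. M i)"
  have "W = {0} \<or> W = UNIV"
  proof (rule irreducible')
    show "subspace W" unfolding W_def by (intro subspace_Inter) (use sub in auto)
  next
    fix w assume w: "w \<in> W"
    have dec: "\<exists>x y. w = x + y \<and> x \<in> lower_ev i \<and> y \<in> lower_wt (d - 1 - i)" for i
      using w unfolding W_def M_def by blast
    have "c w \<in> M i" for i
    proof -
      obtain x y where xy: "w = x + y" "x \<in> lower_ev (i - 1)" "y \<in> lower_wt (d - 1 - (i - 1))"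
        using dec by blast
      show ?thesis
        using c_lower_ev[OF xy(2)] c_lower_wt[OF xy(3)]
        unfolding xy(1) simps by (intro subspace_add[OF sub] ev wt) (simp_all add: algebra_simps)
    qed
    then show "c w \<in> W" by (simp add: W_def)
    have "k' w \<in> M i" for i
    proof -
      obtain x y where xy: "w = x + y" "x \<in> lower_ev (i - 1)" "y \<in> lower_wt (d - 1 - (i - 1))"
        using dec by blast
      let ?\<theta> = "inverse (theta (d - 1 - (i - 1)))"
      have "k' x \<in> M i" using k'_lower_ev[OF xy(2)] by (intro ev) simp
      moreover have "scale ?\<theta> x \<in> M i"
        using xy(2) lower_ev_mono[of "i - 1" i] by (intro subspace_scale[OF sub] ev) auto
      moreover have "k' y - scale ?\<theta> y \<in> M i"
        using k'_lower_wt[OF xy(3)] by (intro wt) (simp add: algebra_simps)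
      moreover have "scale ?\<theta> w \<in> M i"
        using w sub by (simp add: W_def subspace_scale)
      moreover have "k' w = (k' x - scale ?\<theta> x) + (k' y - scale ?\<theta> y) + scale ?\<theta> w"
        by (simp add: xy(1) simps scale_right_distrib)
      ultimately show ?thesis using sub by (metis subspace_add subspace_diff)
    qed
    then show "k' w \<in> W" by (simp add: W_def)
    have "a w \<in> M i" for i
    proof -
      obtain x y where xy: "w = x + y" "x \<in> lower_ev (i + 1)" "y \<in> lower_wt (d - 1 - (i + 1))"
        using dec by blast
      let ?\<theta> = "theta (i + 1)"
      have "a y \<in> M i" using a_lower_wt[OF xy(3)] by (intro wt) (simp add: algebra_simps)
      moreover have "scale ?\<theta> y \<in> M i"
        using xy(3) lower_wt_mono[of "d - 1 - (i + 1)" "d - 1 - i"]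
        by (intro subspace_scale[OF sub] wt) auto
      moreover have "a x - scale ?\<theta> x \<in> M i"
        using a_lower_ev[OF xy(2)] by (intro ev) simp
      moreover have "scale ?\<theta> w \<in> M i"
        using w sub by (simp add: W_def subspace_scale)
      moreover have "a w = (a x - scale ?\<theta> x) + (a y - scale ?\<theta> y) + scale ?\<theta> w"
        by (simp add: xy(1) endo_simps[OF endo_a] scale_right_distrib)
      ultimately show ?thesis using sub by (metis subspace_add subspace_diff)
    qed
    then show "k w + e w \<in> W" by (simp add: W_def a_def)
  qed
  moreover have "ev 0 \<subseteq> M i" for i
    using ev_subset_lower[of 0 i] ev lower_wt_top[of "d - 1 - i"] wt by (cases "i \<ge> 0") auto
  then have "ev 0 \<subseteq> W" by (auto simp: W_def)
  ultimately have "W = UNIV"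
    using ev_bottom subspace_0[OF subspace_ev, of 0] by auto
  then have "v \<in> M i" by (auto simp: W_def)
  then show ?thesis using that unfolding M_def by blast
qed

text \<open>Since the two flags are opposite, the space is the direct sum of the spaces \<open>summand i\<close>.\<close>

definition summand :: "int \<Rightarrow> 'v set" where "summand i = lower_ev i \<inter> lower_wt (d - i)"

lemma subspace_summand: "subspace (summand i)"
  by (simp add: summand_def subspace_inter subspace_lower_ev subspace_lower_wt)

lemma summand_span: "span (\<Union>i\<in>{0..d}. summand i) = UNIV"
proof -
  have "int n \<le> d + 1 \<Longrightarrow> lower_ev (int n - 1) \<subseteq> span (\<Union>i\<in>{0..d}. summand i)" for n
  proof (induction n)
    case 0
    then show ?case by (simp add: lower_ev_neg span_zero)
  next
    case (Suc n)
    show ?case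
    proof
      fix v assume v: "v \<in> lower_ev (int (Suc n) - 1)"
      obtain x y where xy: "v = x + y" "x \<in> lower_ev (int n - 1)" "y \<in> lower_wt (d - 1 - (int n - 1))"
        by (rule lower_flags_sum)
      have "x \<in> lower_ev (int n)" using xy(2) lower_ev_mono[of "int n - 1" "int n"] by auto
      then have "v - x \<in> lower_ev (int n)" using v by (intro subspace_diff subspace_lower_ev) auto
      then have "y \<in> summand (int n)" using xy by (simp add: summand_def)
      then have "y \<in> span (\<Union>i\<in>{0..d}. summand i)" using Suc.prems by (intro span_base) auto
      moreover have "x \<in> span (\<Union>i\<in>{0..d}. summand i)" using Suc.IH Suc.prems xy(2) by auto
      ultimately show "v \<in> span (\<Union>i\<in>{0..d}. summand i)" unfolding xy(1) by (rule span_add[rotated])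
    qed
  qed
  from this[of "nat (d + 1)"] have "lower_ev d \<subseteq> span (\<Union>i\<in>{0..d}. summand i)"
    using d_nonneg by simp
  moreover have "v \<in> lower_ev d" for v
    using lower_flags_sum[of v d] lower_wt_neg[of "d - 1 - d"] by auto
  ultimately show ?thesis by auto
qed

lemma summand_independent:
  assumes "\<And>i. i \<in> {0..d} \<Longrightarrow> z i \<in> summand i" "(\<Sum>i\<in>{0..d}. z i) = 0"
  shows "\<forall>i\<in>{0..d}. z i = 0"
proof (rule ccontr)
  assume "\<not> ?thesis"
  then have ne: "{i\<in>{0..d}. z i \<noteq> 0} \<noteq> {}" (is "?N \<noteq> {}") by auto
  define m where "m = Max ?N"
  have m: "m \<in> ?N" unfolding m_def using ne by (intro Max_in finite_subset[of ?N "{0..d}"]) auto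
  have "z i = 0" if "i \<in> {m+1..d}" for i
  proof (rule ccontr)
    assume "z i \<noteq> 0"
    then have "i \<le> m" unfolding m_def using that m by (intro Max_ge finite_subset[of ?N "{0..d}"]) auto
    then show False using that by simp
  qed
  moreover have "{0..d} = insert m {0..m-1} \<union> {m+1..d}" using m by auto
  then have "(\<Sum>i\<in>{0..d}. z i) = z m + (\<Sum>i\<in>{0..m-1}. z i) + (\<Sum>i\<in>{m+1..d}. z i)"
    by (simp add: sum.union_disjoint)
  ultimately have "z m = - (\<Sum>i\<in>{0..m-1}. z i)"
    using assms(2) by (simp add: eq_neg_iff_add_eq_0)
  also have "\<dots> \<in> lower_ev (m - 1)"
  proof (intro subspace_neg subspace_sum subspace_lower_ev)
    fix i assume "i \<in> {0..m-1}"
    then show "z i \<in> lower_ev (m - 1)"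
      using assms(1)[of i] m lower_ev_mono[of i "m - 1"] by (auto simp: summand_def)
  qed
  finally have "z m \<in> lower_ev (m - 1) \<inter> lower_wt (d - 1 - (m - 1))"
    using assms(1)[of m] m by (auto simp: summand_def)
  then show False using m unfolding lower_flags_disjoint by simp
qed

lemma summand_outside: "i \<notin> {0..d} \<Longrightarrow> summand i = {0}"
  using lower_ev_neg[of i] lower_wt_neg[of "d - i"]
    subspace_0[OF subspace_lower_ev, of i] subspace_0[OF subspace_lower_wt, of "d - i"]
  by (cases "i < 0") (auto simp: summand_def)

lemma a_summand: assumes "z \<in> summand i" shows "a z - scale (theta i) z \<in> summand (i - 1)"
proof -
  have "z \<in> lower_wt (d - (i - 1))"
    using assms lower_wt_mono[of "d - i" "d - (i - 1)"] by (auto simp: summand_def)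
  then show ?thesis
    using assms a_lower_ev[of z i] a_lower_wt[of z "d - i"]
    by (auto simp: summand_def algebra_simps intro!: subspace_diff subspace_scale subspace_lower_wt)
qed

lemma c_summand: assumes "z \<in> summand i" shows "c z \<in> summand (i + 1)"
  using assms c_lower_ev[of z i] c_lower_wt[of z "d - i"] by (simp add: summand_def algebra_simps)

lemma k'_summand: assumes "z \<in> summand i" shows "k' z - scale (theta i) z \<in> summand (i + 1)"
proof -
  have theta: "inverse (theta (d - i)) = theta i"
    by (simp only: inverse_theta) (simp add: theta_def)
  have "z \<in> lower_ev (i + 1)"
    using assms lower_ev_mono[of i "i + 1"] by (auto simp: summand_def)
  then show ?thesis
    using assms k'_lower_ev[of z i] k'_lower_wt[of z "d - i"]
    by (auto simp: summand_def theta algebra_simps intro!: subspace_diff subspace_scale subspace_lower_ev)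
qed

text \<open>
  The operator \<open>t\<close> acts on \<open>summand i\<close> as the inverse of \<open>theta i\<close>. Its relations with \<open>c\<close>, \<open>k'\<close> and \<open>a\<close> are
  checked on each summand. The first two show that \<open>t - k\<close> has weight $-2$ and that \<open>(t - k) k'\<close> commutes with
  \<open>c\<close>; the third is then a formula for its commutator with \<open>e\<close>.
\<close>

lemma lowering_operator_exists:
  obtains f where "endo f" "\<And>v. k (f v) = scale (q powi -2) (f (k v))"
    "\<And>v. e (f v) - f (e v) = scale (inverse (q - inverse q)) (k v - k' v)"
    "\<And>v. c (f v) = f (c v)"
proof -
  obtain t where t: "endo t" and "\<And>i z. i \<in> {0..d} \<Longrightarrow> z \<in> summand i \<Longrightarrow> t z = scale (inverse (theta i)) z"
    using scalar_operator_exists[of "{0..d}" summand "\<lambda>i. inverse (theta i)"]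
      summand_span summand_independent subspace_summand by blast
  then have ts: "t z = scale (inverse (theta i)) z" if "z \<in> summand i" for z i
    using that summand_outside[of i] by (cases "i \<in> {0..d}") (auto simp: endo_zero)
  note t_simps = endo_simps[OF t] simps endo_simps[OF endo_a]
  have eqI: "g = h" if "endo g" "endo h" "\<And>i z. z \<in> summand i \<Longrightarrow> g z = h z" for g h
    using endo_eq_on_spanning[OF that(1,2) summand_span] that(3) by blast
  have tc: "t (c v) = scale (inverse qq) (c (t v))" for v
  proof -
    have "(\<lambda>v. t (c v)) = (\<lambda>v. scale (inverse qq) (c (t v)))"
    proof (rule eqI)
      fix i z assume z: "z \<in> summand i"
      show "t (c z) = scale (inverse qq) (c (t z))"
        by (simp add: ts[OF c_summand[OF z]] ts[OF z] theta_Suc simps)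
    qed (simp_all add: endo_iff t_simps scale_right_distrib)
    then show ?thesis by (rule fun_cong)
  qed
  have tk': "t (k' v) = scale (inverse qq) (k' (t v)) + scale (1 - inverse qq) v" for v
  proof -
    have "(\<lambda>v. t (k' v)) = (\<lambda>v. scale (inverse qq) (k' (t v)) + scale (1 - inverse qq) v)"
    proof (rule eqI)
      fix i z assume z: "z \<in> summand i"
      have "t (k' z) = t (k' z - scale (theta i) z) + scale (theta i) (t z)"
        by (simp add: t_simps)
      also have "\<dots> = scale (inverse qq) (scale (inverse (theta i)) (k' z) - z) + z"
        using theta_nonzero[of i]
        by (simp add: ts[OF k'_summand[OF z]] ts[OF z] theta_Suc scale_right_diff_distrib)
      also have "\<dots> = scale (inverse qq) (k' (t z)) + scale (1 - inverse qq) z"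
        by (simp add: ts[OF z] simps scale_right_diff_distrib scale_left_diff_distrib)
      finally show "t (k' z) = scale (inverse qq) (k' (t z)) + scale (1 - inverse qq) z" .
    qed (simp_all add: endo_iff t_simps scale_right_distrib scale_left_commute algebra_simps)
    then show ?thesis by (rule fun_cong)
  qed
  have ta: "t (a v) = scale qq (a (t v)) + scale (1 - qq) v" for v
  proof -
    have "(\<lambda>v. t (a v)) = (\<lambda>v. scale qq (a (t v)) + scale (1 - qq) v)"
    proof (rule eqI)
      fix i z assume z: "z \<in> summand i"
      have "t (a z) = t (a z - scale (theta i) z) + scale (theta i) (t z)"
        by (simp add: t_simps)
      also have "\<dots> = scale qq (scale (inverse (theta i)) (a z) - z) + z"
        using theta_nonzero[of i]
        by (simp add: ts[OF a_summand[OF z]] ts[OF z] theta_pred scale_right_diff_distrib)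
      also have "\<dots> = scale qq (a (t z)) + scale (1 - qq) z"
        by (simp add: ts[OF z] t_simps scale_right_diff_distrib scale_left_diff_distrib)
      finally show "t (a z) = scale qq (a (t z)) + scale (1 - qq) z" .
    qed (simp_all add: endo_iff t_simps scale_right_distrib scale_left_commute algebra_simps)
    then show ?thesis by (rule fun_cong)
  qed
  have kt: "k (t v) = scale (inverse qq) (t (k v)) + scale (1 - inverse qq) (k (k v))" for v
    using arg_cong[OF tk'[of "k v"], of k] by (simp add: simps k_k' k'_k)
  have te: "t (e v) = scale qq (e (t v)) + scale (qq - 1) (k (k v)) + scale (1 - qq) v" for v
  proof -
    have "t (k v) + t (e v) = scale qq (k (t v)) + scale qq (e (t v)) + scale (1 - qq) v"
      using ta[of v] by (simp add: a_def t_simps scale_right_distrib)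
    also have "scale qq (k (t v)) = t (k v) + scale (qq - 1) (k (k v))"
      using qq_nonzero by (simp add: kt qq_cancel scale_right_distrib right_diff_distrib)
    finally show ?thesis by (simp add: algebra_simps)
  qed
  \<comment> \<open>\<open>\<gamma>\<close> is chosen to give the commutator of \<open>e\<close> and \<open>f\<close> its coefficient.\<close>
  define \<gamma> where "\<gamma> = inverse ((inverse qq - 1) * (q - inverse q))"
  define f where "f v = scale \<gamma> (t (k' v) - v)" for v
  have nz: "inverse qq - 1 \<noteq> 0"
    using qq_neq_1 by (auto simp: field_simps)
  show ?thesis
  proof
    show "endo f"
      by (simp add: endo_iff f_def t_simps scale_right_distrib scale_right_diff_distrib
          algebra_simps)
    show "k (f v) = scale (q powi -2) (f (k v))" for v
      by (simp add: f_def t_simps k_k' k'_k kt powi_double scale_right_distrib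
          scale_right_diff_distrib scale_left_diff_distrib algebra_simps)
    show "c (f v) = f (c v)" for v
      using qq_nonzero by (simp add: f_def t_simps k'_ec tc)
    show "e (f v) - f (e v) = scale (inverse (q - inverse q)) (k v - k' v)" for v
    proof -
      have "t (k' (e v)) = e (t (k' v)) + scale (1 - inverse qq) (k v - k' v)"
        using qq_nonzero
        by (simp add: k'_ec t_simps te k_k' scale_right_distrib scale_right_diff_distrib
            scale_left_diff_distrib algebra_simps)
      moreover have "e (f v) - f (e v) = scale \<gamma> (e (t (k' v)) - t (k' (e v)))"
        by (simp add: f_def t_simps scale_right_diff_distrib)
      ultimately have "e (f v) - f (e v) = scale \<gamma> (- scale (1 - inverse qq) (k v - k' v))"
        by simp
      also have "\<dots> = scale (\<gamma> * (inverse qq - 1)) (k v - k' v)"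
        by (simp add: right_diff_distrib flip: scale_minus_left)
      also have "\<gamma> * (inverse qq - 1) = inverse (q - inverse q)"
        using nz q_diff_nonzero by (simp add: \<gamma>_def)
      finally show ?thesis .
    qed
  qed
qed

end

section \<open>Weight modules over quantum \<open>sl\<^sub>2\<close>\<close>

text \<open>
  A diagonalisable \<open>k\<close> together with the operators \<open>e\<close> and \<open>f\<close> of quantum $sl_2$.
\<close>

locale sl2_action = weight_operator scale q d k k'
  for scale :: "'f::field \<Rightarrow> 'v::ab_group_add \<Rightarrow> 'v" and q d k k' +
  fixes e f :: "'v \<Rightarrow> 'v"
  assumes endo_e: "endo e" and endo_f: "endo f"
    and k_e: "\<And>v. k (e v) = scale (q powi 2) (e (k v))"
    and k_f: "\<And>v. k (f v) = scale (q powi -2) (f (k v))"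
    and e_f: "\<And>v. e (f v) - f (e v) = scale (inverse (q - inverse q)) (k v - k' v)"
begin

lemma e_wt: "v \<in> wt i \<Longrightarrow> e v \<in> wt (i + 1)"
  using raising_wt[OF endo_e, of 1] k_e by simp

lemma f_wt: "v \<in> wt i \<Longrightarrow> f v \<in> wt (i - 1)"
  using raising_wt[OF endo_f, of "-1"] k_f by simp

lemma funpow_e_wt: "v \<in> wt i \<Longrightarrow> (e ^^ n) v \<in> wt (i + int n)"
proof (induction n)
  case (Suc n)
  then show ?case using e_wt[of "(e ^^ n) v" "i + int n"] by (simp add: algebra_simps)
qed simp

lemma endo_funpow_e: "endo (e ^^ n)"
  by (induction n) (use endo_e in \<open>simp_all add: endo_iff\<close>)

lemma e_f_wt: "v \<in> wt i \<Longrightarrow> e (f v) = f (e v) + scale (h i) v"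
  using e_f[of v] k_minus_k'_wt[of v i] by (simp add: algebra_simps)

lemma funpow_e_f:
  assumes "v \<in> wt i"
  shows "(e ^^ Suc n) (f v) = f ((e ^^ Suc n) v)
    + scale (qint q (int n + 1) * qint q (2 * i - d + int n)) ((e ^^ n) v)"
proof (induction n)
  case 0
  then show ?case using e_f_wt[OF assms] qint_product[of 0 1]
    by (simp add: h_def qint_def q_diff_nonzero)
next
  case (Suc n)
  define w where "w = (e ^^ Suc n) v"
  have w: "w \<in> wt (i + int (Suc n))" "e ((e ^^ n) v) = w"
    unfolding w_def using funpow_e_wt[OF assms] by (blast, simp)
  have "(e ^^ Suc (Suc n)) (f v)
      = e (f w) + scale (qint q (int n + 1) * qint q (2 * i - d + int n)) w"
    unfolding funpow.simps(2)[of "Suc n"] o_apply Suc.IH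
    by (simp add: endo_simps[OF endo_e] w(2))
  also have "\<dots> = f (e w) + scale (qint q (2 * (i + int (Suc n)) - d)
      + qint q (int n + 1) * qint q (2 * i - d + int n)) w"
    by (simp add: e_f_wt[OF w(1)] h_def scale_left_distrib)
  also have "qint q (2 * (i + int (Suc n)) - d) + qint q (int n + 1) * qint q (2 * i - d + int n)
      = qint q (int (Suc n) + 1) * qint q (2 * i - d + int (Suc n))"
    using qint_product[of "Suc n" "2 * i - d"] by (simp add: algebra_simps)
  finally show ?case by (simp add: w_def)
qed

text \<open>
  By induction on the weight: if \<open>e ^^ n\<close> kills \<open>v\<close>, then \<open>e ^^ Suc n\<close> kills \<open>f v\<close>, so \<open>f v = 0\<close> by the
  induction hypothesis. But then the commutation formula shows that \<open>e ^^ (n - 1)\<close> kills \<open>v\<close>, and so on down to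
  \<open>v\<close> itself; the coefficients do not vanish as long as \<open>n \<le> d - 2 * i\<close>.
\<close>

lemma funpow_e_injective:
  assumes "v \<in> wt i" "(e ^^ n) v = 0" "int n \<le> d - 2 * i"
  shows "v = 0"
proof -
  have "\<lbrakk>v \<in> wt i; (e ^^ n) v = 0; int n \<le> d - 2 * i; i < int m\<rbrakk> \<Longrightarrow> v = 0" for m i n v
  proof (induction m arbitrary: i n v)
    case 0
    then show ?case using wt_outside[of i] by simp
  next
    case (Suc m)
    have fv: "f v = 0"
    proof (rule Suc.IH)
      show "f v \<in> wt (i - 1)" by (rule f_wt[OF Suc.prems(1)])
      show "(e ^^ Suc n) (f v) = 0"
        using funpow_e_f[OF Suc.prems(1), of n] Suc.prems(2)
        by (simp add: endo_zero[OF endo_e] endo_zero[OF endo_f])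
    qed (use Suc.prems in auto)
    have "int n \<le> d - 2 * i \<Longrightarrow> (e ^^ n) v = 0 \<Longrightarrow> v = 0" for n
    proof (induction n)
      case (Suc n)
      have "scale (qint q (int n + 1) * qint q (2 * i - d + int n)) ((e ^^ n) v) = 0"
        using funpow_e_f[OF \<open>v \<in> wt i\<close>, of n] Suc.prems(2) fv endo_zero[OF endo_funpow_e, of "Suc n"]
        by (simp add: endo_zero[OF endo_f] del: funpow.simps)
      then have "(e ^^ n) v = 0" using Suc.prems(1) by (simp add: qint_eq_0_iff)
      then show ?case using Suc by simp
    qed simp
    then show ?case using Suc.prems by blast
  qed
  from this[of v i n "nat (i + 1)"] assms show ?thesis
    using wt_outside[of i] by (cases "i < 0") auto
qed

text \<open>
  By \<open>funpow_e_f\<close>, \<open>e ^^ Suc n\<close> kills \<open>f v\<close>; and it is injective on \<open>wt (i - 1)\<close>.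
\<close>

lemma f_zero:
  assumes "v \<in> wt i" "(e ^^ n) v = 0" "int n = d - 2 * i + 1"
  shows "f v = 0"
proof (rule funpow_e_injective)
  show "f v \<in> wt (i - 1)" by (rule f_wt[OF assms(1)])
  show "(e ^^ Suc n) (f v) = 0"
    unfolding funpow_e_f[OF assms(1)] using assms(2)
    by (simp add: endo_zero[OF endo_e] endo_zero[OF endo_f])
qed (use assms(3) in simp)

text \<open>
  Let \<open>v\<close> be in \<open>W \<inter> wt i\<close>. If \<open>2 * i \<le> d\<close>, the hypothesis gives \<open>u\<close> in \<open>W \<inter> wt (i - 1)\<close> such that \<open>v - e u\<close>
  is killed by the power of \<open>e\<close> in \<open>f_zero\<close>, so \<open>f v = f (e u)\<close>. Otherwise \<open>v\<close> is the image of some \<open>u\<close> in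
  \<open>W \<inter> wt (d - i)\<close> under a power of \<open>e\<close>. In both cases \<open>u\<close> has a lower weight than \<open>v\<close>.
\<close>

lemma f_invariant:
  assumes W: "subspace W" "\<And>w. w \<in> W \<Longrightarrow> k w \<in> W" "\<And>w. w \<in> W \<Longrightarrow> e w \<in> W"
    and surj: "\<And>i y. 2 * i \<le> d \<Longrightarrow> y \<in> W \<inter> wt (d - i)
      \<Longrightarrow> \<exists>x \<in> W \<inter> wt i. (e ^^ nat (d - 2 * i)) x = y"
    and w: "w \<in> W"
  shows "f w \<in> W"
proof -
  have eW: "(e ^^ n) w \<in> W" if "w \<in> W" for n w
    by (induction n) (use W(3) that in auto)
  have main: "i < int m \<Longrightarrow> v \<in> W \<inter> wt i \<Longrightarrow> f v \<in> W" for m i v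
  proof (induction m arbitrary: i v)
    case 0
    then show ?case using wt_outside[of i] endo_zero[OF endo_f] subspace_0[OF W(1)] by auto
  next
    case (Suc m)
    have v: "v \<in> W" "v \<in> wt i" using Suc.prems by auto
    show ?case
    proof (cases "2 * i \<le> d")
      case True
      define n where "n = nat (d - 2 * i + 1)"
      have n: "int n = d - 2 * i + 1" using True by (simp add: n_def)
      have "i + int n = d - (i - 1)" using n by simp
      then have "(e ^^ n) v \<in> W \<inter> wt (d - (i - 1))"
        using eW[OF v(1)] funpow_e_wt[OF v(2), of n] by (metis IntI)
      then have "\<exists>u \<in> W \<inter> wt (i - 1). (e ^^ nat (d - 2 * (i - 1))) u = (e ^^ n) v"
        using True by (intro surj) simp_all
      moreover have "nat (d - 2 * (i - 1)) = Suc n" using n by simp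
      ultimately obtain u where u: "u \<in> W" "u \<in> wt (i - 1)" "(e ^^ Suc n) u = (e ^^ n) v"
        by (metis IntD1 IntD2)
      have "f (v - e u) = 0"
      proof (rule f_zero[OF _ _ n])
        show "v - e u \<in> wt i" using subspace_diff[OF subspace_wt v(2)] e_wt[OF u(2)] by simp
        show "(e ^^ n) (v - e u) = 0"
          using u(3) by (simp add: endo_simps[OF endo_funpow_e] funpow_swap1)
      qed
      then have "f v = e (f u) - scale (h (i - 1)) u"
        using e_f_wt[OF u(2)] by (simp add: endo_simps[OF endo_f])
      moreover have "f u \<in> W" using Suc.IH[of "i - 1" u] Suc.prems u by auto
      ultimately show ?thesis using W u(1) by (auto intro: subspace_diff subspace_scale)
    next
      case False
      define n where "n = nat (2 * i - d - 1)"
      have "nat (d - 2 * (d - i)) = Suc n" using False by (simp add: n_def)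
      moreover have "\<exists>u \<in> W \<inter> wt (d - i). (e ^^ nat (d - 2 * (d - i))) u = v"
        using False v by (intro surj) simp_all
      ultimately obtain u where u: "u \<in> W" "u \<in> wt (d - i)" "(e ^^ Suc n) u = v"
        by (metis IntD1 IntD2)
      have "f u \<in> W" using Suc.IH[of "d - i" u] Suc.prems u False by auto
      moreover have "f v = (e ^^ Suc n) (f u)
          - scale (qint q (int n + 1) * qint q (2 * (d - i) - d + int n)) ((e ^^ n) u)"
        using funpow_e_f[OF u(2), of n] u(3) by simp
      ultimately show ?thesis using W(1) eW u(1) by (auto intro!: subspace_diff subspace_scale simp del: funpow.simps)
    qed
  qed
  show ?thesis
  proof (rule endo_span[OF endo_f W(1)])
    show "w \<in> span (\<Union>i\<in>{0..d}. W \<inter> wt i)" using wt_graded[OF W(1,2)] w by simp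
    show "f x \<in> W" if x: "x \<in> (\<Union>i\<in>{0..d}. W \<inter> wt i)" for x
    proof -
      obtain i where "0 \<le> i" "x \<in> W \<inter> wt i" using x by auto
      then show ?thesis using main[of i "nat (i + 1)" x] by simp
    qed
  qed
qed

end

text \<open>
  Two actions of quantum $sl_2$ with inverse operators \<open>k\<close> and \<open>k'\<close>. No relation between \<open>e\<close>, \<open>f\<close> on the one hand
  and \<open>c\<close>, \<open>g\<close> on the other is required.
\<close>

locale double_sl2_action = sl2_action scale q d k k' e f + finite_dimensional_vector_space scale Basis
  for scale :: "'f::field \<Rightarrow> 'v::ab_group_add \<Rightarrow> 'v" and q d k k' e f Basis +
  fixes c g :: "'v \<Rightarrow> 'v"
  assumes opposite: "sl2_action scale q d k' k c g"
begin

lemma injective_selfmap_surj: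
  assumes "subspace A" "endo t" "\<And>x. x \<in> A \<Longrightarrow> t x \<in> A" "\<And>x. x \<in> A \<Longrightarrow> t x = 0 \<Longrightarrow> x = 0" "y \<in> A"
  obtains x where "x \<in> A" "t x = y"
proof -
  interpret T: finite_dimensional_vector_space_pair scale Basis scale Basis by unfold_locales
  have inj: "inj_on t A"
  proof (rule inj_onI)
    fix x y assume "x \<in> A" "y \<in> A" "t x = t y"
    then show "x = y"
      using assms(4)[of "x - y"] assms(1) by (auto simp: endo_simps[OF assms(2)] intro: subspace_diff)
  qed
  have "dim (t ` A) = dim A"
    by (rule T.dim_image_eq[OF assms(2)]) (use inj assms(1) in \<open>simp_all add: span_eq_iff[THEN iffD2]\<close>)
  then have "t ` A = A"
    using T.linear_subspace_image[OF assms(2,1)] assms(1,3) by (intro subspace_dim_equal) auto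
  then show ?thesis using that assms(5) by (metis imageE)
qed

text \<open>
  On \<open>W \<inter> wt (d - i)\<close> the composite of \<open>c ^^ (d - 2 * i)\<close> and \<open>e ^^ (d - 2 * i)\<close> is injective, hence onto.
\<close>

lemma raising_onto:
  assumes W: "subspace W" "\<And>w. w \<in> W \<Longrightarrow> e w \<in> W" "\<And>w. w \<in> W \<Longrightarrow> c w \<in> W"
    and i: "2 * i \<le> d" and y: "y \<in> W \<inter> wt (d - i)"
  shows "\<exists>x \<in> W \<inter> wt i. (e ^^ nat (d - 2 * i)) x = y"
proof -
  interpret O: sl2_action scale q d k' k c g by (rule opposite)
  define n where "n = nat (d - 2 * i)"
  have n: "int n = d - 2 * i" using i by (simp add: n_def)
  have O_wt: "O.wt j = wt (d - j)" for j by (rule dual_wt)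
  have c: "(c ^^ n) x \<in> W \<inter> wt i" if "x \<in> W \<inter> wt (d - i)" for x
  proof -
    have "(c ^^ n) x \<in> W" by (induction n) (use W(3) that in auto)
    moreover have "(c ^^ n) x \<in> O.wt (i + int n)"
      using that by (intro O.funpow_e_wt) (simp add: O_wt)
    ultimately show ?thesis by (simp add: O_wt n)
  qed
  have e: "(e ^^ n) x \<in> W \<inter> wt (d - i)" if "x \<in> W \<inter> wt i" for x
  proof -
    have "(e ^^ n) x \<in> W" by (induction n) (use W(2) that in auto)
    then show ?thesis using funpow_e_wt[of x i n] that n by simp
  qed
  obtain z where "z \<in> W \<inter> wt (d - i)" "(e ^^ n) ((c ^^ n) z) = y"
  proof (rule injective_selfmap_surj[OF _ _ _ _ y, of "\<lambda>x. (e ^^ n) ((c ^^ n) x)"])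
    show "subspace (W \<inter> wt (d - i))" by (intro subspace_inter W(1) subspace_wt)
    show "endo (\<lambda>x. (e ^^ n) ((c ^^ n) x))"
      using endo_funpow_e O.endo_funpow_e by (simp add: endo_iff)
    show "x = 0" if x: "x \<in> W \<inter> wt (d - i)" "(e ^^ n) ((c ^^ n) x) = 0" for x
    proof -
      have "(c ^^ n) x = 0" using funpow_e_injective[of "(c ^^ n) x" i n] c[OF x(1)] x(2) n by auto
      then show ?thesis using O.funpow_e_injective[of x i n] x(1) n by (simp add: O_wt)
    qed
  qed (use c e in auto)
  then show ?thesis using c unfolding n_def by blast
qed

lemma f_invariant':
  assumes "subspace W" "\<And>w. w \<in> W \<Longrightarrow> k w \<in> W" "\<And>w. w \<in> W \<Longrightarrow> e w \<in> W" "\<And>w. w \<in> W \<Longrightarrow> c w \<in> W"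
    and "w \<in> W"
  shows "f w \<in> W"
proof (rule f_invariant[OF assms(1-3)])
  show "\<exists>x \<in> W \<inter> wt i. (e ^^ nat (d - 2 * i)) x = y"
    if "2 * i \<le> d" "y \<in> W \<inter> wt (d - i)" for i y
    using raising_onto[OF assms(1,3,4) that] .
qed (use assms(5) in simp_all)

lemma swapped: "double_sl2_action scale q d k' k c g Basis e f"
  by (rule double_sl2_action.intro[OF opposite finite_dimensional_vector_space_axioms
      double_sl2_action_axioms.intro[OF sl2_action_axioms]])

end

section \<open>Uniqueness and Serre relations of lowering operators\<close>

text \<open>
  An irreducible module of the Borel subalgebra, with both Serre relations; now \<open>e\<close> and \<open>c\<close> play symmetric roles.
\<close>

locale borel_operators = borel_triple scale q d k k' Basis e c
  for scale :: "'f::field \<Rightarrow> 'v::ab_group_add \<Rightarrow> 'v" and q d k k' Basis e c +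
  assumes serre': "\<And>v. c (c (c (e v))) - scale (qint q 3) (c (c (e (c v))))
        + scale (qint q 3) (c (e (c (c v)))) - e (c (c (c v))) = 0"
begin

lemma swapped: "borel_operators scale q d k' k Basis c e"
proof -
  interpret D: weight_operator scale q d k' k by (rule dual)
  have "borel_triple_axioms scale q d k' c e"
  proof (rule borel_triple_axioms.intro)
    show "0 \<le> d" by (rule d_nonneg)
    show "endo c" "endo e" by (rule endo_c, rule endo_e)
    show "D.wt 0 \<noteq> {0}" "D.wt d \<noteq> {0}" using wt_bottom wt_top by (simp_all add: dual_wt)
    show "k' (c v) = scale (q powi 2) (c (k' v))" "k' (e v) = scale (q powi -2) (e (k' v))" for v
      using k'_ec[of v] by (simp_all only: powi_double)
    show "c (c (c (e v))) - scale (qint q 3) (c (c (e (c v)))) + scale (qint q 3) (c (e (c (c v))))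
        - e (c (c (c v))) = 0" for v
      by (rule serre')
    show "W = {0} \<or> W = UNIV"
      if W: "subspace W" "\<And>w. w \<in> W \<Longrightarrow> k' w \<in> W" "\<And>w. w \<in> W \<Longrightarrow> c w \<in> W" "\<And>w. w \<in> W \<Longrightarrow> e w \<in> W" for W
    proof (rule irreducible[OF W(1)])
      show "k w \<in> W" if "w \<in> W" for w using D.invariant_k'[OF W(1,2) that] .
    qed (fact W(3,4))+
  qed
  moreover have "borel_operators_axioms scale q c e"
    by (rule borel_operators_axioms.intro) (rule serre)
  ultimately show ?thesis
    using dual finite_dimensional_vector_space_axioms
    by (simp only: borel_operators_def borel_triple_def)
qed

text \<open>
  The relations to be satisfied by $\varepsilon_0 e_0^-$, except for the Serre relations. In the swapped
  instance of the locale they are those for $\varepsilon_1 e_1^-$.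
\<close>

definition lowering :: "('v \<Rightarrow> 'v) \<Rightarrow> bool" where
  "lowering f \<longleftrightarrow> endo f \<and> (\<forall>v. k (f v) = scale (q powi -2) (f (k v))) \<and>
    (\<forall>v. e (f v) - f (e v) = scale (inverse (q - inverse q)) (k v - k' v)) \<and>
    (\<forall>v. c (f v) = f (c v))"

lemma bottom_vector: obtains v where "v \<in> wt 0" "v \<noteq> 0"
  using wt_bottom subspace_0[OF subspace_wt] by blast

lemma lowering_unique:
  assumes "lowering f" "lowering g" shows "f = g"
proof
  fix v
  note f = assms(1)[unfolded lowering_def] and g = assms(2)[unfolded lowering_def]
  let ?D = "\<lambda>v. f v - g v"
  have D: "endo ?D" using f g by (simp add: endo_iff algebra_simps)
  have k: "k (?D v) = scale (q powi -2) (?D (k v))" for v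
    using f g by (simp add: simps scale_right_diff_distrib)
  obtain v0 where v0: "v0 \<in> wt 0" "v0 \<noteq> 0" by (rule bottom_vector)
  have "?D v = 0"
  proof (rule commuting_operator_zero[OF D _ _ k _ v0(2)])
    show "?D v0 = 0" using raising_wt[OF D, of "-1" v0 0] k v0(1) wt_outside[of "-1"] by simp
    show "?D (e v) = e (?D v)" for v
    proof -
      have "e (f v) - f (e v) = e (g v) - g (e v)" using f g by simp
      then show ?thesis by (simp add: simps algebra_simps)
    qed
  qed (use f g q_nonzero in \<open>simp_all add: simps\<close>)
  then show "f v = g v" by simp
qed

text \<open>
  The Serre expression has weight $-4$. It commutes with \<open>e\<close> and \<open>c\<close> by the three-term identity
  \<open>h_three_term\<close>, so it vanishes.
\<close>

lemma lowering_serre: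
  assumes f: "lowering f" and g: "borel_operators.lowering scale q k' k c e g"
  shows "f (f (f (g v))) - scale (qint q 3) (f (f (g (f v))))
        + scale (qint q 3) (f (g (f (f v)))) - g (f (f (f v))) = 0"
proof -
  interpret S: borel_operators scale q d k' k Basis c e by (rule swapped)
  have f: "endo f" "\<And>v. k (f v) = scale (q powi -2) (f (k v))"
    "\<And>v. e (f v) - f (e v) = scale (inverse (q - inverse q)) (k v - k' v)" "\<And>v. c (f v) = f (c v)"
    using f by (simp_all add: lowering_def)
  have g: "endo g" "\<And>v. k' (g v) = scale (q powi -2) (g (k' v))"
    "\<And>v. c (g v) - g (c v) = scale (inverse (q - inverse q)) (k' v - k v)" "\<And>v. e (g v) = g (e v)"
    using g by (simp_all add: S.lowering_def)
  have kf: "k (f v) = scale (inverse qq) (f (k v))" for v using f(2)[of v] by (simp only: powi_double)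
  have kg: "k (g v) = scale qq (g (k v))" for v
    using S.k'_commute[of g "inverse qq" v] g(1,2) qq_nonzero by (simp only: powi_double) simp
  have f_wt: "f v \<in> wt (i - 1)" if "v \<in> wt i" for v i
    using raising_wt[OF f(1), of "-1"] f(2) that by simp
  have g_wt: "g v \<in> wt (i + 1)" if "v \<in> wt i" for v i
  proof -
    have "k (g v) = scale (q powi (2 * 1)) (g (k v))" for v
      unfolding mult_1_right powi_double by (rule kg)
    then show ?thesis by (rule raising_wt[OF g(1) _ that])
  qed
  have ef: "e (f v) = f (e v) + scale (h i) v" if "v \<in> wt i" for v i
    using f(3)[of v] k_minus_k'_wt[OF that] by (simp add: algebra_simps)
  have cg: "c (g v) = g (c v) - scale (h i) v" if "v \<in> wt i" for v i
    using g(3)[of v] k_minus_k'_wt[OF that] by (simp add: algebra_simps scale_right_diff_distrib)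
  define s where "s v = f (f (f (g v))) - scale (qint q 3) (f (f (g (f v))))
        + scale (qint q 3) (f (g (f (f v)))) - g (f (f (f v)))" for v
  note fg_simps = endo_simps[OF f(1)] endo_simps[OF g(1)] simps
  have s: "endo s" by (simp add: s_def endo_iff fg_simps scale_right_distrib algebra_simps)
  have es: "e (s v) = s (e v)" for v
  proof -
    have "(\<lambda>v. e (s v)) = (\<lambda>v. s (e v))"
    proof (rule wt_induct)
      fix i v assume v: "v \<in> wt i"
      note w = f_wt[OF v] g_wt[OF v]
      have h1: "h (1 + i) = qint q 3 * h i - h i - h (i - 1)"
        using h_next[of i] by (simp add: add.commute)
      have h2: "h (i - 2) = qint q 3 * h (i - 1) - h (i - 1) - h i"
        using h_three_term[of "i - 1"] by (simp add: algebra_simps)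
      have "g (f v) \<in> wt i" "f (g v) \<in> wt i"
        using g_wt[OF w(1)] f_wt[OF w(2)] by simp_all
      note w = w this
      have "f (g (f v)) \<in> wt (i - 1)" "f (f (g v)) \<in> wt (i - 1)" "f (f v) \<in> wt (i - 2)"
        using f_wt[OF w(3)] f_wt[OF w(4)] f_wt[OF w(1)] by simp_all
      note w = w this
      have "g (f (f v)) \<in> wt (i - 1)" using g_wt[OF w(7)] by simp
      note w = w this
      show "e (s v) = s (e v)"
        unfolding s_def
        by (simp add: fg_simps g(4) ef[OF v] ef[OF w(1)] ef[OF w(2)] ef[OF w(3)] ef[OF w(4)] ef[OF w(5)]
            ef[OF w(6)] ef[OF w(7)] ef[OF w(8)] add.commute[of i 1] h1 h2 scale_right_distrib scale_left_distrib
            scale_left_diff_distrib scale_right_diff_distrib algebra_simps)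
    qed (use s endo_e in \<open>simp_all add: endo_iff\<close>)
    then show ?thesis by (rule fun_cong)
  qed
  have cs: "c (s v) = s (c v)" for v
  proof -
    have "(\<lambda>v. c (s v)) = (\<lambda>v. s (c v))"
    proof (rule wt_induct)
      fix i v assume v: "v \<in> wt i"
      have h1: "h i = qint q 3 * h (i - 1) - h (i - 1) - h (i - 2)"
        using h_next[of "i - 1"] by simp
      have h2: "h (i - 3) = qint q 3 * h (i - 2) - h (i - 2) - h (i - 1)"
        using h_three_term[of "i - 2"] by (simp add: algebra_simps)
      have w: "f v \<in> wt (i - 1)" "f (f v) \<in> wt (i - 2)" "f (f (f v)) \<in> wt (i - 3)"
        using f_wt[OF v] f_wt[OF f_wt[OF v]] f_wt[OF f_wt[OF f_wt[OF v]]] by simp_all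
      show "c (s v) = s (c v)"
        unfolding s_def
        by (simp add: fg_simps f(4) cg[OF v] cg[OF w(1)] cg[OF w(2)] cg[OF w(3)] h1 h2 scale_right_distrib
            scale_left_distrib scale_left_diff_distrib scale_right_diff_distrib algebra_simps)
    qed (use s endo_c in \<open>simp_all add: endo_iff\<close>)
    then show ?thesis by (rule fun_cong)
  qed
  have ks: "k (s v) = scale (inverse qq * inverse qq) (s (k v))" for v
    using qq_nonzero
    by (simp add: s_def fg_simps kf kg qq_cancel scale_right_distrib scale_right_diff_distrib algebra_simps)
  obtain v0 where v0: "v0 \<in> wt 0" "v0 \<noteq> 0" by (rule bottom_vector)
  have "s v = 0"
  proof (rule commuting_operator_zero[OF s es[symmetric] cs[symmetric] ks _ v0(2)])
    have "inverse qq * inverse qq = q powi (2 * (- 2))"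
      using q_nonzero by (simp add: powi_double(2)[symmetric] flip: power_int_add)
    then have "s v0 \<in> wt (0 + - 2)" using raising_wt[OF s _ v0(1), of "- 2"] ks by simp
    then show "s v0 = 0" using wt_outside[of "- 2"] by simp
  qed (use qq_nonzero in simp)
  then show ?thesis by (simp add: s_def)
qed

lemma lowering_exists: "\<exists>f. lowering f"
proof (rule lowering_operator_exists)
  fix f
  assume "endo f" "\<And>v. k (f v) = scale (q powi -2) (f (k v))"
    "\<And>v. e (f v) - f (e v) = scale (inverse (q - inverse q)) (k v - k' v)"
    "\<And>v. c (f v) = f (c v)"
  then have "lowering f" by (simp add: lowering_def)
  then show ?thesis by blast
qed

end

section \<open>Evaluation of the free algebra\<close>

context linear_space
begin

text \<open>
  The operator by which a word, and then an element of the free algebra, acts if each generator \<open>g\<close> acts as \<open>op g\<close>.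
\<close>

primrec word_eval :: "('g \<Rightarrow> 'b \<Rightarrow> 'b) \<Rightarrow> 'g list \<Rightarrow> 'b \<Rightarrow> 'b" where
  "word_eval op [] v = v"
| "word_eval op (g # gs) v = op g (word_eval op gs v)"

fun monoid_eval :: "('g \<Rightarrow> 'b \<Rightarrow> 'b) \<Rightarrow> 'g free_monoid \<Rightarrow> 'b \<Rightarrow> 'b" where
  "monoid_eval op (Word gs) = word_eval op gs"

definition fa_eval :: "('g \<Rightarrow> 'b \<Rightarrow> 'b) \<Rightarrow> ('g, 'a) free_algebra \<Rightarrow> 'b \<Rightarrow> 'b" where
  "fa_eval op x v = (\<Sum>w\<in>Poly_Mapping.keys x. scale (Poly_Mapping.lookup x w) (monoid_eval op w v))"

lemma fa_eval_superset:
  assumes "finite A" "Poly_Mapping.keys x \<subseteq> A"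
  shows "fa_eval op x v = (\<Sum>w\<in>A. scale (Poly_Mapping.lookup x w) (monoid_eval op w v))"
  unfolding fa_eval_def by (rule sum.mono_neutral_left[OF assms]) (auto simp: in_keys_iff)

lemma fa_eval_add: "fa_eval op (x + y) v = fa_eval op x v + fa_eval op y v"
proof -
  let ?A = "Poly_Mapping.keys x \<union> Poly_Mapping.keys y"
  have "fa_eval op z v = (\<Sum>w\<in>?A. scale (Poly_Mapping.lookup z w) (monoid_eval op w v))"
    if "z \<in> {x, y, x + y}" for z
    using that Poly_Mapping.keys_add[of x y] by (intro fa_eval_superset) auto
  then show ?thesis by (simp add: lookup_add scale_left_distrib sum.distrib)
qed

lemma fa_eval_zero: "fa_eval op 0 v = 0"
  by (simp add: fa_eval_def)

lemma fa_eval_uminus: "fa_eval op (- x) v = - fa_eval op x v"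
  using fa_eval_add[of op x "- x" v] by (simp add: fa_eval_zero eq_neg_iff_add_eq_0 add.commute)

lemma fa_eval_diff: "fa_eval op (x - y) v = fa_eval op x v - fa_eval op y v"
  using fa_eval_add[of op x "- y" v] by (simp add: fa_eval_uminus)

lemma fa_eval_single: "fa_eval op (Poly_Mapping.single w c) v = scale c (monoid_eval op w v)"
  by (cases "c = 0") (simp_all add: fa_eval_def)

lemma fa_eval_gen: "fa_eval op (fa_gen g) v = op g v"
  by (simp add: fa_gen_def fa_eval_single)

lemma fa_eval_const: "fa_eval op (fa_const c) v = scale c v"
  by (simp add: fa_const_def fa_eval_single zero_free_monoid_def)

lemma fa_eval_one: "fa_eval op 1 v = v"
  using fa_eval_const[of op 1 v] by (simp add: fa_const_def)

end

lemma free_algebra_induct [case_names single add]: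
  fixes x :: "('g, 'f::field) free_algebra"
  assumes single: "\<And>w c. P (Poly_Mapping.single w c)" and add: "\<And>x y. P x \<Longrightarrow> P y \<Longrightarrow> P (x + y)"
  shows "P x"
proof -
  have "P (\<Sum>w\<in>A. Poly_Mapping.single w (Poly_Mapping.lookup x w))" if "finite A" for A
    using that
  proof (induction A rule: finite_induct)
    case empty
    then show ?case using single[of undefined 0] by simp
  qed (simp add: single add)
  moreover have "(\<Sum>w\<in>Poly_Mapping.keys x. Poly_Mapping.single w (Poly_Mapping.lookup x w)) = x"
    by (rule poly_mapping_eqI) (auto simp: lookup_sum lookup_single when_def in_keys_iff)
  ultimately show ?thesis using finite_keys[of x] by metis
qed

lemma free_algebra_gen_induct [case_names const gen add mult]:
  fixes x :: "('g, 'f::field) free_algebra"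
  assumes const: "\<And>a. P (fa_const a)" and gen: "\<And>g. P (fa_gen g)"
    and add: "\<And>x y. P x \<Longrightarrow> P y \<Longrightarrow> P (x + y)" and mult: "\<And>x y. P x \<Longrightarrow> P y \<Longrightarrow> P (x * y)"
  shows "P x"
proof (induction x rule: free_algebra_induct)
  case (single w a)
  have "P (Poly_Mapping.single (Word gs) 1)" for gs
  proof (induction gs)
    case Nil
    show ?case using const[of 1] by (simp add: fa_const_def flip: zero_free_monoid_def)
  next
    case (Cons g gs)
    have "fa_gen g * Poly_Mapping.single (Word gs) 1 = Poly_Mapping.single (Word (g # gs)) (1 :: 'f)"
      by (simp add: fa_gen_def mult_single)
    then show ?case using mult[OF gen Cons] by metis
  qed
  moreover have "fa_const a * Poly_Mapping.single w 1 = Poly_Mapping.single w a"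
    by (simp add: fa_const_def mult_single)
  ultimately show ?case using mult[OF const] by (metis free_monoid.exhaust)
qed (rule add)

context linear_space
begin

context
  fixes op :: "'g \<Rightarrow> 'b \<Rightarrow> 'b"
  assumes endo_op: "\<And>g. endo (op g)"
begin

lemma endo_monoid_eval: "endo (monoid_eval op w)"
proof (cases w)
  case (Word gs)
  have "endo (word_eval op gs)"
    by (induction gs) (use endo_op in \<open>simp_all add: endo_iff\<close>)
  then show ?thesis using Word by simp
qed

lemma endo_fa_eval: "endo (fa_eval op x)"
  using endo_monoid_eval
  by (simp add: endo_iff fa_eval_def scale_right_distrib sum.distrib scale_sum_right mult.commute)

lemma monoid_eval_add: "monoid_eval op (w + u) v = monoid_eval op w (monoid_eval op u v)"
proof (cases w; cases u)
  fix gs hs assume "w = Word gs" "u = Word hs"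
  moreover have "word_eval op (gs @ hs) v = word_eval op gs (word_eval op hs v)"
    by (induction gs) simp_all
  ultimately show ?thesis by simp
qed

lemma fa_eval_mult: "fa_eval op (x * y) v = fa_eval op x (fa_eval op y v)"
proof (induction x rule: free_algebra_induct)
  case (single w c)
  show ?case
  proof (induction y rule: free_algebra_induct)
    case (single u b)
    show ?case
      by (simp add: mult_single fa_eval_single monoid_eval_add endo_scale[OF endo_monoid_eval])
  qed (simp add: distrib_left fa_eval_add endo_add[OF endo_fa_eval])
qed (simp add: distrib_right fa_eval_add)

end

end

section \<open>Operator form of modules\<close>

lemma uq_class_hom: "ring_hom_ring ring_of_type_algebra (uq q) (uq_class q)"
  unfolding uq_def uq_class_def using ideal.rcos_ring_hom_ring[OF ideal_uq_ideal] .

lemma uq_class_add: "uq_class q (x + y) = uq_class q x \<oplus>\<^bsub>uq q\<^esub> uq_class q y"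
  and uq_class_mult: "uq_class q (x * y) = uq_class q x \<otimes>\<^bsub>uq q\<^esub> uq_class q y"
  and uq_class_one: "uq_class q 1 = \<one>\<^bsub>uq q\<^esub>"
  and uq_class_zero: "uq_class q 0 = \<zero>\<^bsub>uq q\<^esub>"
proof -
  interpret ring_hom_ring "ring_of_type_algebra" "uq q" "uq_class q" by (rule uq_class_hom)
  show "uq_class q (x + y) = uq_class q x \<oplus>\<^bsub>uq q\<^esub> uq_class q y"
    "uq_class q (x * y) = uq_class q x \<otimes>\<^bsub>uq q\<^esub> uq_class q y" "uq_class q 1 = \<one>\<^bsub>uq q\<^esub>"
    "uq_class q 0 = \<zero>\<^bsub>uq q\<^esub>"
    using hom_add[of x y] hom_mult[of x y] hom_one hom_zero by (simp_all add: ring_of_type_algebra_def)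
qed

lemma uq_class_uminus: "uq_class q (- x) = \<ominus>\<^bsub>uq q\<^esub> uq_class q x"
proof -
  interpret ring "uq q" by (rule ring_uq)
  show ?thesis
    by (rule minus_equality[symmetric])
      (simp_all add: uq_class_closed uq_class_zero flip: uq_class_add)
qed

lemma uq_class_surj: assumes "x \<in> carrier (uq q)" obtains y where "x = uq_class q y"
  using assms
  by (auto simp: uq_class_def uq_def FactRing_def A_RCOSETS_def' a_r_coset_def' ring_of_type_algebra_def)

lemma uq_class_relation:
  assumes "x \<in> uq_relations q" shows "uq_class q x = \<zero>\<^bsub>uq q\<^esub>"
proof -
  have "x \<in> uq_ideal q"
    unfolding uq_ideal_def using ring.genideal_self[OF ring_free_algebra] assms
    by (fastforce simp: ring_of_type_algebra_def)
  interpret I: ideal "uq_ideal q" ring_of_type_algebra by (rule ideal_uq_ideal)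
  show ?thesis
    using I.a_rcos_const[OF \<open>x \<in> uq_ideal q\<close>] by (simp add: uq_class_def uq_def FactRing_def)
qed

lemma uq_class_eq_imp_diff:
  assumes "uq_class q x = uq_class q y" shows "x - y \<in> uq_ideal q"
proof -
  interpret I: ideal "uq_ideal q" ring_of_type_algebra by (rule ideal_uq_ideal)
  have "x \<in> uq_class q x"
    unfolding uq_class_def by (rule I.a_rcos_self) (simp add: ring_of_type_algebra_def)
  then have "x \<in> uq_class q y" using assms by simp
  then obtain z where "z \<in> uq_ideal q" "x = z + y"
    by (auto simp: uq_class_def a_r_coset_def' ring_of_type_algebra_def)
  then show ?thesis by simp
qed

text \<open>Elements of the Borel subalgebra are represented by elements of the free algebra.\<close>

lemma borel_carrier_induct [consumes 1, case_names const E K uminus add mult]: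
  assumes "x \<in> borel_carrier q"
    and "\<And>a. P (fa_const a)" "\<And>i. P (fa_gen (E Pos i))" "\<And>s i. P (fa_gen (K s i))"
    and "\<And>y. P y \<Longrightarrow> P (- y)" "\<And>y z. P y \<Longrightarrow> P z \<Longrightarrow> P (y + z)" "\<And>y z. P y \<Longrightarrow> P z \<Longrightarrow> P (y * z)"
  shows "\<exists>y. x = uq_class q y \<and> P y"
  using assms(1) unfolding borel_carrier_def
proof (induction rule: generate_ring.induct)
  case one
  have "fa_const 1 = (1 :: (uq_gen, 'a) free_algebra)" by (simp add: fa_const_def)
  then show ?case using assms(2)[of 1] uq_class_one[of q] by metis
next
  case (incl h)
  then show ?case using assms(2-4) by (auto simp: uq_const_def uq_E_def uq_K_def)
next
  case (a_inv h)
  then show ?case using assms(5) uq_class_uminus by metis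
next
  case (eng_add h1 h2)
  then show ?case using assms(6) uq_class_add by metis
next
  case (eng_mult h1 h2)
  then show ?case using assms(7) uq_class_mult by metis
qed

lemma generators_mem_borel: "uq_K q s i \<in> borel_carrier q" "uq_E q Pos i \<in> borel_carrier q"
  unfolding borel_carrier_def by (blast intro: generate_ring.incl)+

text \<open>
  A module over a subring \<open>C\<close> that contains the Borel subalgebra. The cases of interest are the Borel subalgebra
  itself and the whole algebra. Elements of \<open>C\<close> are represented by elements of the free algebra: \<open>acting\<close>
  consists of all representatives, and \<open>act x\<close> is the action of the class of \<open>x\<close>.
\<close>

locale uq_partial_action = linear_space scale
  for scale :: "'f::field \<Rightarrow> 'v::ab_group_add \<Rightarrow> 'v" +
  fixes q :: 'f and C :: "(uq_gen, 'f) free_algebra set set"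
    and \<rho> :: "(uq_gen, 'f) free_algebra set \<Rightarrow> 'v \<Rightarrow> 'v"
  assumes subring_C: "subring C (uq q)" and borel_subset: "borel_carrier q \<subseteq> C"
    and action: "is_module_action ((uq q)\<lparr>carrier := C\<rparr>) (uq_const q) scale \<rho>"
begin

definition act :: "(uq_gen, 'f) free_algebra \<Rightarrow> 'v \<Rightarrow> 'v" where
  "act x = \<rho> (uq_class q x)"

definition acting :: "(uq_gen, 'f) free_algebra set" where
  "acting = {x. uq_class q x \<in> C}"

lemma acting_closed:
  "x \<in> acting \<Longrightarrow> y \<in> acting \<Longrightarrow> x + y \<in> acting" "x \<in> acting \<Longrightarrow> y \<in> acting \<Longrightarrow> x * y \<in> acting"
  "x \<in> acting \<Longrightarrow> - x \<in> acting" "fa_const a \<in> acting" "1 \<in> acting"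
  using subringE(3,5-7)[OF subring_C] borel_subset
  by (auto simp: acting_def uq_class_add uq_class_mult uq_class_uminus uq_class_one borel_carrier_def
      uq_const_def intro!: generate_ring.incl)

lemma acting_diff: "x \<in> acting \<Longrightarrow> y \<in> acting \<Longrightarrow> x - y \<in> acting"
  using acting_closed(1)[of x "- y"] acting_closed(3)[of y] by simp

lemma acting_gens: "fa_gen (E Pos i) \<in> acting" "fa_gen (K s i) \<in> acting"
  using borel_subset generators_mem_borel(1)[of q s i] generators_mem_borel(2)[of q i] by (auto simp: acting_def uq_E_def uq_K_def)

lemma endo_act: "x \<in> acting \<Longrightarrow> endo (act x)"
  and act_add: "x \<in> acting \<Longrightarrow> y \<in> acting \<Longrightarrow> act (x + y) v = act x v + act y v"
  and act_mult: "x \<in> acting \<Longrightarrow> y \<in> acting \<Longrightarrow> act (x * y) v = act x (act y v)"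
  and act_one: "act 1 v = v"
  and act_const: "act (fa_const a) v = scale a v"
  using action unfolding is_module_action_def act_def acting_def uq_const_def
  by (simp_all add: uq_class_add uq_class_mult uq_class_one)

lemma act_uminus: assumes "x \<in> acting" shows "act (- x) v = - act x v"
proof -
  have "act (0 + 0) v = act 0 v + act 0 v"
    using acting_diff[OF assms assms] by (intro act_add) simp_all
  then have "act 0 v = 0" by simp
  then have "act x v + act (- x) v = 0"
    using act_add[OF assms acting_closed(3)[OF assms], of v] by simp
  then show ?thesis by (simp add: eq_neg_iff_add_eq_0 add.commute)
qed

lemma act_diff: "x \<in> acting \<Longrightarrow> y \<in> acting \<Longrightarrow> act (x - y) v = act x v - act y v"
  using act_add[of x "- y" v] acting_closed(3)[of y] by (simp add: act_uminus)

lemma act_relation: assumes "x \<in> uq_relations q" shows "act x v = 0"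
proof -
  have "uq_class q x = uq_class q (1 - 1)"
    by (simp add: uq_class_relation[OF assms] uq_class_zero)
  then show ?thesis
    using act_diff[of 1 1 v] acting_closed(5) by (simp add: act_def)
qed

lemmas act_simps = act_add act_mult act_one act_const act_diff acting_closed acting_diff acting_gens

abbreviation opK :: "sign \<Rightarrow> node \<Rightarrow> 'v \<Rightarrow> 'v" where "opK s i \<equiv> \<rho> (uq_K q s i)"
abbreviation opE :: "sign \<Rightarrow> node \<Rightarrow> 'v \<Rightarrow> 'v" where "opE s i \<equiv> \<rho> (uq_E q s i)"

lemma act_gens: "act (fa_gen (E s i)) = opE s i" "act (fa_gen (K s i)) = opK s i"
  by (simp_all add: act_def uq_E_def uq_K_def)

lemma endo_opK: "endo (opK s i)"
  using endo_act[OF acting_gens(2), of s i] by (simp add: act_gens)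

lemma endo_opE: "fa_gen (E s i) \<in> acting \<Longrightarrow> endo (opE s i)"
  using endo_act[of "fa_gen (E s i)"] by (simp add: act_gens)

lemma opK_inverse: "opK s i (opK (opp s) i v) = v"
proof -
  have "act (fa_gen (K s i) * fa_gen (K (opp s) i) - 1) v = 0"
    by (rule act_relation) (auto simp: uq_relations_def Let_def)
  then show ?thesis by (simp add: act_simps act_gens)
qed

lemma opK_opE:
  assumes "fa_gen (E s j) \<in> acting"
  shows "opK Pos i (opE s j (opK Neg i v))
    = scale (q powi ((if i = j then 2 else - 2) * sgn_int s)) (opE s j v)"
proof -
  have "act (fa_gen (K Pos i) * fa_gen (E s j) * fa_gen (K Neg i)
      - fa_const (q powi ((if i = j then 2 else - 2) * sgn_int s)) * fa_gen (E s j)) v = 0"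
    by (rule act_relation) (auto simp: uq_relations_def Let_def)
  then show ?thesis using assms by (simp add: act_simps act_gens)
qed

lemma opE_same:
  assumes "fa_gen (E Neg i) \<in> acting"
  shows "opE Pos i (opE Neg i v) - opE Neg i (opE Pos i v)
    = scale (inverse (q - inverse q)) (opK Pos i v - opK Neg i v)"
proof -
  have "act (fa_gen (E Pos i) * fa_gen (E Neg i) - fa_gen (E Neg i) * fa_gen (E Pos i)
      - fa_const (inverse (q - inverse q)) * (fa_gen (K Pos i) - fa_gen (K Neg i))) v = 0"
    by (rule act_relation) (auto simp: uq_relations_def Let_def)
  then show ?thesis using assms by (simp add: act_simps act_gens)
qed

lemma opE_mixed:
  assumes "fa_gen (E s N0) \<in> acting" "fa_gen (E (opp s) N1) \<in> acting"
  shows "opE s N0 (opE (opp s) N1 v) = opE (opp s) N1 (opE s N0 v)"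
proof -
  have "act (fa_gen (E s N0) * fa_gen (E (opp s) N1) - fa_gen (E (opp s) N1) * fa_gen (E s N0)) v = 0"
    by (rule act_relation) (auto simp: uq_relations_def Let_def)
  then show ?thesis using assms by (simp add: act_simps act_gens)
qed

lemma opE_serre:
  assumes "fa_gen (E s i) \<in> acting" "fa_gen (E s j) \<in> acting" "i \<noteq> j"
  shows "opE s i (opE s i (opE s i (opE s j v))) - scale (qint q 3) (opE s i (opE s i (opE s j (opE s i v))))
    + scale (qint q 3) (opE s i (opE s j (opE s i (opE s i v))))
    - opE s j (opE s i (opE s i (opE s i v))) = 0"
proof -
  let ?e = "\<lambda>i. fa_gen (E s i) :: (uq_gen, 'f) free_algebra"
  have "act (?e i ^ 3 * ?e j - fa_const (qint q 3) * ?e i ^ 2 * ?e j * ?e i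
      + fa_const (qint q 3) * ?e i * ?e j * ?e i ^ 2 - ?e j * ?e i ^ 3) v = 0"
    by (rule act_relation) (use assms(3) in \<open>auto simp: uq_relations_def Let_def\<close>)
  then show ?thesis
    using assms by (simp add: act_simps act_gens power3_eq_cube power2_eq_square mult.assoc)
qed

end

text \<open>
  The defining relations as a condition on operators: \<open>\<kappa> s i\<close> and \<open>\<eta> s i\<close> are the actions of the generators \<open>K s i\<close>
  and \<open>E s i\<close>. The two relations between the $K_i$ and the $e_j^{\pm}$ are combined into one.
\<close>

definition (in linear_space) uq_operators ::
  "'a \<Rightarrow> (sign \<Rightarrow> node \<Rightarrow> 'b \<Rightarrow> 'b) \<Rightarrow> (sign \<Rightarrow> node \<Rightarrow> 'b \<Rightarrow> 'b) \<Rightarrow> bool" where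
  "uq_operators q \<kappa> \<eta> \<longleftrightarrow>
    (\<forall>s i. endo (\<kappa> s i) \<and> endo (\<eta> s i)) \<and>
    (\<forall>s i v. \<kappa> s i (\<kappa> (opp s) i v) = v) \<and>
    (\<forall>v. \<kappa> Pos N0 (\<kappa> Pos N1 v) = \<kappa> Pos N1 (\<kappa> Pos N0 v)) \<and>
    (\<forall>s i j v. \<kappa> Pos i (\<eta> s j (\<kappa> Neg i v))
       = scale (q powi ((if i = j then 2 else - 2) * sgn_int s)) (\<eta> s j v)) \<and>
    (\<forall>i v. \<eta> Pos i (\<eta> Neg i v) - \<eta> Neg i (\<eta> Pos i v)
       = scale (inverse (q - inverse q)) (\<kappa> Pos i v - \<kappa> Neg i v)) \<and>
    (\<forall>s v. \<eta> s N0 (\<eta> (opp s) N1 v) = \<eta> (opp s) N1 (\<eta> s N0 v)) \<and>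
    (\<forall>s i j v. i \<noteq> j \<longrightarrow> \<eta> s i (\<eta> s i (\<eta> s i (\<eta> s j v)))
       - scale (qint q 3) (\<eta> s i (\<eta> s i (\<eta> s j (\<eta> s i v))))
       + scale (qint q 3) (\<eta> s i (\<eta> s j (\<eta> s i (\<eta> s i v))))
       - \<eta> s j (\<eta> s i (\<eta> s i (\<eta> s i v))) = 0)"

text \<open>
  The elements of the free algebra that evaluate to zero form an ideal that contains the relations. So evaluation
  depends on the class only.
\<close>

lemma (in linear_space) module_of_operators:
  assumes ops: "uq_operators q \<kappa> \<eta>"
  obtains \<sigma> where "\<sigma> \<in> extensional (carrier (uq q))" "is_module_action (uq q) (uq_const q) scale \<sigma>"
    "\<And>s i. \<sigma> (uq_K q s i) = \<kappa> s i" "\<And>s i. \<sigma> (uq_E q s i) = \<eta> s i"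
proof -
  define op where "op g = (case g of E s i \<Rightarrow> \<eta> s i | K s i \<Rightarrow> \<kappa> s i)" for g
  have op: "op (E s i) = \<eta> s i" "op (K s i) = \<kappa> s i" for s i by (simp_all add: op_def)
  have endo_op: "endo (op g)" for g
    using ops by (cases g) (simp_all add: op uq_operators_def)
  note ev = fa_eval_mult[of op, OF endo_op] fa_eval_add fa_eval_diff fa_eval_const fa_eval_one fa_eval_gen
  define I :: "(uq_gen, 'a) free_algebra set" where "I = {x. \<forall>v. fa_eval op x v = 0}"
  have "ideal I ring_of_type_algebra"
  proof (rule idealI[OF ring_free_algebra])
    let ?R = "ring_of_type_algebra :: (uq_gen, 'a) free_algebra ring"
    interpret R: ring ?R by (rule ring_free_algebra)
    have minus: "\<ominus>\<^bsub>?R\<^esub> x = - x" for x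
      by (rule R.minus_equality) (simp_all add: ring_of_type_algebra_def)
    show "subgroup I (add_monoid ?R)"
      by (rule R.add.subgroupI)
        (use minus in \<open>auto simp: I_def ring_of_type_algebra_def fa_eval_add fa_eval_uminus a_inv_def
          intro: exI[of _ 0] fa_eval_zero\<close>)
    show "x \<otimes>\<^bsub>?R\<^esub> a \<in> I" "a \<otimes>\<^bsub>?R\<^esub> x \<in> I" if "a \<in> I" for a x
      using that endo_zero[OF endo_fa_eval[of op, OF endo_op]]
      by (simp_all add: I_def ring_of_type_algebra_def ev)
  qed
  moreover have "uq_relations q \<subseteq> I"
  proof -
    have rel: "\<kappa> s i (\<kappa> (opp s) i v) = v" "\<kappa> Pos N0 (\<kappa> Pos N1 v) = \<kappa> Pos N1 (\<kappa> Pos N0 v)"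
      "\<kappa> Pos i (\<eta> s i (\<kappa> Neg i v)) = scale (q powi (2 * sgn_int s)) (\<eta> s i v)"
      "i \<noteq> j \<Longrightarrow> \<kappa> Pos i (\<eta> s j (\<kappa> Neg i v)) = scale (q powi (- 2 * sgn_int s)) (\<eta> s j v)"
      "\<eta> Pos i (\<eta> Neg i v) - \<eta> Neg i (\<eta> Pos i v)
        = scale (inverse (q - inverse q)) (\<kappa> Pos i v - \<kappa> Neg i v)"
      "\<eta> s N0 (\<eta> (opp s) N1 v) = \<eta> (opp s) N1 (\<eta> s N0 v)"
      "i \<noteq> j \<Longrightarrow> \<eta> s i (\<eta> s i (\<eta> s i (\<eta> s j v)))
        - scale (qint q 3) (\<eta> s i (\<eta> s i (\<eta> s j (\<eta> s i v))))
        + scale (qint q 3) (\<eta> s i (\<eta> s j (\<eta> s i (\<eta> s i v))))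
        - \<eta> s j (\<eta> s i (\<eta> s i (\<eta> s i v))) = 0" for s i j v
      using ops by (simp_all add: uq_operators_def)
    show ?thesis
      unfolding uq_relations_def Let_def
      by (auto simp: I_def ev op rel power3_eq_cube power2_eq_square mult.assoc
          simp del: mult_minus_left)
  qed
  ultimately have "uq_ideal q \<subseteq> I"
    unfolding uq_ideal_def by (intro ring.genideal_minimal ring_free_algebra)
  then have wd: "fa_eval op x = fa_eval op y" if "uq_class q x = uq_class q y" for x y
  proof (intro ext)
    fix v
    have "fa_eval op (x - y) v = 0"
      using uq_class_eq_imp_diff[OF that] \<open>uq_ideal q \<subseteq> I\<close> by (auto simp: I_def)
    then show "fa_eval op x v = fa_eval op y v" by (simp add: fa_eval_diff)
  qed
  define \<sigma> where "\<sigma> = (\<lambda>c\<in>carrier (uq q). fa_eval op (SOME x. uq_class q x = c))"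
  have \<sigma>: "\<sigma> (uq_class q x) = fa_eval op x" for x
    using wd[OF someI[of "\<lambda>y. uq_class q y = uq_class q x" x]] by (simp add: \<sigma>_def uq_class_closed)
  show ?thesis
  proof
    show "\<sigma> \<in> extensional (carrier (uq q))" by (simp add: \<sigma>_def)
    show "\<sigma> (uq_K q s i) = \<kappa> s i" "\<sigma> (uq_E q s i) = \<eta> s i" for s i
      by (auto simp: uq_K_def uq_E_def \<sigma> fa_eval_gen op)
    have one: "\<sigma> \<one>\<^bsub>uq q\<^esub> v = v" for v
      by (simp add: \<sigma> fa_eval_one flip: uq_class_one)
    show "is_module_action (uq q) (uq_const q) scale \<sigma>"
      unfolding is_module_action_def
    proof (intro conjI ballI allI)
      fix x y v assume "x \<in> carrier (uq q)" "y \<in> carrier (uq q)"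
      then obtain a b where "x = uq_class q a" "y = uq_class q b" by (metis uq_class_surj)
      then show "\<sigma> (x \<oplus>\<^bsub>uq q\<^esub> y) v = \<sigma> x v + \<sigma> y v" "\<sigma> (x \<otimes>\<^bsub>uq q\<^esub> y) v = \<sigma> x (\<sigma> y v)"
        by (simp_all add: \<sigma> ev flip: uq_class_add uq_class_mult)
    next
      fix x assume "x \<in> carrier (uq q)"
      then obtain a where "x = uq_class q a" by (metis uq_class_surj)
      then show "endo (\<sigma> x)" using endo_fa_eval[of op, OF endo_op] by (simp add: \<sigma>)
    qed (simp_all add: one uq_const_def \<sigma> fa_eval_const)
  qed
qed

lemma (in linear_space) full_action:
  assumes "is_module_action (uq q) (uq_const q) scale \<sigma>"
  shows "uq_partial_action scale q (carrier (uq q)) \<sigma>"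
proof (intro uq_partial_action.intro linear_space_axioms uq_partial_action_axioms.intro)
  show "subring (carrier (uq q)) (uq q)" by (rule ring.carrier_is_subring[OF ring_uq])
  show "borel_carrier q \<subseteq> carrier (uq q)" by (rule subringE(1)[OF subring_borel_carrier])
  show "is_module_action ((uq q)\<lparr>carrier := carrier (uq q)\<rparr>) (uq_const q) scale \<sigma>"
    using assms by simp
qed

lemma (in linear_space) module_determined_by_operators:
  assumes \<sigma>: "is_module_action (uq q) (uq_const q) scale \<sigma>"
    and \<tau>: "is_module_action (uq q) (uq_const q) scale \<tau>"
    and eq: "\<And>s i. \<sigma> (uq_K q s i) = \<tau> (uq_K q s i)" "\<And>s i. \<sigma> (uq_E q s i) = \<tau> (uq_E q s i)"
    and x: "x \<in> carrier (uq q)"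
  shows "\<sigma> x = \<tau> x"
proof -
  interpret S: uq_partial_action scale q "carrier (uq q)" \<sigma> by (rule full_action[OF \<sigma>])
  interpret T: uq_partial_action scale q "carrier (uq q)" \<tau> by (rule full_action[OF \<tau>])
  have acting: "y \<in> S.acting" "y \<in> T.acting" for y by (simp_all add: S.acting_def T.acting_def uq_class_closed)
  have act: "S.act y v = T.act y v" for y v
  proof (induction y arbitrary: v rule: free_algebra_gen_induct)
    case (gen g)
    then show ?case by (cases g) (simp_all add: S.act_gens T.act_gens eq)
  qed (simp_all add: S.act_const T.act_const S.act_add T.act_add S.act_mult T.act_mult acting)
  obtain y where "x = uq_class q y" using uq_class_surj[OF x] .
  then show ?thesis using act[of y] by (auto simp: S.act_def T.act_def)
qed

lemma (in uq_partial_action) borel_invariant: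
  assumes W: "subspace W" and K: "\<And>s i w. w \<in> W \<Longrightarrow> opK s i w \<in> W"
    and E: "\<And>i w. w \<in> W \<Longrightarrow> opE Pos i w \<in> W"
    and x: "x \<in> borel_carrier q" and w: "w \<in> W"
  shows "\<rho> x w \<in> W"
proof -
  from x have "\<exists>y. x = uq_class q y \<and> y \<in> acting \<and> (\<forall>w\<in>W. act y w \<in> W)"
    by (induction rule: borel_carrier_induct)
      (use K E in \<open>simp_all add: act_simps act_uminus act_gens subspace_scale[OF W]
        subspace_neg[OF W] subspace_add[OF W]\<close>)
  then show ?thesis using w by (auto simp: act_def)
qed

lemma (in linear_space) borel_action_determined:
  assumes R: "uq_partial_action scale q C \<rho>" and S: "uq_partial_action scale q D \<sigma>"
    and K: "\<And>s i. \<rho> (uq_K q s i) = \<sigma> (uq_K q s i)"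
    and E: "\<And>i. \<rho> (uq_E q Pos i) = \<sigma> (uq_E q Pos i)"
    and x: "x \<in> borel_carrier q"
  shows "\<rho> x = \<sigma> x"
proof -
  interpret R: uq_partial_action scale q C \<rho> by (rule R)
  interpret S: uq_partial_action scale q D \<sigma> by (rule S)
  from x have "\<exists>y. x = uq_class q y \<and> y \<in> R.acting \<and> y \<in> S.acting \<and> (\<forall>v. R.act y v = S.act y v)"
    by (induction rule: borel_carrier_induct)
      (simp_all add: R.act_simps S.act_simps R.act_uminus S.act_uminus R.act_gens S.act_gens K E)
  then show ?thesis by (auto simp: R.act_def S.act_def)
qed

lemma (in linear_space) uq_invariant:
  assumes \<sigma>: "is_module_action (uq q) (uq_const q) scale \<sigma>"
    and W: "subspace W" and K: "\<And>s i w. w \<in> W \<Longrightarrow> \<sigma> (uq_K q s i) w \<in> W"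
    and E: "\<And>s i w. w \<in> W \<Longrightarrow> \<sigma> (uq_E q s i) w \<in> W"
    and x: "x \<in> carrier (uq q)" and w: "w \<in> W"
  shows "\<sigma> x w \<in> W"
proof -
  interpret S: uq_partial_action scale q "carrier (uq q)" \<sigma> by (rule full_action[OF \<sigma>])
  have acting: "y \<in> S.acting" for y by (simp add: S.acting_def uq_class_closed)
  have "S.act y w \<in> W" if "w \<in> W" for y w
    using that
  proof (induction y arbitrary: w rule: free_algebra_gen_induct)
    case (gen g)
    then show ?case using K E by (cases g) (simp_all add: S.act_gens)
  qed (simp_all add: S.act_const S.act_add S.act_mult acting subspace_scale[OF W] subspace_add[OF W])
  moreover obtain y where "x = uq_class q y" using uq_class_surj[OF x] .
  ultimately show ?thesis using w by (simp add: S.act_def)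
qed

section \<open>Normalised operators of a module of type \<open>(\<epsilon>\<^sub>0, \<epsilon>\<^sub>1)\<close>\<close>

text \<open>
  A module on which $K_0 K_1$ acts as $\varepsilon_0 \varepsilon_1$, over a subring that contains the Borel
  subalgebra. The operators below absorb the signs. Those called \<open>f\<close> and \<open>g\<close> are meaningful only if \<open>C\<close> contains
  $e_0^-$ and $e_1^-$.
\<close>

locale typed_action = uq_partial_action scale q C \<rho> + finite_dimensional_vector_space scale Basis
  for scale :: "'f::field \<Rightarrow> 'v::ab_group_add \<Rightarrow> 'v" and q C \<rho> Basis +
  fixes \<epsilon>0 \<epsilon>1 :: 'f
  assumes q0: "q \<noteq> 0" and q1: "\<And>n::nat. n > 0 \<Longrightarrow> q ^ n \<noteq> 1"
    and sq0: "\<epsilon>0 * \<epsilon>0 = 1" and sq1: "\<epsilon>1 * \<epsilon>1 = 1"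
    and central: "\<And>v. opK Pos N0 (opK Pos N1 v) = scale (\<epsilon>0 * \<epsilon>1) v"
begin

definition k where "k v = scale \<epsilon>0 (opK Pos N0 v)"
definition k' where "k' v = scale \<epsilon>0 (opK Neg N0 v)"
definition e where "e = opE Pos N0"
definition c where "c = opE Pos N1"
definition f where "f v = scale \<epsilon>0 (opE Neg N0 v)"
definition g where "g v = scale \<epsilon>1 (opE Neg N1 v)"

lemma sign_cancel: "\<epsilon>0 * (\<epsilon>0 * a) = a" "\<epsilon>1 * (\<epsilon>1 * a) = a"
  using sq0 sq1 by (simp_all add: mult.assoc[symmetric])

lemma endo_k: "endo k" and endo_k': "endo k'" and endo_e: "endo e" and endo_c: "endo c"
  using endo_opK endo_opE acting_gens
  by (simp_all add: k_def[abs_def] k'_def[abs_def] e_def c_def endo_iff scale_right_distrib mult.commute)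

lemma k_k': "k (k' v) = v" and k'_k: "k' (k v) = v"
  using opK_inverse[of Pos N0 v] opK_inverse[of Neg N0 v] sq0
  by (simp_all add: k_def k'_def endo_scale[OF endo_opK])

lemma opK_N0: "opK Pos N0 v = scale \<epsilon>0 (k v)" "opK Neg N0 v = scale \<epsilon>0 (k' v)"
  using sq0 by (simp_all add: k_def k'_def)

lemma opK_N1: "opK Pos N1 v = scale \<epsilon>1 (k' v)" "opK Neg N1 v = scale \<epsilon>1 (k v)"
proof -
  show 1: "opK Pos N1 v = scale \<epsilon>1 (k' v)" for v
  proof -
    have "opK Pos N1 v = opK Neg N0 (scale (\<epsilon>0 * \<epsilon>1) v)"
      using opK_inverse[of Neg N0 "opK Pos N1 v"] central by simp
    then show ?thesis by (simp add: endo_scale[OF endo_opK] k'_def mult.commute)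
  qed
  have "opK Pos N1 (scale \<epsilon>1 (k v)) = v"
    using sq1 by (simp add: 1 endo_scale[OF endo_k'] k'_k)
  then show "opK Neg N1 v = scale \<epsilon>1 (k v)"
    using opK_inverse[of Neg N1 "scale \<epsilon>1 (k v)"] by simp
qed

lemma opK_opE': assumes "fa_gen (E s j) \<in> acting"
  shows "opK Pos i (opE s j v) = scale (q powi ((if i = j then 2 else - 2) * sgn_int s)) (opE s j (opK Pos i v))"
  using opK_opE[OF assms, of i "opK Pos i v"] opK_inverse[of Neg i v] by simp

lemma k_e: "k (e v) = scale (q powi 2) (e (k v))" and k_c: "k (c v) = scale (q powi -2) (c (k v))"
  using opK_opE'[OF acting_gens(1), of N0 N0 v] opK_opE'[OF acting_gens(1), of N0 N1 v]
  by (simp_all add: k_def e_def c_def endo_scale[OF endo_opE[OF acting_gens(1)]] mult.commute)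

lemma serre:
  "e (e (e (c v))) - scale (qint q 3) (e (e (c (e v)))) + scale (qint q 3) (e (c (e (e v))))
    - c (e (e (e v))) = 0"
  "c (c (c (e v))) - scale (qint q 3) (c (c (e (c v)))) + scale (qint q 3) (c (e (c (c v))))
    - e (c (c (c v))) = 0"
  using opE_serre[OF acting_gens(1) acting_gens(1), of N0 N1 v] opE_serre[OF acting_gens(1) acting_gens(1), of N1 N0 v]
  by (simp_all add: e_def c_def)

lemma borel_invariant':
  assumes W: "subspace W" and inv: "\<And>w. w \<in> W \<Longrightarrow> k w \<in> W" "\<And>w. w \<in> W \<Longrightarrow> k' w \<in> W"
    "\<And>w. w \<in> W \<Longrightarrow> e w \<in> W" "\<And>w. w \<in> W \<Longrightarrow> c w \<in> W"
    and x: "x \<in> borel_carrier q" and w: "w \<in> W"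
  shows "\<rho> x w \<in> W"
proof (rule borel_invariant[OF W _ _ x w])
  show "opK s i w \<in> W" if "w \<in> W" for s i w
    using inv(1,2)[OF that] subspace_scale[OF W]
    by (cases s; cases i) (simp_all add: opK_N0 opK_N1)
  show "opE Pos i w \<in> W" if "w \<in> W" for i w
    using inv(3,4)[OF that] by (cases i) (simp_all add: e_def c_def)
qed

lemma weight_operatorI:
  assumes "span (\<Union>i\<in>{0..d}. eigenspace k (q powi (2 * i - d))) = UNIV"
  shows "weight_operator scale q d k k'"
  by (intro weight_operator.intro linear_space_axioms weight_operator_axioms.intro q0 q1 endo_k endo_k'
      k_k' k'_k assms)

lemma eigenspace_k: "eigenspace k \<mu> = eigenspace (opK Pos N0) (\<epsilon>0 * \<mu>)"
proof -
  have "k v = scale \<mu> v \<longleftrightarrow> opK Pos N0 v = scale (\<epsilon>0 * \<mu>) v" for v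
  proof
    assume "k v = scale \<mu> v"
    then show "opK Pos N0 v = scale (\<epsilon>0 * \<mu>) v" by (simp add: opK_N0)
  next
    assume "opK Pos N0 v = scale (\<epsilon>0 * \<mu>) v"
    then show "k v = scale \<mu> v" by (simp add: k_def sign_cancel)
  qed
  then show ?thesis by (simp add: eigenspace_def)
qed

end

text \<open>The same over the whole algebra.\<close>

locale typed_full_action = typed_action scale q "carrier (uq q)" \<rho> Basis \<epsilon>0 \<epsilon>1
  for scale :: "'f::field \<Rightarrow> 'v::ab_group_add \<Rightarrow> 'v" and q \<rho> Basis \<epsilon>0 \<epsilon>1
begin

lemma acting_all: "x \<in> acting"
  by (simp add: acting_def uq_class_closed)

lemma opE_Neg: "opE Neg N0 v = scale \<epsilon>0 (f v)" "opE Neg N1 v = scale \<epsilon>1 (g v)"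
  using sq0 sq1 by (simp_all add: f_def g_def)

lemma endo_f: "endo f" and endo_g: "endo g"
  using endo_opE[OF acting_all]
  by (simp_all add: f_def[abs_def] g_def[abs_def] endo_iff scale_right_distrib mult.commute)

lemma k_f: "k (f v) = scale (q powi -2) (f (k v))"
  and k'_g: "k' (g v) = scale (q powi -2) (g (k' v))"
proof -
  show "k (f v) = scale (q powi -2) (f (k v))"
    using opK_opE'[OF acting_all, of N0 Neg N0 v]
    by (simp add: k_def f_def endo_scale[OF endo_opE[OF acting_all]] endo_scale[OF endo_opK] mult.commute)
  have "opK Pos N1 (g v) = scale (q powi -2) (g (opK Pos N1 v))"
    using opK_opE'[OF acting_all, of N1 Neg N1 v]
    by (simp add: g_def endo_scale[OF endo_opE[OF acting_all]] endo_scale[OF endo_opK] mult.commute)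
  then have "scale \<epsilon>1 (k' (g v)) = scale \<epsilon>1 (scale (q powi -2) (g (k' v)))"
    by (simp add: opK_N1 endo_scale[OF endo_g] mult.commute)
  then have "scale (\<epsilon>1 * \<epsilon>1) (k' (g v)) = scale (\<epsilon>1 * \<epsilon>1) (scale (q powi -2) (g (k' v)))"
    by (metis scale_scale)
  then show "k' (g v) = scale (q powi -2) (g (k' v))" by (simp add: sq1)
qed

lemma e_f: "e (f v) - f (e v) = scale (inverse (q - inverse q)) (k v - k' v)"
  and c_g: "c (g v) - g (c v) = scale (inverse (q - inverse q)) (k' v - k v)"
proof -
  have "scale \<epsilon>0 (e (opE Neg N0 v) - opE Neg N0 (e v))
      = scale \<epsilon>0 (scale (inverse (q - inverse q)) (opK Pos N0 v - opK Neg N0 v))"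
    using opE_same[OF acting_all, of N0 v] by (simp add: e_def)
  then show "e (f v) - f (e v) = scale (inverse (q - inverse q)) (k v - k' v)"
    by (simp add: f_def endo_scale[OF endo_e] scale_right_diff_distrib k_def k'_def mult.commute)
  have "scale \<epsilon>1 (c (opE Neg N1 v) - opE Neg N1 (c v))
      = scale \<epsilon>1 (scale (inverse (q - inverse q)) (opK Pos N1 v - opK Neg N1 v))"
    using opE_same[OF acting_all, of N1 v] by (simp add: c_def)
  then show "c (g v) - g (c v) = scale (inverse (q - inverse q)) (k' v - k v)"
    by (simp add: g_def endo_scale[OF endo_c] scale_right_diff_distrib opK_N1 sign_cancel mult.commute
        mult.left_commute)
qed

lemma c_f: "c (f v) = f (c v)" and e_g: "e (g v) = g (e v)"
  using opE_mixed[OF acting_all acting_all, of Pos v] opE_mixed[OF acting_all acting_all, of Neg v]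
  by (simp_all add: c_def e_def f_def g_def endo_scale[OF endo_opE[OF acting_all]])

lemma double_sl2:
  assumes "span (\<Union>i\<in>{0..d}. eigenspace k (q powi (2 * i - d))) = UNIV"
  shows "double_sl2_action scale q d k k' e f Basis c g"
proof -
  interpret weight_operator scale q d k k' by (rule weight_operatorI[OF assms])
  have "k' (c v) = scale (q powi 2) (c (k' v))" for v
    using k'_commute[OF k_c _ endo_c, of v] q0 by (simp flip: power_int_minus)
  then show ?thesis
    by (intro double_sl2_action.intro double_sl2_action_axioms.intro sl2_action.intro
        sl2_action_axioms.intro finite_dimensional_vector_space_axioms dual weight_operator_axioms
        endo_e endo_f endo_c endo_g k_e k_f k'_g e_f c_g)
qed

end

section \<open>Extension from the Borel subalgebra\<close>

lemma (in linear_space) eigen_direct_sum: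
  assumes "endo T" "inj_on \<mu> {..d}" "span (\<Union>i\<in>{..d}. eigenspace T (\<mu> i)) = UNIV"
  shows "direct_sum_decomposition scale d (\<lambda>i. eigenspace T (\<mu> i))"
  unfolding direct_sum_decomposition_def
proof (intro conjI allI impI)
  show "subspace (eigenspace T (\<mu> i))" for i by (rule subspace_eigenspace[OF assms(1)])
  fix v
  obtain z where z: "\<And>i. i \<in> {..d} \<Longrightarrow> z i \<in> eigenspace T (\<mu> i)" "v = (\<Sum>i\<in>{..d}. z i)"
    using span_UN_sum[of "{..d}" "\<lambda>i. eigenspace T (\<mu> i)" v] assms(3) subspace_eigenspace[OF assms(1)]
    by auto
  show "\<exists>!u. u \<in> (\<Pi>\<^sub>E i\<in>{..d}. eigenspace T (\<mu> i)) \<and> v = (\<Sum>i\<le>d. u i)"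
  proof (rule ex1I[of _ "restrict z {..d}"])
    fix u assume u: "u \<in> (\<Pi>\<^sub>E i\<in>{..d}. eigenspace T (\<mu> i)) \<and> v = (\<Sum>i\<le>d. u i)"
    have "\<forall>i\<in>{..d}. u i - z i = 0"
    proof (rule eigen_components_zero[OF _ assms(2,1)])
      show "u i - z i \<in> eigenspace T (\<mu> i)" if "i \<in> {..d}" for i
        using u z(1)[OF that] that by (intro subspace_diff subspace_eigenspace[OF assms(1)]) auto
      show "(\<Sum>i\<in>{..d}. u i - z i) = 0" using u z(2) by (simp add: sum_subtractf)
    qed simp
    then have "u i = restrict z {..d} i" for i
      using PiE_arb[OF conjunct1[OF u], of i] by (cases "i \<in> {..d}") simp_all
    then show "u = restrict z {..d}" ..
  qed (use z in auto)
qed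

lemma (in linear_space) direct_sum_span:
  assumes "direct_sum_decomposition scale d U"
  shows "span (\<Union>i\<in>{..d}. U i) = UNIV"
proof -
  have "v \<in> span (\<Union>i\<in>{..d}. U i)" for v
  proof -
    obtain u where u: "u \<in> (\<Pi>\<^sub>E i\<in>{..d}. U i)" "v = (\<Sum>i\<le>d. u i)"
      using assms unfolding direct_sum_decomposition_def by blast
    show ?thesis unfolding u(2) using u(1) by (intro span_sum span_base) auto
  qed
  then show ?thesis by auto
qed

lemma UN_int_atMost: "(\<Union>i\<in>{0..int d}. F i) = (\<Union>i\<in>{..d}. F (int i))"
proof -
  have "{0..int d} = int ` {..d}" by (simp add: image_int_atLeastAtMost atMost_atLeast0)
  then show ?thesis by simp
qed

lemma (in borel_operators) uq_operatorsI:
  assumes f: "lowering f" and g: "borel_operators.lowering scale q k' k c e g"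
    and sq: "\<epsilon>0 * \<epsilon>0 = 1" "\<epsilon>1 * \<epsilon>1 = 1"
    and \<kappa>: "\<kappa> Pos N0 = (\<lambda>v. scale \<epsilon>0 (k v))" "\<kappa> Neg N0 = (\<lambda>v. scale \<epsilon>0 (k' v))"
      "\<kappa> Pos N1 = (\<lambda>v. scale \<epsilon>1 (k' v))" "\<kappa> Neg N1 = (\<lambda>v. scale \<epsilon>1 (k v))"
    and \<eta>: "\<eta> Pos N0 = e" "\<eta> Pos N1 = c" "\<eta> Neg N0 = (\<lambda>v. scale \<epsilon>0 (f v))" "\<eta> Neg N1 = (\<lambda>v. scale \<epsilon>1 (g v))"
  shows "uq_operators q \<kappa> \<eta>"
proof -
  interpret S: borel_operators scale q d k' k Basis c e by (rule swapped)
  note serre_fg = lowering_serre[OF f g] S.lowering_serre[OF g f]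
  have f: "endo f" "\<And>v. k (f v) = scale (q powi -2) (f (k v))"
    "\<And>v. e (f v) - f (e v) = scale (inverse (q - inverse q)) (k v - k' v)" "\<And>v. c (f v) = f (c v)"
    using f by (simp_all add: lowering_def)
  have g: "endo g" "\<And>v. k' (g v) = scale (q powi -2) (g (k' v))"
    "\<And>v. c (g v) - g (c v) = scale (inverse (q - inverse q)) (k' v - k v)" "\<And>v. e (g v) = g (e v)"
    using g by (simp_all add: S.lowering_def)
  have kf: "k (f v) = scale (inverse qq) (f (k v))" for v using f(2)[of v] by (simp only: powi_double)
  have kg: "k' (g v) = scale (inverse qq) (g (k' v))" for v using g(2)[of v] by (simp only: powi_double)
  have k'f: "k' (f v) = scale qq (f (k' v))" for v
    using k'_commute[of f "inverse qq" v] kf f(1) qq_nonzero by simp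
  have k'g: "k (g v) = scale qq (g (k v))" for v
    using S.k'_commute[of g "inverse qq" v] kg g(1) qq_nonzero by simp
  note fg_simps = simps endo_simps[OF f(1)] endo_simps[OF g(1)]
  have sqm: "\<epsilon>0 * (\<epsilon>0 * x) = x" "\<epsilon>1 * (\<epsilon>1 * x) = x" for x
    using sq by (simp_all add: mult.assoc[symmetric])
  show ?thesis
    unfolding uq_operators_def
  proof (intro conjI allI impI)
    fix s i j v
    show "endo (\<kappa> s i)" "endo (\<eta> s i)"
      by (cases s; cases i; simp add: \<kappa> \<eta> endo_iff fg_simps scale_right_distrib mult.commute)+
    show "\<kappa> s i (\<kappa> (opp s) i v) = v"
      by (cases s; cases i) (simp_all add: \<kappa> simps k_k' k'_k sq)
    show "\<kappa> Pos N0 (\<kappa> Pos N1 v) = \<kappa> Pos N1 (\<kappa> Pos N0 v)"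
      by (simp add: \<kappa> simps k_k' k'_k mult.commute)
    show "\<kappa> Pos i (\<eta> s j (\<kappa> Neg i v)) = scale (q powi ((if i = j then 2 else - 2) * sgn_int s)) (\<eta> s j v)"
    proof -
      have pw: "q powi ((if i = j then 2 else - 2) * sgn_int s)
          = (if (i = j) = (s = Pos) then qq else inverse qq)"
        using powi_double by (cases s) auto
      show ?thesis
        unfolding pw
        by (cases s; cases i; cases j)
          (simp_all add: \<kappa> \<eta> k_ec k'_ec kf kg k'f k'g k_k' k'_k fg_simps sq sqm mult.left_commute
            mult.commute)
    qed
    show "\<eta> Pos i (\<eta> Neg i v) - \<eta> Neg i (\<eta> Pos i v)
       = scale (inverse (q - inverse q)) (\<kappa> Pos i v - \<kappa> Neg i v)"
    proof (cases i)
      case N0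
      have "scale \<epsilon>0 (e (f v) - f (e v)) = scale \<epsilon>0 (scale (inverse (q - inverse q)) (k v - k' v))"
        by (simp only: f(3))
      then show ?thesis by (simp add: N0 \<kappa> \<eta> simps scale_right_diff_distrib mult.commute)
    next
      case N1
      have "scale \<epsilon>1 (c (g v) - g (c v)) = scale \<epsilon>1 (scale (inverse (q - inverse q)) (k' v - k v))"
        by (simp only: g(3))
      then show ?thesis by (simp add: N1 \<kappa> \<eta> simps scale_right_diff_distrib mult.commute)
    qed
    show "\<eta> s N0 (\<eta> (opp s) N1 v) = \<eta> (opp s) N1 (\<eta> s N0 v)"
      by (cases s) (simp_all add: \<eta> simps f(4) g(4))
    assume ij: "i \<noteq> j"
    show "\<eta> s i (\<eta> s i (\<eta> s i (\<eta> s j v)))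
       - scale (qint q 3) (\<eta> s i (\<eta> s i (\<eta> s j (\<eta> s i v))))
       + scale (qint q 3) (\<eta> s i (\<eta> s j (\<eta> s i (\<eta> s i v))))
       - \<eta> s j (\<eta> s i (\<eta> s i (\<eta> s i v))) = 0"
    proof (cases s)
      case Pos
      then show ?thesis using ij serre[of v] serre'[of v] by (cases i; cases j) (simp_all add: \<eta>)
    next
      case Neg
      have "scale (\<epsilon>0 * \<epsilon>1) (f (f (f (g v))) - scale (qint q 3) (f (f (g (f v))))
          + scale (qint q 3) (f (g (f (f v)))) - g (f (f (f v)))) = 0"
        "scale (\<epsilon>0 * \<epsilon>1) (g (g (g (f v))) - scale (qint q 3) (g (g (f (g v))))
          + scale (qint q 3) (g (f (g (g v)))) - f (g (g (g v)))) = 0"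
        by (simp_all only: serre_fg scale_zero_right)
      then show ?thesis
        using Neg ij
        by (cases i; cases j)
          (simp_all add: \<eta> fg_simps scale_right_distrib scale_right_diff_distrib sqm mult.commute
            mult.left_commute)
    qed
  qed
qed

context typed_action
begin

lemma borel_operatorsI:
  assumes d: "0 \<le> d" and span: "span (\<Union>i\<in>{0..d}. eigenspace k (q powi (2 * i - d))) = UNIV"
    and ne: "\<And>i. i \<in> {0..d} \<Longrightarrow> eigenspace k (q powi (2 * i - d)) \<noteq> {0}"
    and irr: "\<And>W. subspace W \<Longrightarrow> (\<And>x w. x \<in> borel_carrier q \<Longrightarrow> w \<in> W \<Longrightarrow> \<rho> x w \<in> W)
      \<Longrightarrow> W = {0} \<or> W = UNIV"
  shows "borel_operators scale q d k k' Basis e c"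
proof -
  interpret weight_operator scale q d k k' by (rule weight_operatorI[OF span])
  have "borel_triple_axioms scale q d k e c"
  proof (rule borel_triple_axioms.intro)
    show "W = {0} \<or> W = UNIV"
      if W: "subspace W" "\<And>w. w \<in> W \<Longrightarrow> k w \<in> W" "\<And>w. w \<in> W \<Longrightarrow> e w \<in> W" "\<And>w. w \<in> W \<Longrightarrow> c w \<in> W" for W
    proof (rule irr[OF W(1)])
      fix x w assume "x \<in> borel_carrier q" "w \<in> W"
      then show "\<rho> x w \<in> W"
        using borel_invariant'[OF W(1,2) invariant_k'[OF W(1,2)] W(3,4)] by blast
    qed
    show "wt 0 \<noteq> {0}" "wt d \<noteq> {0}" using ne[of 0] ne[of d] d by (simp_all add: wt_def)
  qed (fact d endo_e endo_c k_e k_c serre(1))+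
  moreover have "borel_operators_axioms scale q e c"
    by (rule borel_operators_axioms.intro) (rule serre(2))
  ultimately show ?thesis
    using weight_operator_axioms finite_dimensional_vector_space_axioms
    by (simp only: borel_operators_def borel_triple_def)
qed

lemma extension_typed:
  assumes \<sigma>: "is_module_action (uq q) (uq_const q) scale \<sigma>"
    and ext: "\<And>x. x \<in> borel_carrier q \<Longrightarrow> \<sigma> x = \<rho> x"
  shows "typed_full_action scale q \<sigma> Basis \<epsilon>0 \<epsilon>1"
proof -
  have "\<sigma> (uq_K q Pos N0) (\<sigma> (uq_K q Pos N1) v) = scale (\<epsilon>0 * \<epsilon>1) v" for v
    using central[of v] ext[OF generators_mem_borel(1)] by simp
  then show ?thesis
    unfolding typed_full_action_def
    by (intro typed_action.intro full_action[OF \<sigma>] finite_dimensional_vector_space_axioms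
        typed_action_axioms.intro q0 q1 sq0 sq1)
qed

lemma extension_lowering:
  assumes O: "borel_operators scale q d k k' Basis e c"
    and \<sigma>: "is_module_action (uq q) (uq_const q) scale \<sigma>"
    and ext: "\<And>x. x \<in> borel_carrier q \<Longrightarrow> \<sigma> x = \<rho> x"
  shows "borel_operators.lowering scale q k k' e c (\<lambda>v. scale \<epsilon>0 (\<sigma> (uq_E q Neg N0) v))"
    "borel_operators.lowering scale q k' k c e (\<lambda>v. scale \<epsilon>1 (\<sigma> (uq_E q Neg N1) v))"
proof -
  interpret O: borel_operators scale q d k k' Basis e c by (rule O)
  interpret S: borel_operators scale q d k' k Basis c e by (rule O.swapped)
  interpret T: typed_full_action scale q \<sigma> Basis \<epsilon>0 \<epsilon>1 by (rule extension_typed[OF \<sigma> ext])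
  have eq: "T.k = k" "T.k' = k'" "T.e = e" "T.c = c"
    by (simp_all add: fun_eq_iff k_def k'_def e_def c_def T.k_def T.k'_def T.e_def T.c_def ext generators_mem_borel)
  show "O.lowering (\<lambda>v. scale \<epsilon>0 (\<sigma> (uq_E q Neg N0) v))"
    using T.endo_f T.k_f T.e_f T.c_f unfolding eq T.f_def by (simp add: O.lowering_def T.f_def[abs_def])
  show "S.lowering (\<lambda>v. scale \<epsilon>1 (\<sigma> (uq_E q Neg N1) v))"
    using T.endo_g T.k'_g T.c_g T.e_g unfolding eq T.g_def by (simp add: S.lowering_def T.g_def[abs_def])
qed

lemma extension_unique:
  assumes O: "borel_operators scale q d k k' Basis e c"
    and \<sigma>: "is_module_action (uq q) (uq_const q) scale \<sigma>" "\<And>x. x \<in> borel_carrier q \<Longrightarrow> \<sigma> x = \<rho> x"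
    and \<tau>: "is_module_action (uq q) (uq_const q) scale \<tau>" "\<And>x. x \<in> borel_carrier q \<Longrightarrow> \<tau> x = \<rho> x"
    and x: "x \<in> carrier (uq q)"
  shows "\<sigma> x = \<tau> x"
proof (rule module_determined_by_operators[OF \<sigma>(1) \<tau>(1) _ _ x])
  interpret O: borel_operators scale q d k k' Basis e c by (rule O)
  interpret S: borel_operators scale q d k' k Basis c e by (rule O.swapped)
  show "\<sigma> (uq_K q s i) = \<tau> (uq_K q s i)" for s i
    by (simp add: \<sigma>(2) \<tau>(2) generators_mem_borel)
  have "(\<lambda>v. scale \<epsilon>0 (\<sigma> (uq_E q Neg N0) v)) = (\<lambda>v. scale \<epsilon>0 (\<tau> (uq_E q Neg N0) v))"
    by (rule O.lowering_unique[OF extension_lowering(1)[OF O \<sigma>] extension_lowering(1)[OF O \<tau>]])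
  then have 0: "\<sigma> (uq_E q Neg N0) = \<tau> (uq_E q Neg N0)"
    using sq0 by (auto simp: fun_eq_iff)
  have "(\<lambda>v. scale \<epsilon>1 (\<sigma> (uq_E q Neg N1) v)) = (\<lambda>v. scale \<epsilon>1 (\<tau> (uq_E q Neg N1) v))"
    by (rule S.lowering_unique[OF extension_lowering(2)[OF O \<sigma>] extension_lowering(2)[OF O \<tau>]])
  then have 1: "\<sigma> (uq_E q Neg N1) = \<tau> (uq_E q Neg N1)"
    using sq1 by (auto simp: fun_eq_iff)
  show "\<sigma> (uq_E q s i) = \<tau> (uq_E q s i)" for s i
    using 0 1 by (cases s; cases i) (simp_all add: \<sigma>(2) \<tau>(2) generators_mem_borel)
qed

lemma extension_exists:
  assumes O: "borel_operators scale q d k k' Basis e c"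
  obtains \<sigma> where "\<sigma> \<in> extensional (carrier (uq q))" "is_module_action (uq q) (uq_const q) scale \<sigma>"
    "\<And>x. x \<in> borel_carrier q \<Longrightarrow> \<sigma> x = \<rho> x"
proof -
  interpret O: borel_operators scale q d k k' Basis e c by (rule O)
  interpret S: borel_operators scale q d k' k Basis c e by (rule O.swapped)
  obtain f g where fg: "O.lowering f" "S.lowering g" using O.lowering_exists S.lowering_exists by blast
  define \<kappa> where "\<kappa> s i = \<rho> (uq_K q s i)" for s i
  define \<eta> where "\<eta> s i = (case s of Pos \<Rightarrow> \<rho> (uq_E q Pos i)
      | Neg \<Rightarrow> (case i of N0 \<Rightarrow> (\<lambda>v. scale \<epsilon>0 (f v)) | N1 \<Rightarrow> (\<lambda>v. scale \<epsilon>1 (g v))))" for s i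
  have "uq_operators q \<kappa> \<eta>"
    by (rule O.uq_operatorsI[OF fg sq0 sq1])
      (simp_all add: \<kappa>_def \<eta>_def opK_N0 opK_N1 e_def c_def fun_eq_iff)
  then obtain \<sigma> where \<sigma>: "\<sigma> \<in> extensional (carrier (uq q))" "is_module_action (uq q) (uq_const q) scale \<sigma>"
    "\<And>s i. \<sigma> (uq_K q s i) = \<kappa> s i" "\<And>s i. \<sigma> (uq_E q s i) = \<eta> s i"
    by (rule module_of_operators) blast
  moreover have "\<sigma> x = \<rho> x" if "x \<in> borel_carrier q" for x
    by (rule borel_action_determined[OF full_action[OF \<sigma>(2)] uq_partial_action_axioms _ _ that])
      (simp_all add: \<sigma>(3,4) \<kappa>_def \<eta>_def)
  ultimately show ?thesis using that by blast
qed

end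

section \<open>Restriction to the Borel subalgebra\<close>

lemma (in linear_space) borel_action_of_module:
  assumes "is_module_action (uq q) (uq_const q) scale \<sigma>"
  shows "is_module_action (borel q) (uq_const q) scale (restrict \<sigma> (carrier (borel q)))"
proof -
  interpret B: ring "borel q" by (rule ring_borel)
  have sub: "x \<in> carrier (uq q)" if "x \<in> carrier (borel q)" for x
    using that subringE(1)[OF subring_borel_carrier] by (auto simp: borel_def)
  have const: "uq_const q a \<in> carrier (borel q)" for a
    unfolding borel_def borel_carrier_def by (auto intro: generate_ring.incl)
  have "x \<oplus>\<^bsub>borel q\<^esub> y = x \<oplus>\<^bsub>uq q\<^esub> y" "x \<otimes>\<^bsub>borel q\<^esub> y = x \<otimes>\<^bsub>uq q\<^esub> y" "\<one>\<^bsub>borel q\<^esub> = \<one>\<^bsub>uq q\<^esub>" for x y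
    by (simp_all add: borel_def)
  note eq = this
  show ?thesis
    using assms B.add.m_closed B.m_closed B.one_closed
    unfolding is_module_action_def by (simp add: sub const eq)
qed

lemma (in typed_action) borel_type_span:
  assumes "direct_sum_decomposition scale d U"
    and "\<And>i u. i \<le> d \<Longrightarrow> u \<in> U i \<Longrightarrow> opK Pos N0 u - scale (\<epsilon>0 * q powi (2 * int i - int d)) u = 0"
  shows "span (\<Union>i\<in>{0..int d}. eigenspace k (q powi (2 * i - int d))) = UNIV"
proof -
  have "U i \<subseteq> eigenspace k (q powi (2 * int i - int d))" if "i \<le> d" for i
    unfolding eigenspace_k using assms(2)[OF that] by (auto simp: eigenspace_def)
  then have "(\<Union>i\<in>{..d}. U i) \<subseteq> (\<Union>i\<in>{0..int d}. eigenspace k (q powi (2 * i - int d)))"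
    unfolding UN_int_atMost by blast
  then show ?thesis using direct_sum_span[OF assms(1)] span_mono by blast
qed

text \<open>
  On an irreducible module over the whole algebra, the sum of the eigenspaces of \<open>K\<^sub>0\<close> is a submodule.
\<close>

lemma (in typed_full_action) eigenspaces_span:
  assumes irr: "\<And>W. subspace W \<Longrightarrow> (\<And>x w. x \<in> carrier (uq q) \<Longrightarrow> w \<in> W \<Longrightarrow> \<rho> x w \<in> W)
      \<Longrightarrow> W = {0} \<or> W = UNIV"
    and ev: "eigenvalues scale (opK Pos N0) = {\<epsilon>0 * q powi (2 * int i - int d) | i. i \<le> d}"
  shows "span (\<Union>i\<in>{0..int d}. eigenspace k (q powi (2 * i - int d))) = UNIV"
    and "i \<in> {0..int d} \<Longrightarrow> eigenspace k (q powi (2 * i - int d)) \<noteq> {0}"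
proof -
  let ?F = "\<lambda>i. eigenspace k (q powi (2 * i - int d))"
  have e0: "\<epsilon>0 \<noteq> 0" using sq0 by auto
  have nonzero: "?F i \<noteq> {0}" if "i \<in> {0..int d}" for i
  proof -
    have "\<epsilon>0 * q powi (2 * int (nat i) - int d) \<in> eigenvalues scale (opK Pos N0)"
      unfolding ev using that by (intro CollectI exI[of _ "nat i"] conjI refl) (simp add: nat_le_iff)
    then show ?thesis
      unfolding eigenspace_k using that by (auto simp: eigenvalues_def eigenspace_def)
  qed
  then show "i \<in> {0..int d} \<Longrightarrow> ?F i \<noteq> {0}" for i .
  have range: "i \<in> {0..int d}" if "v \<in> ?F i" "v \<noteq> 0" for i v
  proof -
    have "\<epsilon>0 * q powi (2 * i - int d) \<in> eigenvalues scale (opK Pos N0)"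
      using that unfolding eigenspace_k by (auto simp: eigenspace_def eigenvalues_def)
    then obtain j where j: "j \<le> d" "q powi (2 * i - int d) = q powi (2 * int j - int d)"
      unfolding ev using e0 by auto
    have "2 * i - int d = 2 * int j - int d"
      using j(2) powi_inject[OF q0 q1] by blast
    then show ?thesis using j(1) by simp
  qed
  let ?W = "span (\<Union>i\<in>{0..int d}. ?F i)"
  have mem: "v \<in> ?W" if "v \<in> ?F i" for v i
    using that range[OF that] by (cases "v = 0") (auto intro!: span_base span_zero)
  have shift: "t v \<in> ?F (i + s)"
    if t: "endo t" "\<And>v. k (t v) = scale (q powi (2 * s)) (t (k v))" and v: "v \<in> ?F i" for t s v i
  proof -
    have "k (t v) = scale (q powi (2 * s) * q powi (2 * i - int d)) (t v)"
      using v by (simp add: eigenspace_def t(2) endo_scale[OF t(1)])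
    also have "q powi (2 * s) * q powi (2 * i - int d) = q powi (2 * (i + s) - int d)"
      using q0 by (simp flip: power_int_add add: algebra_simps)
    finally show ?thesis by (simp add: eigenspace_def)
  qed
  have inv: "t w \<in> ?W"
    if t: "endo t" "\<And>v. k (t v) = scale (q powi (2 * s)) (t (k v))" and w: "w \<in> ?W" for t s w
    by (rule endo_span[OF t(1) subspace_span _ w]) (use shift[OF t] mem in blast)
  have k_g: "k (g v) = scale (q powi (2 * 1)) (g (k v))" for v
  proof -
    have "k' (g (k v)) = scale (q powi -2) (g v)" using k'_g[of "k v"] k'_k by simp
    then have "g (k v) = scale (q powi -2) (k (g v))"
      using k_k'[of "g (k v)"] by (simp add: endo_scale[OF endo_k])
    then show ?thesis using q0 power_int_minus[of q 2] by simp
  qed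
  have invs: "k w \<in> ?W" "k' w \<in> ?W" "e w \<in> ?W" "c w \<in> ?W" "f w \<in> ?W" "g w \<in> ?W" if w: "w \<in> ?W" for w
    using inv[OF endo_k _ w, of 0] inv[OF endo_k' _ w, of 0] inv[OF endo_e _ w, of 1] inv[OF endo_c _ w, of "-1"]
      inv[OF endo_f _ w, of "-1"] inv[OF endo_g k_g w] k_e k_c k_f k_k' k'_k by simp_all
  have "?W = {0} \<or> ?W = UNIV"
  proof (rule irr)
    fix x w assume "x \<in> carrier (uq q)" "w \<in> ?W"
    then show "\<rho> x w \<in> ?W"
    proof (rule uq_invariant[rotated 4])
      show "is_module_action (uq q) (uq_const q) scale \<rho>" using action by simp
      show "opK s i w \<in> ?W" if "w \<in> ?W" for s i w
        using invs[OF that] by (cases s; cases i) (simp_all add: opK_N0 opK_N1 span_scale)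
      show "opE s i w \<in> ?W" if "w \<in> ?W" for s i w
        using invs[OF that] by (cases s; cases i) (simp_all add: opE_Neg span_scale flip: e_def c_def)
    qed simp
  qed simp
  moreover have "?W \<noteq> {0}"
  proof -
    obtain v where "v \<in> ?F 0" "v \<noteq> 0"
      using nonzero[of 0] subspace_0[OF subspace_eigenspace[OF endo_k]] by fastforce
    then show ?thesis using mem by blast
  qed
  ultimately show "?W = UNIV" by blast
qed

text \<open>A subspace that is invariant under the Borel subalgebra is a submodule.\<close>

lemma (in typed_full_action) borel_irreducible:
  assumes span: "span (\<Union>i\<in>{0..d}. eigenspace k (q powi (2 * i - d))) = UNIV"
    and W: "subspace W" "\<And>x w. x \<in> borel_carrier q \<Longrightarrow> w \<in> W \<Longrightarrow> \<rho> x w \<in> W"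
    and x: "x \<in> carrier (uq q)" and w: "w \<in> W"
  shows "\<rho> x w \<in> W"
proof -
  interpret D: double_sl2_action scale q d k k' e f Basis c g by (rule double_sl2[OF span])
  interpret S: double_sl2_action scale q d k' k c g Basis e f by (rule D.swapped)
  have inv: "k w \<in> W" "k' w \<in> W" "e w \<in> W" "c w \<in> W" if "w \<in> W" for w
    using W(2)[OF generators_mem_borel(1) that] W(2)[OF generators_mem_borel(2) that] subspace_scale[OF W(1)]
    by (simp_all add: k_def k'_def e_def c_def)
  have f: "f w \<in> W" if "w \<in> W" for w using D.f_invariant'[OF W(1) inv(1,3,4) that] .
  have g: "g w \<in> W" if "w \<in> W" for w using S.f_invariant'[OF W(1) inv(2,4,3) that] .
  show ?thesis
  proof (rule uq_invariant[OF _ W(1) _ _ x w])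
    show "is_module_action (uq q) (uq_const q) scale \<rho>" using action by simp
    show "opK s i w \<in> W" if "w \<in> W" for s i w using W(2)[OF generators_mem_borel(1) that] .
    show "opE s i w \<in> W" if "w \<in> W" for s i w
      using W(2)[OF generators_mem_borel(2) that] f[OF that] g[OF that] subspace_scale[OF W(1)]
      by (cases s; cases i) (simp_all add: opE_Neg)
  qed
qed

theorem theorem13p1:
  fixes q \<epsilon>0 \<epsilon>1 :: "'f::alg_closed_field"
    and scale :: "'f \<Rightarrow> 'v::ab_group_add \<Rightarrow> 'v"
    and Basis :: "'v set"
  assumes "q \<noteq> 0"
    and "\<And>n::nat. n > 0 \<Longrightarrow> q ^ n \<noteq> 1"
    and "\<epsilon>0 \<in> {1, -1}" and "\<epsilon>1 \<in> {1, -1}"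
    and "finite_dimensional_vector_space scale Basis"
  shows
    "(\<forall>\<rho>. borel_module q scale \<rho> \<and> is_irreducible_action (borel q) scale \<rho>
          \<and> borel_module_type q scale \<rho> (\<epsilon>0, \<epsilon>1) \<longrightarrow>
        (\<exists>!\<sigma>. \<sigma> \<in> extensional (carrier (uq q)) \<and> uq_module q scale \<sigma>
              \<and> (\<forall>x\<in>carrier (borel q). \<sigma> x = \<rho> x))
      \<and> (\<forall>\<sigma>. uq_module q scale \<sigma> \<and> (\<forall>x\<in>carrier (borel q). \<sigma> x = \<rho> x) \<longrightarrow>
            is_irreducible_action (uq q) scale \<sigma> \<and> uq_module_type q scale \<sigma> (\<epsilon>0, \<epsilon>1)))
   \<and> (\<forall>\<sigma>. uq_module q scale \<sigma> \<and> is_irreducible_action (uq q) scale \<sigma>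
          \<and> uq_module_type q scale \<sigma> (\<epsilon>0, \<epsilon>1) \<longrightarrow>
        borel_module q scale (restrict \<sigma> (carrier (borel q)))
      \<and> is_irreducible_action (borel q) scale (restrict \<sigma> (carrier (borel q)))
      \<and> borel_module_type q scale (restrict \<sigma> (carrier (borel q))) (\<epsilon>0, \<epsilon>1))"
proof -
  interpret finite_dimensional_vector_space scale Basis by (rule assms(5))
  interpret linear_space scale by unfold_locales
  have sq: "\<epsilon>0 * \<epsilon>0 = 1" "\<epsilon>1 * \<epsilon>1 = 1" using assms(3,4) by auto
  have e0: "\<epsilon>0 \<noteq> 0" using sq by auto
  have borel_sub: "borel_carrier q \<subseteq> carrier (uq q)" by (rule subringE(1)[OF subring_borel_carrier])
  have carrier_borel: "carrier (borel q) = borel_carrier q" by (simp add: borel_def)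
  have mult_borel: "x \<otimes>\<^bsub>borel q\<^esub> y = x \<otimes>\<^bsub>uq q\<^esub> y" for x y by (simp add: borel_def)
  have inj: "inj_on (\<lambda>i. \<epsilon>0 * q powi (2 * int i - int d)) {..d}" for d
    using powi_inject[OF assms(1,2)] e0 by (auto simp: inj_on_def)
  have part1: "(\<exists>!\<sigma>. \<sigma> \<in> extensional (carrier (uq q)) \<and> uq_module q scale \<sigma>
              \<and> (\<forall>x\<in>carrier (borel q). \<sigma> x = \<rho> x))
      \<and> (\<forall>\<sigma>. uq_module q scale \<sigma> \<and> (\<forall>x\<in>carrier (borel q). \<sigma> x = \<rho> x) \<longrightarrow>
            is_irreducible_action (uq q) scale \<sigma> \<and> uq_module_type q scale \<sigma> (\<epsilon>0, \<epsilon>1))"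
    if mod: "borel_module q scale \<rho>" and irr: "is_irreducible_action (borel q) scale \<rho>"
      and type: "borel_module_type q scale \<rho> (\<epsilon>0, \<epsilon>1)" for \<rho>
  proof -
    interpret P: uq_partial_action scale q "borel_carrier q" \<rho>
      by (intro uq_partial_action.intro linear_space_axioms uq_partial_action_axioms.intro
          subring_borel_carrier order_refl) (use mod in \<open>simp add: borel_module_def borel_def\<close>)
    obtain \<gamma> d U where \<gamma>: "\<And>v. \<rho> (uq_K q Pos N0 \<otimes>\<^bsub>uq q\<^esub> uq_K q Pos N1) v = scale \<gamma> v" "\<epsilon>1 = \<gamma> * inverse \<epsilon>0"
      and U: "direct_sum_decomposition scale d U" "\<And>i. i \<le> d \<Longrightarrow> U i \<noteq> {0}"
      "\<And>i u. i \<le> d \<Longrightarrow> u \<in> U i \<Longrightarrow> \<rho> (uq_K q Pos N0) u - scale (\<epsilon>0 * q powi (2 * int i - int d)) u = 0"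
      using type unfolding borel_module_type_def case_prod_conv mult_borel by blast
    have "\<gamma> = \<epsilon>0 * \<epsilon>1" using \<gamma>(2) e0 by simp
    then have central: "\<rho> (uq_K q Pos N0) (\<rho> (uq_K q Pos N1) v) = scale (\<epsilon>0 * \<epsilon>1) v" for v
      using \<gamma>(1)[of v] P.act_mult[OF P.acting_gens(2) P.acting_gens(2), of Pos N0 Pos N1 v]
      by (simp add: P.act_def uq_class_mult uq_K_def)
    interpret T: typed_action scale q "borel_carrier q" \<rho> Basis \<epsilon>0 \<epsilon>1
      by (intro typed_action.intro P.uq_partial_action_axioms finite_dimensional_vector_space_axioms
          typed_action_axioms.intro assms(1,2) sq central)
    have span: "span (\<Union>i\<in>{0..int d}. eigenspace T.k (q powi (2 * i - int d))) = UNIV"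
      by (rule T.borel_type_span[OF U(1,3)])
    have ne: "eigenspace T.k (q powi (2 * i - int d)) \<noteq> {0}" if "i \<in> {0..int d}" for i
    proof -
      have i: "nat i \<le> d" "int (nat i) = i" using that by auto
      have "U (nat i) \<subseteq> eigenspace T.k (q powi (2 * i - int d))"
        unfolding T.eigenspace_k using U(3)[OF i(1)] unfolding i(2) by (auto simp: eigenspace_def)
      moreover have "0 \<in> U (nat i)"
        using U(1) i(1) subspace_0 unfolding direct_sum_decomposition_def by blast
      ultimately show ?thesis using U(2)[OF i(1)] by blast
    qed
    have irr': "W = {0} \<or> W = UNIV"
      if "subspace W" "\<And>x w. x \<in> borel_carrier q \<Longrightarrow> w \<in> W \<Longrightarrow> \<rho> x w \<in> W" for W
      using irr that unfolding is_irreducible_action_def carrier_borel by blast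
    have O: "borel_operators scale q (int d) T.k T.k' Basis T.e T.c"
      by (rule T.borel_operatorsI[OF _ span ne irr']) auto
    obtain \<sigma> where \<sigma>: "\<sigma> \<in> extensional (carrier (uq q))" "is_module_action (uq q) (uq_const q) scale \<sigma>"
      "\<And>x. x \<in> borel_carrier q \<Longrightarrow> \<sigma> x = \<rho> x"
      using T.extension_exists[OF O] by blast
    have "\<exists>!\<sigma>. \<sigma> \<in> extensional (carrier (uq q)) \<and> uq_module q scale \<sigma>
        \<and> (\<forall>x\<in>carrier (borel q). \<sigma> x = \<rho> x)"
      unfolding uq_module_def carrier_borel
    proof (rule ex1I[of _ \<sigma>])
      fix \<tau>
      assume "\<tau> \<in> extensional (carrier (uq q)) \<and> is_module_action (uq q) (uq_const q) scale \<tau>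
        \<and> (\<forall>x\<in>borel_carrier q. \<tau> x = \<rho> x)"
      then show "\<tau> = \<sigma>"
        using T.extension_unique[OF O _ _ \<sigma>(2,3), of \<tau>] \<sigma>(1) by (intro extensionalityI[where A = "carrier (uq q)"]) auto
    qed (use \<sigma> in simp)
    moreover have "is_irreducible_action (uq q) scale \<tau> \<and> uq_module_type q scale \<tau> (\<epsilon>0, \<epsilon>1)"
      if \<tau>: "uq_module q scale \<tau>" "\<forall>x\<in>carrier (borel q). \<tau> x = \<rho> x" for \<tau>
    proof
      have ext: "\<tau> x = \<rho> x" if "x \<in> borel_carrier q" for x using \<tau>(2) that by (simp add: carrier_borel)
      show "is_irreducible_action (uq q) scale \<tau>"
        unfolding is_irreducible_action_def
      proof (intro conjI allI impI)
        show "(UNIV :: 'v set) \<noteq> {0}" using irr by (simp add: is_irreducible_action_def)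
        fix W assume W: "subspace W \<and> (\<forall>x\<in>carrier (uq q). \<forall>w\<in>W. \<tau> x w \<in> W)"
        show "W = {0} \<or> W = UNIV"
        proof (rule irr')
          show "\<rho> x w \<in> W" if "x \<in> borel_carrier q" "w \<in> W" for x w
            using W that borel_sub ext[OF that(1)] by (metis subsetD)
        qed (use W in simp)
      qed
      interpret F: uq_partial_action scale q "carrier (uq q)" \<tau>
        using \<tau>(1) by (intro full_action) (simp add: uq_module_def)
      have acting: "y \<in> F.acting" for y by (simp add: F.acting_def uq_class_closed)
      have 1: "\<tau> (uq_K q Pos N0 \<otimes>\<^bsub>uq q\<^esub> uq_K q Pos N1) v = scale (\<epsilon>0 * \<epsilon>1) v" for v
        using central[of v] F.act_mult[OF acting acting, of "fa_gen (K Pos N0)" "fa_gen (K Pos N1)" v]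
        by (simp add: F.act_def uq_class_mult uq_K_def ext[OF generators_mem_borel(1), unfolded uq_K_def])
      have sp: "span (\<Union>i\<in>{..d}. eigenspace (\<rho> (uq_K q Pos N0)) (\<epsilon>0 * q powi (2 * int i - int d))) = UNIV"
        using span unfolding UN_int_atMost T.eigenspace_k .
      have "eigenvalues scale (\<rho> (uq_K q Pos N0)) = {\<epsilon>0 * q powi (2 * int i - int d) | i. i \<le> d}"
      proof (rule subset_antisym; rule subsetI)
        fix \<theta> assume "\<theta> \<in> eigenvalues scale (\<rho> (uq_K q Pos N0))"
        then obtain v where "v \<noteq> 0" "v \<in> eigenspace (\<rho> (uq_K q Pos N0)) \<theta>"
          by (auto simp: eigenvalues_def eigenspace_def)
        then show "\<theta> \<in> {\<epsilon>0 * q powi (2 * int i - int d) | i. i \<le> d}"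
          using eigenvalue_of_spanning[OF _ inj P.endo_opK sp] by auto
      next
        fix \<theta> assume "\<theta> \<in> {\<epsilon>0 * q powi (2 * int i - int d) | i. i \<le> d}"
        then obtain i where i: "i \<le> d" "\<theta> = \<epsilon>0 * q powi (2 * int i - int d)" by blast
        obtain v where v: "v \<in> eigenspace T.k (q powi (2 * int i - int d))" "v \<noteq> 0"
          using ne[of "int i"] i(1) subspace_0[OF subspace_eigenspace[OF T.endo_k]] by fastforce
        then show "\<theta> \<in> eigenvalues scale (\<rho> (uq_K q Pos N0))"
          unfolding i(2) T.eigenspace_k by (auto simp: eigenvalues_def eigenspace_def)
      qed
      then show "uq_module_type q scale \<tau> (\<epsilon>0, \<epsilon>1)"
        unfolding uq_module_type_def using assms(3,4) 1 ext[OF generators_mem_borel(1)] by auto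
    qed
    ultimately show ?thesis by blast
  qed
  have part2: "borel_module q scale (restrict \<sigma> (carrier (borel q)))
      \<and> is_irreducible_action (borel q) scale (restrict \<sigma> (carrier (borel q)))
      \<and> borel_module_type q scale (restrict \<sigma> (carrier (borel q))) (\<epsilon>0, \<epsilon>1)"
    if mod: "uq_module q scale \<sigma>" and irr: "is_irreducible_action (uq q) scale \<sigma>"
      and type: "uq_module_type q scale \<sigma> (\<epsilon>0, \<epsilon>1)" for \<sigma>
  proof -
    have act: "is_module_action (uq q) (uq_const q) scale \<sigma>" using mod by (simp add: uq_module_def)
    interpret F: uq_partial_action scale q "carrier (uq q)" \<sigma> by (rule full_action[OF act])
    have acting: "y \<in> F.acting" for y by (simp add: F.acting_def uq_class_closed)
    obtain d where ev: "eigenvalues scale (\<sigma> (uq_K q Pos N0)) = {\<epsilon>0 * q powi (2 * int i - int d) | i. i \<le> d}"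
      and prod: "\<And>v. \<sigma> (uq_K q Pos N0 \<otimes>\<^bsub>uq q\<^esub> uq_K q Pos N1) v = scale (\<epsilon>0 * \<epsilon>1) v"
      using type unfolding uq_module_type_def case_prod_conv by blast
    have central: "\<sigma> (uq_K q Pos N0) (\<sigma> (uq_K q Pos N1) v) = scale (\<epsilon>0 * \<epsilon>1) v" for v
      using prod[of v] F.act_mult[OF acting acting, of "fa_gen (K Pos N0)" "fa_gen (K Pos N1)" v]
      by (simp add: F.act_def uq_class_mult uq_K_def)
    interpret T: typed_full_action scale q \<sigma> Basis \<epsilon>0 \<epsilon>1
      unfolding typed_full_action_def
      by (intro typed_action.intro F.uq_partial_action_axioms finite_dimensional_vector_space_axioms
          typed_action_axioms.intro assms(1,2) sq central)
    have irr': "W = {0} \<or> W = UNIV"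
      if "subspace W" "\<And>x w. x \<in> carrier (uq q) \<Longrightarrow> w \<in> W \<Longrightarrow> \<sigma> x w \<in> W" for W
      using irr that unfolding is_irreducible_action_def by blast
    have span: "span (\<Union>i\<in>{0..int d}. eigenspace T.k (q powi (2 * i - int d))) = UNIV"
      and ne: "\<And>i. i \<in> {0..int d} \<Longrightarrow> eigenspace T.k (q powi (2 * i - int d)) \<noteq> {0}"
      using T.eigenspaces_span[OF irr' ev] by blast+
    let ?\<rho> = "restrict \<sigma> (carrier (borel q))"
    have \<rho>: "?\<rho> x = \<sigma> x" if "x \<in> borel_carrier q" for x using that by (simp add: carrier_borel)
    have "borel_module q scale ?\<rho>"
      unfolding borel_module_def by (rule borel_action_of_module[OF act])
    moreover have "is_irreducible_action (borel q) scale ?\<rho>"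
      unfolding is_irreducible_action_def
    proof (intro conjI allI impI)
      show "(UNIV :: 'v set) \<noteq> {0}" using irr by (simp add: is_irreducible_action_def)
      fix W assume W: "subspace W \<and> (\<forall>x\<in>carrier (borel q). \<forall>w\<in>W. ?\<rho> x w \<in> W)"
      show "W = {0} \<or> W = UNIV"
      proof (rule irr')
        show "\<sigma> x w \<in> W" if "x \<in> carrier (uq q)" "w \<in> W" for x w
          using T.borel_irreducible[OF span _ _ that] W by (simp add: carrier_borel)
      qed (use W in simp)
    qed
    moreover have "borel_module_type q scale ?\<rho> (\<epsilon>0, \<epsilon>1)"
      unfolding borel_module_type_def case_prod_conv
    proof (intro exI conjI allI impI ballI)
      let ?U = "\<lambda>i. eigenspace (\<sigma> (uq_K q Pos N0)) (\<epsilon>0 * q powi (2 * int i - int d))"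
      have sp: "span (\<Union>i\<in>{..d}. ?U i) = UNIV"
        using span unfolding UN_int_atMost T.eigenspace_k .
      show "direct_sum_decomposition scale d ?U"
        by (rule eigen_direct_sum[OF F.endo_opK inj sp])
      have "uq_K q Pos N0 \<otimes>\<^bsub>uq q\<^esub> uq_K q Pos N1 \<in> borel_carrier q"
        by (rule subringE(6)[OF subring_borel_carrier generators_mem_borel(1) generators_mem_borel(1)])
      then show "?\<rho> (uq_K q Pos N0 \<otimes>\<^bsub>borel q\<^esub> uq_K q Pos N1) v = scale (\<epsilon>0 * \<epsilon>1) v" for v
        by (simp only: mult_borel \<rho> prod)
      show "\<epsilon>0 \<noteq> 0" by (rule e0)
      show "\<epsilon>1 = \<epsilon>0 * \<epsilon>1 * inverse \<epsilon>0" using e0 by simp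
      show "?U i \<noteq> {0}" if "i \<le> d" for i
        using ne[of "int i"] that by (simp add: T.eigenspace_k)
      show "?\<rho> (uq_K q Pos N0) u - scale (\<epsilon>0 * q powi (2 * int i - int d)) u = 0" if "u \<in> ?U i" for i u
        using that by (simp only: \<rho>[OF generators_mem_borel(1)]) (simp add: eigenspace_def)
    qed
    ultimately show ?thesis by blast
  qed
  show ?thesis using part1 part2 by blast
qed

end
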